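(* Let $\sigma(n)$ denote the sum of the positive divisors of $n$. Let $B=\{n\geq 1:\ \sigma(2n+1)\geq \sigma(2n)\}$ and let $B(x)=|\{n\in B:\ n\leq x\}|$. Then the natural density $\operatorname{dens} B=\lim_{x\to\infty}B(x)/x$ exists, and \[0.0539171 \leq \operatorname{dens} B \leq 0.0549445.\] *)

theory Defs
  imports Complex_Main
begin

(* The set of divisors of 0 is infinite, so divisor_sigma 0 = 0; only positive arguments matter. *)
definition divisor_sigma :: "nat \<Rightarrow> nat" where
  "divisor_sigma n = (\<Sum>d | d dvd n. d)"

definition count_upto :: "nat set \<Rightarrow> real \<Rightarrow> nat" where
  "count_upto A x = card {n \<in> A. real n \<le> x}"

definition has_natural_density :: "nat set \<Rightarrow> real \<Rightarrow> bool" where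
  "has_natural_density A d \<longleftrightarrow> ((\<lambda>x::real. real (count_upto A x) / x) \<longlongrightarrow> d) at_top"

definition B :: "nat set" where
  "B = {n. n \<ge> 1 \<and> divisor_sigma (2 * n + 1) \<ge> divisor_sigma (2 * n)}"

end

(*
Up to an error of at most 1/(2n), n lies in B iff the sum over the primes p of
ln (sigma(p^a)/p^a) - ln (sigma(p^b)/p^b) is nonnegative, where p^a and p^b exactly divide 2n + 1
and 2n. Cutting primes and exponents off at M gives a periodic function of n whose summands are
independent by the Chinese remainder theorem; the mean of the omitted part is at most of order 1/M.

Existence of the density. The upper densities of B and of its complement add up to at most 1 plus
the probability that the truncated sum lies in a short interval around 0. This is small: if a
prime p of a large finite set divides 2n + 1 exactly once, deleting this factor moves the sum by
-ln (1 + 1/p), the shifts of different p are well separated, and deletion changes probabilities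
only by a factor of about 1/p.

Numerical bounds. The tail function of the sum is bounded on the lattice of multiples of 1/5800.
The primes above 6000 are covered by Chernoff's bound, then the primes from 6000 down to 11 are
added one at a time with all values and weights rounded in the unfavourable direction, and the
local states of 2, 3, 5, 7 are summed exactly. The same table serves for B and for its complement,
since 2n and 2n + 1 have the same local distribution at odd primes.
*)

theory Submission
  imports Defs "HOL-Number_Theory.Number_Theory" "HOL-Analysis.Harmonic_Numbers"
    "HOL-Computational_Algebra.Squarefree"
begin

section \<open>Upper density bounds\<close>

text \<open>Only upper bounds are ever proved, for \<open>B\<close> and for its complement, so one
  kind of quantity has to be estimated: the probability that a sum of independent terms is at least
  x. It is antitone in x, which lets thresholds be rounded down and tables be cut short. Numerical
  bounds cannot by themselves give existence: the limit law might have an atom at 0, so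
  anticoncentration has to reach every error \<open>e\<close>. The evaluation is done by rewriting,
  hence with natural numbers and with division by powers of 8 only. Probabilities are therefore
  stored as multiples of a scale \<open>s\<close>; where a weight sum W ought to be divided out, the
  scale is multiplied by W / 8^k instead. The constants fit together: offsets for 2, 3, 5, 7 use
  steps of 1/371200, where 371200 = 64 * 5800, and the slack \<delta> = 1/742400 makes the threshold
  - 2 \<delta> exactly one such step. The Chernoff exponent 6000 is the largest that the moment
  bound admits for the primes above 6000.\<close>

definition upper_density_le :: "nat set \<Rightarrow> real \<Rightarrow> bool" where
  "upper_density_le A u \<longleftrightarrow>
     (\<forall>e>0. \<forall>\<^sub>F N in sequentially. real (card (A \<inter> {..<N})) \<le> (u + e) * real N)"

lemma upper_density_le_subset:
  assumes "upper_density_le A u" "C \<subseteq> A" "u \<le> v"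
  shows "upper_density_le C v"
  unfolding upper_density_le_def
proof (intro allI impI)
  fix e :: real assume "e > 0"
  then have "\<forall>\<^sub>F N in sequentially. real (card (A \<inter> {..<N})) \<le> (u + e) * real N"
    using assms(1) by (auto simp: upper_density_le_def)
  then show "\<forall>\<^sub>F N in sequentially. real (card (C \<inter> {..<N})) \<le> (v + e) * real N"
  proof eventually_elim
    case (elim N)
    have "card (C \<inter> {..<N}) \<le> card (A \<inter> {..<N})"
      using assms(2) by (intro card_mono) auto
    then have "real (card (C \<inter> {..<N})) \<le> (u + e) * real N" using elim by linarith
    also have "\<dots> \<le> (v + e) * real N" using assms(3) by (intro mult_right_mono) auto
    finally show ?case .
  qed
qed

lemma upper_density_le_Un:
  assumes "upper_density_le A u" "upper_density_le C v"
  shows "upper_density_le (A \<union> C) (u + v)"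
  unfolding upper_density_le_def
proof (intro allI impI)
  fix e :: real assume "e > 0"
  then have "e / 2 > 0" by simp
  then have "\<forall>\<^sub>F N in sequentially. real (card (A \<inter> {..<N})) \<le> (u + e/2) * real N"
    "\<forall>\<^sub>F N in sequentially. real (card (C \<inter> {..<N})) \<le> (v + e/2) * real N"
    using assms unfolding upper_density_le_def by blast+
  then show "\<forall>\<^sub>F N in sequentially. real (card ((A \<union> C) \<inter> {..<N})) \<le> (u + v + e) * real N"
  proof eventually_elim
    case (elim N)
    have "card ((A \<union> C) \<inter> {..<N}) \<le> card (A \<inter> {..<N}) + card (C \<inter> {..<N})"
      by (metis Int_Un_distrib2 card_Un_le)
    then have "real (card ((A \<union> C) \<inter> {..<N})) \<le> (u + e/2) * real N + (v + e/2) * real N"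
      using elim by linarith
    then show ?case by (simp add: algebra_simps)
  qed
qed

lemma upper_density_le_finite:
  assumes "finite A"
  shows "upper_density_le A 0"
  unfolding upper_density_le_def
proof (intro allI impI)
  fix e :: real assume "e > 0"
  show "\<forall>\<^sub>F N in sequentially. real (card (A \<inter> {..<N})) \<le> (0 + e) * real N"
    using eventually_ge_at_top[of "nat \<lceil>real (card A) / e\<rceil>"]
  proof eventually_elim
    case (elim N)
    have "real (card (A \<inter> {..<N})) \<le> real (card A)"
      using assms by (simp add: card_mono)
    also have "real (card A) / e \<le> real N" using elim by linarith
    then have "real (card A) \<le> e * real N" using \<open>e > 0\<close> by (simp add: field_simps)
    finally show ?case by simp
  qed
qed

text \<open>The limit is the infimum of all upper bounds for \<open>A\<close>. An upper bound v for
  the complement bounds the counting ratio from below by 1 - v, and \<open>gap\<close> closes the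
  interval between the two.\<close>

lemma has_natural_density_between:
  assumes b: "upper_density_le A b" and a: "upper_density_le (- A) (1 - a)"
    and gap: "\<And>e. e > 0 \<Longrightarrow> \<exists>u v. upper_density_le A u \<and> upper_density_le (- A) v \<and> u + v \<le> 1 + e"
  shows "\<exists>d. has_natural_density A d \<and> a \<le> d \<and> d \<le> b"
proof -
  define r where "r N = real (card (A \<inter> {..<N})) / real N" for N
  have up: "\<forall>\<^sub>F N in sequentially. r N \<le> u + e" if "upper_density_le A u" "e > 0" for u e
    using that(1)[unfolded upper_density_le_def, rule_format, OF that(2)] eventually_gt_at_top[of 0]
    by eventually_elim (simp add: r_def field_simps)
  have low: "\<forall>\<^sub>F N in sequentially. 1 - v - e \<le> r N" if "upper_density_le (- A) v" "e > 0" for v e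
    using that(1)[unfolded upper_density_le_def, rule_format, OF that(2)] eventually_gt_at_top[of 0]
  proof eventually_elim
    case (elim N)
    have "card (A \<inter> {..<N}) + card (- A \<inter> {..<N}) = card (A \<inter> {..<N} \<union> - A \<inter> {..<N})"
      by (rule card_Un_disjoint[symmetric]) auto
    also have "A \<inter> {..<N} \<union> - A \<inter> {..<N} = {..<N}" by auto
    finally have "real N = real (card (A \<inter> {..<N})) + real (card (- A \<inter> {..<N}))"
      by (metis card_lessThan of_nat_add)
    then show ?case using elim by (simp add: r_def field_simps)
  qed
  have cross: "1 - v \<le> u" if "upper_density_le A u" "upper_density_le (- A) v" for u v
  proof (rule ccontr)
    assume "\<not> 1 - v \<le> u"
    define e where "e = (1 - v - u) / 3"
    have "e > 0" using \<open>\<not> 1 - v \<le> u\<close> by (simp add: e_def)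
    have "\<forall>\<^sub>F N in sequentially. r N \<le> u + e \<and> 1 - v - e \<le> r N"
      using up[OF that(1) \<open>e > 0\<close>] low[OF that(2) \<open>e > 0\<close>] by (rule eventually_conj)
    then obtain N where "r N \<le> u + e" "1 - v - e \<le> r N"
      using eventually_happens by force
    moreover have "3 * e = 1 - v - u" by (simp add: e_def)
    ultimately show False using \<open>e > 0\<close> by linarith
  qed
  define d where "d = Inf {u. upper_density_le A u}"
  have bdd: "bdd_below {u. upper_density_le A u}"
    using cross[OF _ a] by (intro bdd_belowI[of _ "1 - (1 - a)"]) auto
  have d_le: "d \<le> u" if "upper_density_le A u" for u
    unfolding d_def using that bdd by (intro cInf_lower) auto
  have le_d: "1 - v \<le> d" if "upper_density_le (- A) v" for v
    unfolding d_def using b cross[OF _ that] by (intro cInf_greatest) auto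
  have "r \<longlonglongrightarrow> d"
  proof (rule LIMSEQ_I)
    fix e :: real assume "e > 0"
    then obtain u v where uv: "upper_density_le A u" "upper_density_le (- A) v" "u + v \<le> 1 + e / 3"
      using gap[of "e / 3"] by auto
    have e3: "e / 3 > 0" using \<open>e > 0\<close> by simp
    have "\<forall>\<^sub>F N in sequentially. norm (r N - d) < e"
      using up[OF uv(1) e3] low[OF uv(2) e3]
    proof eventually_elim
      case (elim N)
      then show ?case
        using d_le[OF uv(1)] le_d[OF uv(2)] uv(3) \<open>e > 0\<close> unfolding real_norm_def abs_less_iff by linarith
    qed
    then show "\<exists>no. \<forall>n\<ge>no. norm (r n - d) < e" by (simp add: eventually_sequentially)
  qed
  \<comment> \<open>The numbers up to a real x >= 0 are those below N = floor x + 1, and N / x tends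
    to 1.\<close>
  moreover have "filterlim (\<lambda>x::real. nat \<lfloor>x\<rfloor> + 1) sequentially at_top"
    unfolding filterlim_at_top
  proof
    fix Z :: nat
    show "\<forall>\<^sub>F x::real in at_top. Z \<le> nat \<lfloor>x\<rfloor> + 1"
      using eventually_ge_at_top[of "real Z"] by eventually_elim linarith
  qed
  ultimately have "((\<lambda>x::real. r (nat \<lfloor>x\<rfloor> + 1)) \<longlongrightarrow> d) at_top"
    by (rule filterlim_compose)
  moreover have "((\<lambda>x::real. real (nat \<lfloor>x\<rfloor> + 1) / x) \<longlongrightarrow> 1) at_top"
  proof (rule tendsto_sandwich[where f = "\<lambda>_. 1" and h = "\<lambda>x. 1 + 1 / x"])
    show "\<forall>\<^sub>F x::real in at_top. 1 \<le> real (nat \<lfloor>x\<rfloor> + 1) / x"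
      using eventually_gt_at_top[of 0] by eventually_elim (simp add: field_simps; linarith)
    show "\<forall>\<^sub>F x::real in at_top. real (nat \<lfloor>x\<rfloor> + 1) / x \<le> 1 + 1 / x"
      using eventually_gt_at_top[of 0] by eventually_elim (simp add: field_simps)
    have "((\<lambda>x::real. 1 / x) \<longlongrightarrow> 0) at_top"
      using tendsto_inverse_0_at_top[OF filterlim_ident] by (simp add: inverse_eq_divide)
    then show "((\<lambda>x::real. 1 + 1 / x) \<longlongrightarrow> 1) at_top"
      using tendsto_add[OF tendsto_const[of "1::real"]] by fastforce
  qed simp
  ultimately have "((\<lambda>x::real. r (nat \<lfloor>x\<rfloor> + 1) * (real (nat \<lfloor>x\<rfloor> + 1) / x)) \<longlongrightarrow> d * 1) at_top"
    by (rule tendsto_mult)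
  moreover have "\<forall>\<^sub>F x::real in at_top. r (nat \<lfloor>x\<rfloor> + 1) * (real (nat \<lfloor>x\<rfloor> + 1) / x)
    = real (count_upto A x) / x"
    using eventually_gt_at_top[of 0]
  proof eventually_elim
    case (elim x)
    have "{n \<in> A. real n \<le> x} = A \<inter> {..<nat \<lfloor>x\<rfloor> + 1}"
      using elim by (auto simp: less_Suc_eq_le le_nat_floor) (metis le_floor_iff le_nat_iff of_int_of_nat_eq order_less_imp_le zero_le_floor)
    then show ?case by (simp add: r_def count_upto_def)
  qed
  ultimately have "has_natural_density A d"
    unfolding has_natural_density_def mult_1_right by (rule Lim_transform_eventually)
  then show ?thesis using d_le[OF b] le_d[OF a] by auto
qed

section \<open>Averages over a period\<close>

definition avg :: "nat \<Rightarrow> (nat \<Rightarrow> real) \<Rightarrow> real" where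
  "avg Q f = (\<Sum>n<Q. f n) / real Q"

definition periodic :: "nat \<Rightarrow> (nat \<Rightarrow> 'a) \<Rightarrow> bool" where
  "periodic q f \<longleftrightarrow> q > 0 \<and> (\<forall>n. f (n + q) = f n)"

lemma periodic_add_mult: "periodic q f \<Longrightarrow> f (n + q * k) = f n"
  by (induction k) (auto simp: periodic_def algebra_simps, metis add.assoc add.commute)

lemma periodic_mod: "periodic q f \<Longrightarrow> f (n mod q) = f n"
  using periodic_add_mult[of q f "n mod q" "n div q"] by simp

lemma periodic_dvd: "periodic q f \<Longrightarrow> q dvd Q \<Longrightarrow> Q > 0 \<Longrightarrow> periodic Q f"
  unfolding periodic_def by (metis dvd_def periodic_add_mult periodic_def)

lemma periodic_compose: "periodic q f \<Longrightarrow> periodic q (\<lambda>n. g (f n))"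
  by (simp add: periodic_def)

lemma periodic_compose2: "periodic q f \<Longrightarrow> periodic q g \<Longrightarrow> periodic q (\<lambda>n. h (f n) (g n))"
  by (simp add: periodic_def)

lemma sum_lessThan_mult:
  fixes f :: "nat \<Rightarrow> real"
  assumes "periodic q f"
  shows "(\<Sum>n<q * k. f n) = real k * (\<Sum>n<q. f n)"
proof (induction k)
  case (Suc k)
  have "(\<Sum>n<q * Suc k. f n) = (\<Sum>n<q * k + q. f n)" by (simp add: algebra_simps)
  also have "\<dots> = (\<Sum>n<q * k. f n) + (\<Sum>n<q. f (n + q * k))"
    using sum.atLeastLessThan_concat[of 0 "q * k" "q * k + q" f] sum.shift_bounds_nat_ivl[of f 0 "q * k" q]
    by (simp add: lessThan_atLeast0 add.commute)
  also have "(\<Sum>n<q. f (n + q * k)) = (\<Sum>n<q. f n)"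
    using periodic_add_mult[OF assms] by simp
  finally show ?case using Suc by (simp add: algebra_simps)
qed simp

lemma avg_dvd:
  assumes "periodic q f" "q dvd Q" "Q > 0"
  shows "avg Q f = avg q f"
proof -
  obtain k where k: "Q = q * k" using assms(2) by auto
  then show ?thesis using assms(3) sum_lessThan_mult[OF assms(1), of k] by (simp add: avg_def)
qed

lemma avg_const [simp]: "Q > 0 \<Longrightarrow> avg Q (\<lambda>_. c) = c"
  by (simp add: avg_def)

lemma avg_add: "avg Q (\<lambda>n. f n + g n) = avg Q f + avg Q g"
  by (simp add: avg_def sum.distrib add_divide_distrib)

lemma avg_diff: "avg Q (\<lambda>n. f n - g n) = avg Q f - avg Q g"
  by (simp add: avg_def sum_subtractf diff_divide_distrib)

lemma avg_cmult: "avg Q (\<lambda>n. c * f n) = c * avg Q f"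
  by (simp add: avg_def sum_distrib_left)

lemma avg_sum: "avg Q (\<lambda>n. \<Sum>i\<in>I. f i n) = (\<Sum>i\<in>I. avg Q (f i))"
  unfolding avg_def by (subst sum.swap) (simp add: sum_divide_distrib)

lemma avg_mono: "(\<And>n. f n \<le> g n) \<Longrightarrow> avg Q f \<le> avg Q g"
  unfolding avg_def by (intro divide_right_mono sum_mono) auto

text \<open>Independence, by the Chinese remainder theorem.\<close>

lemma avg_mult:
  assumes f: "periodic a f" and g: "periodic b g" and ab: "coprime a b" "a * b dvd Q" "Q > 0"
  shows "avg Q (\<lambda>n. f n * g n) = avg Q f * avg Q g"
proof -
  have pos: "a > 0" "b > 0" using f g by (auto simp: periodic_def)
  have fab: "periodic (a * b) f" "periodic (a * b) g"
    using periodic_dvd[OF f, of "a * b"] periodic_dvd[OF g, of "a * b"] pos by auto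
  have bij: "bij_betw (\<lambda>n. (n mod a, n mod b)) {..<a * b} ({..<a} \<times> {..<b})"
  proof -
    have inj: "inj_on (\<lambda>n. (n mod a, n mod b)) {..<a * b}"
    proof (rule inj_onI)
      fix x y assume xy: "x \<in> {..<a * b}" "y \<in> {..<a * b}" "(x mod a, x mod b) = (y mod a, y mod b)"
      then have "[x = y] (mod a * b)"
        by (intro coprime_cong_mult_nat[OF _ _ ab(1)]) (auto simp: cong_def)
      then show "x = y" using xy by (simp add: cong_def)
    qed
    moreover have "(\<lambda>n. (n mod a, n mod b)) ` {..<a * b} = {..<a} \<times> {..<b}"
      using pos by (intro card_subset_eq) (auto simp: card_image[OF inj])
    ultimately show ?thesis by (simp add: bij_betw_def)
  qed
  have "(\<Sum>n<a * b. f n * g n) = (\<Sum>n<a * b. f (n mod a) * g (n mod b))"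
    using periodic_mod[OF f] periodic_mod[OF g] by simp
  also have "\<dots> = (\<Sum>(x, y)\<in>{..<a} \<times> {..<b}. f x * g y)"
    using sum.reindex_bij_betw[OF bij, of "\<lambda>(x, y). f x * g y"] by simp
  also have "\<dots> = (\<Sum>x<a. f x) * (\<Sum>y<b. g y)"
    by (simp add: sum_product sum.cartesian_product)
  finally have "avg (a * b) (\<lambda>n. f n * g n) = avg a f * avg b g"
    by (simp add: avg_def)
  moreover have "avg Q (\<lambda>n. f n * g n) = avg (a * b) (\<lambda>n. f n * g n)"
    using periodic_compose2[OF fab, of "(*)"] ab(2,3) by (rule avg_dvd)
  moreover have "avg Q f = avg a f" "avg Q g = avg b g"
    using avg_dvd[OF f _ ab(3)] avg_dvd[OF g _ ab(3)] ab(2) dvd_mult_left dvd_mult_right by blast+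
  ultimately show ?thesis by simp
qed

text \<open>Probabilities are averages of indicators, written with \<^const>\<open>of_bool\<close>.\<close>

lemma upper_density_le_periodic:
  assumes "periodic q P"
  shows "upper_density_le {n. P n} (avg q (\<lambda>n. of_bool (P n)))"
  unfolding upper_density_le_def
proof (intro allI impI)
  fix e :: real assume "e > 0"
  define f where "f = (\<lambda>n. of_bool (P n) :: real)"
  have f: "periodic q f" using periodic_compose[OF assms, of of_bool] by (simp add: f_def)
  have q: "q > 0" using assms by (simp add: periodic_def)
  have card: "real (card ({n. P n} \<inter> {..<N})) = (\<Sum>n<N. f n)" for N
    by (simp add: f_def of_bool_def sum.If_cases Int_commute)
  show "\<forall>\<^sub>F N in sequentially. real (card ({n. P n} \<inter> {..<N})) \<le> (avg q (\<lambda>n. of_bool (P n)) + e) * real N"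
    using eventually_ge_at_top[of "nat \<lceil>real q / e\<rceil>"]
  proof eventually_elim
    case (elim N)
    have avg0: "avg q f \<ge> 0" by (simp add: avg_def f_def sum_nonneg)
    \<comment> \<open>Completing the last period costs at most q, and \<open>elim\<close> makes this
      at most e * N.\<close>
    have "(\<Sum>n<N. f n) \<le> (\<Sum>n<q * (N div q) + q. f n)"
    proof (intro sum_mono2)
      have "N mod q < q" using q by simp
      then have "N \<le> q * (N div q) + q" using mult_div_mod_eq[of q N] by linarith
      then show "{..<N} \<subseteq> {..<q * (N div q) + q}" by auto
    qed (auto simp: f_def)
    also have "\<dots> = (\<Sum>n<q * (N div q + 1). f n)" by (simp add: algebra_simps)
    also have "\<dots> = real (N div q + 1) * (\<Sum>n<q. f n)" by (rule sum_lessThan_mult[OF f])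
    also have "\<dots> = real (N div q) * real q * avg q f + (\<Sum>n<q. f n)"
      using q by (simp add: avg_def algebra_simps)
    also have "real (N div q) * real q * avg q f \<le> real N * avg q f"
      using avg0 by (intro mult_right_mono) (metis of_nat_le_iff of_nat_mult div_times_less_eq_dividend)
    also have "(\<Sum>n<q. f n) \<le> real q"
      using sum_bounded_above[of "{..<q}" f 1] by (simp add: f_def)
    also have "real q / e \<le> real N" using elim by linarith
    then have "real q \<le> e * real N" using \<open>e > 0\<close> by (simp add: field_simps)
    finally show ?case unfolding card by (simp add: f_def algebra_simps)
  qed
qed

section \<open>The logarithm of the abundancy index\<close>

text \<open>For a prime p this is ln (sigma (p^k) / p^k), with the divisors taken in reverse order.
  Written as a geometric sum, its increments in k can be read off.\<close>

definition log_sigma_pow :: "nat \<Rightarrow> nat \<Rightarrow> real" where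
  "log_sigma_pow p k = ln (\<Sum>j\<le>k. 1 / real p ^ j)"

definition log_abund :: "nat \<Rightarrow> real" where
  "log_abund m = ln (real (divisor_sigma m) / real m)"

text \<open>The \<open>p\<close>-adic valuation capped at \<open>K\<close>; unlike \<^const>\<open>multiplicity\<close> it is periodic,
  with value \<open>K\<close> at \<open>0\<close>.\<close>

definition capped_val :: "nat \<Rightarrow> nat \<Rightarrow> nat \<Rightarrow> nat" where
  "capped_val p K n = card {j \<in> {1..K}. p ^ j dvd n}"

definition log_abund_upto :: "nat \<Rightarrow> nat \<Rightarrow> real" where
  "log_abund_upto M m = (\<Sum>p | prime p \<and> p \<le> M. log_sigma_pow p (capped_val p M m))"

lemma finite_primes_le [simp]: "finite {p::nat. prime p \<and> p \<le> M}"
  by (rule finite_subset[of _ "{..M}"]) auto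

lemma capped_val_le: "capped_val p K n \<le> K"
  unfolding capped_val_def
  by (rule order_trans[OF card_mono[of "{1..K}"]]) auto

text \<open>Divisibility by a power of \<open>p\<close> passes to smaller exponents, so the counted
  set is an initial segment of \<open>{1..K}\<close>.\<close>

lemma capped_val_ge_iff:
  assumes "1 \<le> j" "j \<le> K"
  shows "j \<le> capped_val p K n \<longleftrightarrow> p ^ j dvd n"
proof
  assume "p ^ j dvd n"
  then have "{1..j} \<subseteq> {i \<in> {1..K}. p ^ i dvd n}"
    using assms by (auto intro: dvd_trans[OF le_imp_power_dvd])
  then show "j \<le> capped_val p K n"
    unfolding capped_val_def using card_mono[of "{i \<in> {1..K}. p ^ i dvd n}" "{1..j}"] by simp
next
  assume *: "j \<le> capped_val p K n"
  show "p ^ j dvd n"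
  proof (rule ccontr)
    assume "\<not> p ^ j dvd n"
    then have "{i \<in> {1..K}. p ^ i dvd n} \<subseteq> {1..<j}"
      using dvd_trans[OF le_imp_power_dvd, of j _ p n] by (auto simp: not_le[symmetric])
    then have "capped_val p K n \<le> j - 1"
      unfolding capped_val_def using card_mono[of "{1..<j}" "{i \<in> {1..K}. p ^ i dvd n}"] by simp
    then show False using * assms by simp
  qed
qed

lemma capped_val_eq_min:
  assumes "prime p" "m > 0"
  shows "capped_val p K m = min K (multiplicity p m)"
proof -
  have "\<not> is_unit p" using assms(1) not_prime_unit by blast
  then have iff: "p ^ j dvd m \<longleftrightarrow> j \<le> multiplicity p m" for j
    using assms(2) power_dvd_iff_le_multiplicity[of m p j] by simp
  have "{j \<in> {1..K}. p ^ j dvd m} = {1..min K (multiplicity p m)}"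
    unfolding iff by auto
  then show ?thesis by (simp add: capped_val_def)
qed

lemma periodic_dvd_affine: "q > 0 \<Longrightarrow> periodic q (\<lambda>n::nat. q dvd a * n + b)"
proof -
  assume "q > 0"
  have "(q dvd a * (n + q) + b) = (q dvd a * n + b)" for n
    using dvd_add_left_iff[of q "a * q" "a * n + b"] by (simp add: algebra_simps)
  then show ?thesis using \<open>q > 0\<close> by (simp add: periodic_def)
qed

lemma periodic_capped_val: 
  assumes "p > 0"
  shows "periodic (p ^ K) (\<lambda>n. capped_val p K (a * n + b))"
proof -
  have "p ^ j dvd a * (n + p ^ K) + b \<longleftrightarrow> p ^ j dvd a * n + b" if "j \<in> {1..K}" for j n
    using dvd_add_left_iff[of "p ^ j" "a * p ^ K" "a * n + b"] le_imp_power_dvd[of j K p] that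
    by (simp add: algebra_simps dvd_mult)
  then have "{j \<in> {1..K}. p ^ j dvd a * (n + p ^ K) + b} = {j \<in> {1..K}. p ^ j dvd a * n + b}" for n
    by blast
  then show ?thesis using assms by (simp add: periodic_def capped_val_def)
qed

lemma log_sigma_pow_0 [simp]: "log_sigma_pow p 0 = 0"
  by (simp add: log_sigma_pow_def)

lemma sum_pow_ge_1: "(\<Sum>j\<le>k. 1 / real p ^ j) \<ge> 1"
  using sum_mono2[of "{..k}" "{0}" "\<lambda>j. 1 / real p ^ j"] by simp

lemma log_sigma_pow_mono: "j \<le> k \<Longrightarrow> log_sigma_pow p j \<le> log_sigma_pow p k"
  unfolding log_sigma_pow_def
proof (subst ln_le_cancel_iff)
  assume "j \<le> k"
  then show "(\<Sum>i\<le>j. 1 / real p ^ i) \<le> (\<Sum>i\<le>k. 1 / real p ^ i)" by (intro sum_mono2) auto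
qed (use sum_pow_ge_1[where p = p] in \<open>auto intro: less_le_trans[OF zero_less_one]\<close>)

lemma log_sigma_pow_nonneg: "log_sigma_pow p k \<ge> 0"
  using log_sigma_pow_mono[of 0 k p] by simp

text \<open>With a partial sum s >= 1 and added terms t, the difference is ln (1 + t / s) <= t / s
  <= t.\<close>

lemma log_sigma_pow_diff_le:
  assumes "j \<le> k"
  shows "log_sigma_pow p k - log_sigma_pow p j \<le> (\<Sum>i\<in>{j<..k}. 1 / real p ^ i)"
proof -
  define s where "s = (\<Sum>i\<le>j. 1 / real p ^ i)"
  define t where "t = (\<Sum>i\<in>{j<..k}. 1 / real p ^ i)"
  have s: "s \<ge> 1" unfolding s_def by (rule sum_pow_ge_1)
  have t: "t \<ge> 0" unfolding t_def by (simp add: sum_nonneg)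
  have "{..k} = {..j} \<union> {j<..k}" using assms by auto
  then have "(\<Sum>i\<le>k. 1 / real p ^ i) = s + t"
    unfolding s_def t_def by (simp only:) (rule sum.union_disjoint, auto)
  then have "log_sigma_pow p k - log_sigma_pow p j = ln (s + t) - ln s"
    by (simp add: log_sigma_pow_def s_def)
  also have "\<dots> = ln (1 + t / s)"
    using s t ln_divide_pos[of "s + t" s] by (simp add: add_divide_distrib)
  also have "\<dots> \<le> t / s" using s t by (intro ln_add_one_self_le_self) auto
  also have "\<dots> \<le> t" using s t mult_left_mono[of 1 s t] by (simp add: field_simps)
  finally show ?thesis by (simp add: t_def)
qed

section \<open>Multiplicativity of sigma and the prime decomposition of
  \<open>log_abund\<close>\<close>

lemma divisor_sigma_mult_coprime:
  assumes "coprime a b"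
  shows "divisor_sigma (a * b) = divisor_sigma a * divisor_sigma b"
proof -
  have inj: "inj_on (\<lambda>(x, y). x * y) ({d. d dvd a} \<times> {d. d dvd b})"
  proof (rule inj_onI, clarify)
    fix x y x' y' assume d: "x dvd a" "y dvd b" "x' dvd a" "y' dvd b" and e: "x * y = x' * y'"
    have c: "coprime x y'" "coprime x' y"
      using d assms coprime_divisors by blast+
    have "x dvd x'" "x' dvd x"
      using e c by (metis coprime_dvd_mult_left_iff dvd_triv_left)+
    then have "x = x'" by (rule dvd_antisym)
    moreover have "coprime x y" using d assms coprime_divisors by blast
    have "y dvd y'" "y' dvd y"
      using e c by (metis coprime_commute coprime_dvd_mult_right_iff dvd_triv_right)+
    then have "y = y'" by (rule dvd_antisym)
    ultimately show "x = x' \<and> y = y'" by simp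
  qed
  have "(\<lambda>(x, y). x * y) ` ({d. d dvd a} \<times> {d. d dvd b}) = {d. d dvd a * b}"
    by (auto intro: mult_dvd_mono simp: image_iff) (metis division_decomp)
  then have "divisor_sigma (a * b) = (\<Sum>(x, y)\<in>{d. d dvd a} \<times> {d. d dvd b}. x * y)"
    unfolding divisor_sigma_def
    using sum.reindex[OF inj, of "\<lambda>d. d"] by (simp add: case_prod_unfold)
  then show ?thesis
    by (simp add: divisor_sigma_def sum_product sum.cartesian_product)
qed

lemma divisor_sigma_pos: "m > 0 \<Longrightarrow> divisor_sigma m > 0"
  unfolding divisor_sigma_def by (rule sum_pos2[of _ m]) auto

lemma log_abund_mult_coprime:
  assumes "coprime a b" "a > 0" "b > 0"
  shows "log_abund (a * b) = log_abund a + log_abund b"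
proof -
  have "real (divisor_sigma (a * b)) / real (a * b)
      = (real (divisor_sigma a) / real a) * (real (divisor_sigma b) / real b)"
    using assms by (simp add: divisor_sigma_mult_coprime)
  then show ?thesis
    unfolding log_abund_def using assms divisor_sigma_pos[of a] divisor_sigma_pos[of b]
    by (simp only:) (rule ln_mult_pos, auto)
qed

lemma log_abund_prime_power:
  assumes "prime p"
  shows "log_abund (p ^ k) = log_sigma_pow p k"
proof -
  have p: "p > 0" using assms prime_gt_0_nat by blast
  have "{d. d dvd p ^ k} = (\<lambda>j. p ^ j) ` {..k}"
    using divides_primepow_nat[OF assms] by auto
  moreover have "inj_on (\<lambda>j. p ^ j) {..k}"
    using assms by (auto simp: inj_on_def prime_power_inj)
  ultimately have "divisor_sigma (p ^ k) = (\<Sum>j\<le>k. p ^ j)"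
    by (simp add: divisor_sigma_def sum.reindex)
  then have "real (divisor_sigma (p ^ k)) / real (p ^ k) = (\<Sum>j\<le>k. real p ^ j / real p ^ k)"
    by (simp add: sum_divide_distrib)
  also have "\<dots> = (\<Sum>j\<le>k. 1 / real p ^ j)"
    using p by (intro sum.reindex_bij_witness[of _ "\<lambda>j. k - j" "\<lambda>j. k - j"])
      (auto simp: power_diff)
  finally show ?thesis by (simp add: log_abund_def log_sigma_pow_def)
qed

text \<open>Induction strips one full prime power. The bound \<open>N\<close> is free above m, so
  the index set of primes stays the same throughout: primes not dividing m contribute
  \<open>log_sigma_pow p 0\<close>, which is 0.\<close>

lemma log_abund_eq_sum:
  assumes "m > 0" "m \<le> N"
  shows "log_abund m = (\<Sum>p | prime p \<and> p \<le> N. log_sigma_pow p (multiplicity p m))"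
  using assms
proof (induction m rule: less_induct)
  case (less m)
  show ?case
  proof (cases "m = 1")
    case True
    then show ?thesis by (simp add: log_abund_def divisor_sigma_def)
  next
    case False
    then obtain p where p: "prime p" "p dvd m" using prime_factor_nat by blast
    obtain b where b: "m = p ^ multiplicity p m * b" "\<not> p dvd b"
      using multiplicity_decompose'[of m p] less.prems p(1)
      by (metis not_prime_unit not_gr_zero)
    define k where "k = multiplicity p m"
    have k: "k > 0" using p less.prems by (simp add: k_def prime_multiplicity_gt_zero_iff)
    have bpos: "b > 0" using b(1) less.prems by (cases b) auto
    have "1 < p ^ k" using k prime_gt_1_nat[OF p(1)] one_less_power by blast
    then have "b < m" using b(1) bpos unfolding k_def[symmetric] by simp
    have cop: "coprime (p ^ k) b"
      using p(1) b(2) prime_imp_coprime_nat by (simp add: prime_imp_coprime)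
    have pN: "p \<le> N" using dvd_imp_le[OF p(2)] less.prems by simp
    have mult: "multiplicity q m = multiplicity q b" if "prime q" "q \<noteq> p" for q
    proof -
      have "multiplicity q m = multiplicity q (p ^ k) + multiplicity q b"
        using b(1) prime_elem_multiplicity_mult_distrib[of q "p ^ k" b] that(1) bpos prime_gt_0_nat[OF p(1)]
        by (simp add: k_def)
      then show ?thesis using that p(1) by (simp add: multiplicity_distinct_prime_power)
    qed
    have mb: "multiplicity p b = 0" using b(2) by (simp add: not_dvd_imp_multiplicity_0)
    have "log_abund m = log_sigma_pow p k + log_abund b"
      using log_abund_mult_coprime[OF cop] bpos p(1) b(1) prime_gt_0_nat
      by (simp add: k_def log_abund_prime_power)
    also have "log_abund b = (\<Sum>q | prime q \<and> q \<le> N. log_sigma_pow q (multiplicity q b))"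
      using less.IH[OF \<open>b < m\<close> bpos] less.prems \<open>b < m\<close> by simp
    also have "\<dots> = (\<Sum>q\<in>{q. prime q \<and> q \<le> N} - {p}. log_sigma_pow q (multiplicity q m))"
      using p(1) pN mult mb by (subst sum.remove[of _ p]) auto
    also have "log_sigma_pow p k + \<dots> = (\<Sum>q | prime q \<and> q \<le> N. log_sigma_pow q (multiplicity q m))"
      using p(1) pN by (subst sum.remove[of "{q. prime q \<and> q \<le> N}" p]) (auto simp: k_def)
    finally show ?thesis .
  qed
qed

text \<open>The truncation at \<open>M\<close> omits only prime powers exceeding \<open>M\<close>.\<close>

lemma log_abund_truncation:
  assumes "m > 0"
  shows "log_abund_upto M m \<le> log_abund m"
    and "log_abund m - log_abund_upto M m \<le> (\<Sum>d | d dvd m \<and> d > M. 1 / real d)"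
proof -
  define N where "N = max M m"
  define P where "P = {p. prime p \<and> p \<le> N}"
  have P: "finite P" by (simp add: P_def)
  have PM: "{p. prime p \<and> p \<le> M} \<subseteq> P" by (auto simp: P_def N_def)
  define c where "c p = (if p \<le> M then min M (multiplicity p m) else 0)" for p
  have c: "c p \<le> multiplicity p m" for p by (simp add: c_def)
  have upto: "log_abund_upto M m = (\<Sum>p\<in>P. log_sigma_pow p (c p))"
    unfolding log_abund_upto_def using assms
    by (intro sum.mono_neutral_cong_left P PM) (auto simp: P_def c_def capped_val_eq_min)
  have full: "log_abund m = (\<Sum>p\<in>P. log_sigma_pow p (multiplicity p m))"
    unfolding P_def by (rule log_abund_eq_sum) (use assms in \<open>auto simp: N_def\<close>)
  show "log_abund_upto M m \<le> log_abund m"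
    unfolding upto full by (intro sum_mono log_sigma_pow_mono c)
  have "log_abund m - log_abund_upto M m
      = (\<Sum>p\<in>P. log_sigma_pow p (multiplicity p m) - log_sigma_pow p (c p))"
    by (simp add: upto full sum_subtractf)
  also have "\<dots> \<le> (\<Sum>p\<in>P. \<Sum>i\<in>{c p<..multiplicity p m}. 1 / real p ^ i)"
    by (intro sum_mono log_sigma_pow_diff_le c)
  also have "\<dots> = (\<Sum>(p, i)\<in>Sigma P (\<lambda>p. {c p<..multiplicity p m}). 1 / real (p ^ i))"
    using P by (subst sum.Sigma) auto
  \<comment> \<open>Distinct pairs of a prime and a positive exponent give distinct numbers, so the
    double sum runs over distinct divisors.\<close>
  also have "\<dots> = (\<Sum>d\<in>(\<lambda>(p, i). p ^ i) ` Sigma P (\<lambda>p. {c p<..multiplicity p m}). 1 / real d)"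
  proof (subst sum.reindex)
    show "inj_on (\<lambda>(p, i). p ^ i) (Sigma P (\<lambda>p. {c p<..multiplicity p m}))"
      by (rule inj_onI) (auto simp: P_def prime_power_inj'')
  qed (auto simp: case_prod_unfold)
  also have "\<dots> \<le> (\<Sum>d | d dvd m \<and> d > M. 1 / real d)"
  proof (rule sum_mono2)
    show "finite {d. d dvd m \<and> d > M}" using assms by simp
    show "(\<lambda>(p, i). p ^ i) ` Sigma P (\<lambda>p. {c p<..multiplicity p m}) \<subseteq> {d. d dvd m \<and> d > M}"
    proof clarify
      fix p i assume pi: "p \<in> P" "i \<in> {c p<..multiplicity p m}"
      then have pr: "prime p" by (simp add: P_def)
      have "p ^ i dvd m" using pi by (intro multiplicity_dvd') auto
      \<comment> \<open>A prime above \<open>M\<close> exceeds it at once; for a smaller one the cap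
        forces i > M, and p^i >= 2^i > i.\<close>
      moreover have "p ^ i > M"
      proof (cases "p \<le> M")
        case True
        then have "i > M" using pi by (auto simp: c_def)
        then show ?thesis using prime_gt_1_nat[OF pr] less_exp[of i] power_mono[of 2 p i] by linarith
      next
        case False
        then show ?thesis using pi(2) self_le_power[of p i] prime_gt_0_nat[OF pr] by (auto simp: c_def)
      qed
      ultimately show "p ^ i dvd m \<and> M < p ^ i" by simp
    qed
  qed auto
  finally show "log_abund m - log_abund_upto M m \<le> (\<Sum>d | d dvd m \<and> d > M. 1 / real d)" .
qed

text \<open>After exchanging the sums, a divisor d > M occurs for at most X / d of the m and so
  contributes at most X / d^2; then 1 / d^2 <= 1 / (d - 1) - 1 / d telescopes.\<close>

lemma sum_large_divisors_le:
  assumes "M > 0"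
  shows "(\<Sum>m\<in>{1..X}. \<Sum>d | d dvd m \<and> d > M. 1 / real d) \<le> real X / real M"
proof -
  have "(\<Sum>m\<in>{1..X}. \<Sum>d | d dvd m \<and> d > M. 1 / real d)
      = (\<Sum>m\<in>{1..X}. \<Sum>d\<in>{M<..X}. if d dvd m then 1 / real d else 0)"
  proof (rule sum.cong[OF refl])
    fix m assume m: "m \<in> {1..X}"
    have "{d. d dvd m \<and> d > M} = {d \<in> {M<..X}. d dvd m}"
      using m dvd_imp_le[of _ m] by fastforce
    then show "(\<Sum>d | d dvd m \<and> d > M. 1 / real d) = (\<Sum>d\<in>{M<..X}. if d dvd m then 1 / real d else 0)"
      using sum.inter_filter[of "{M<..X}" "\<lambda>d. 1 / real d" "\<lambda>d. d dvd m"] by simp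
  qed
  also have "\<dots> = (\<Sum>d\<in>{M<..X}. \<Sum>m\<in>{1..X}. if d dvd m then 1 / real d else 0)"
    by (rule sum.swap)
  also have "\<dots> \<le> (\<Sum>d\<in>{M<..X}. real X * (1 / real (d - 1) - 1 / real d))"
  proof (rule sum_mono)
    fix d assume d: "d \<in> {M<..X}"
    then have d1: "d > 1" using assms by simp
    have "{m \<in> {1..X}. d dvd m} \<subseteq> (\<lambda>k. d * k) ` {1..X div d}"
      using d1 by (auto simp: dvd_def image_iff less_eq_div_iff_mult_less_eq mult.commute)
    then have "card {m \<in> {1..X}. d dvd m} \<le> card ((\<lambda>k. d * k) ` {1..X div d})"
      by (intro card_mono) auto
    also have "\<dots> \<le> X div d" using card_image_le[of "{1..X div d}" "\<lambda>k. d * k"] by simp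
    finally have card: "card {m \<in> {1..X}. d dvd m} \<le> X div d" .
    have "real (X div d) * real d \<le> real X" by (metis div_times_less_eq_dividend of_nat_le_iff of_nat_mult)
    then have "real (X div d) \<le> real X / real d" using d1 by (simp add: field_simps)
    then have "real (card {m \<in> {1..X}. d dvd m}) \<le> real X / real d" using card by linarith
    then have "real (card {m \<in> {1..X}. d dvd m}) * (1 / real d) \<le> (real X / real d) * (1 / real d)"
      by (intro mult_right_mono) auto
    moreover have "(\<Sum>m\<in>{1..X}. if d dvd m then 1 / real d else 0) = real (card {m \<in> {1..X}. d dvd m}) * (1 / real d)"
      by (subst sum.inter_filter[symmetric]) auto
    ultimately have "(\<Sum>m\<in>{1..X}. if d dvd m then 1 / real d else 0) \<le> (real X / real d) * (1 / real d)"
      by linarith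
    also have "\<dots> \<le> real X * (1 / real (d - 1) - 1 / real d)"
    proof -
      have "(1 / real d) * (1 / real d) \<le> 1 / real (d - 1) - 1 / real d"
        using d1 by (simp add: field_simps of_nat_diff)
      then have "real X * ((1 / real d) * (1 / real d)) \<le> real X * (1 / real (d - 1) - 1 / real d)"
        by (rule mult_left_mono) simp
      then show ?thesis by simp
    qed
    finally show "(\<Sum>m\<in>{1..X}. if d dvd m then 1 / real d else 0) \<le> real X * (1 / real (d - 1) - 1 / real d)" .
  qed
  also have "\<dots> = real X * (\<Sum>d\<in>{M<..X}. 1 / real (d - 1) - 1 / real d)"
    by (simp add: sum_distrib_left)
  also have "(\<Sum>d\<in>{M<..X}. 1 / real (d - 1) - 1 / real d) \<le> 1 / real M"
  proof (cases "M \<le> X")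
    case True
    then have "(\<Sum>d\<in>{M<..X}. 1 / real (d - 1) - 1 / real d) = 1 / real M - 1 / real X"
    proof (induction X rule: dec_induct)
      case (step n)
      have "{M<..Suc n} = insert (Suc n) {M<..n}" using step by auto
      then show ?case using step by simp
    qed simp
    then show ?thesis by simp
  qed auto
  finally show ?thesis by (simp add: mult_left_mono)
qed

text \<open>Markov's inequality, applied to the divisor sum that bounds the truncation
  error.\<close>

lemma card_log_abund_tail_le:
  assumes "M > 0" "\<delta> > 0"
  shows "real (card {m \<in> {1..X}. log_abund m - log_abund_upto M m > \<delta>}) \<le> real X / (real M * \<delta>)"
proof -
  let ?S = "{m \<in> {1..X}. log_abund m - log_abund_upto M m > \<delta>}"
  have "real (card ?S) * \<delta> = (\<Sum>m\<in>?S. \<delta>)" by simp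
  also have "\<dots> \<le> (\<Sum>m\<in>?S. \<Sum>d | d dvd m \<and> d > M. 1 / real d)"
  proof (rule sum_mono)
    fix m assume "m \<in> ?S"
    then have "m > 0" "\<delta> < log_abund m - log_abund_upto M m" by auto
    then show "\<delta> \<le> (\<Sum>d | d dvd m \<and> d > M. 1 / real d)"
      using log_abund_truncation(2)[of m M] by linarith
  qed
  also have "\<dots> \<le> (\<Sum>m\<in>{1..X}. \<Sum>d | d dvd m \<and> d > M. 1 / real d)"
    by (intro sum_mono2) (auto intro: sum_nonneg)
  also have "\<dots> \<le> real X / real M" by (rule sum_large_divisors_le[OF assms(1)])
  finally show ?thesis using assms by (simp add: field_simps)
qed

text \<open>The numbers 2 * n + c with n < N are distinct and at most 2 * N, whence the factor
  2.\<close>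

lemma upper_density_log_abund_tail:
  assumes "M > 0" "\<delta> > 0" "c \<le> 1"
  shows "upper_density_le {n. n \<ge> 1 \<and> log_abund (2 * n + c) - log_abund_upto M (2 * n + c) > \<delta>}
           (2 / (real M * \<delta>))"
  unfolding upper_density_le_def
proof (intro allI impI always_eventually)
  fix e :: real and N :: nat assume "e > 0"
  let ?A = "{n. n \<ge> 1 \<and> log_abund (2 * n + c) - log_abund_upto M (2 * n + c) > \<delta>} \<inter> {..<N}"
  have "card ?A = card ((\<lambda>n. 2 * n + c) ` ?A)" by (rule card_image[symmetric]) (auto simp: inj_on_def)
  also have "\<dots> \<le> card {m \<in> {1..2 * N}. log_abund m - log_abund_upto M m > \<delta>}"
    using assms(3) by (intro card_mono) auto
  finally have "real (card ?A) \<le> real (2 * N) / (real M * \<delta>)"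
    using card_log_abund_tail_le[OF assms(1,2), of "2 * N"] by linarith
  also have "\<dots> \<le> (2 / (real M * \<delta>) + e) * real N" using \<open>e > 0\<close> by (simp add: algebra_simps)
  finally show "real (card ?A) \<le> (2 / (real M * \<delta>) + e) * real N" .
qed

section \<open>From \<open>B\<close> and its complement to the truncated sums\<close>

text \<open>The value \<open>c = 1\<close> compares 2 * n + 1 with 2 * n and serves for
  \<open>B\<close>; \<open>c = 0\<close> reverses the roles and serves for the complement. In both
  cases \<open>1 - c\<close> picks the other number.\<close>

definition excess :: "nat \<Rightarrow> nat \<Rightarrow> nat \<Rightarrow> real" where
  "excess c M n = log_abund_upto M (2 * n + c) - log_abund_upto M (2 * n + (1 - c))"

definition modulus :: "nat \<Rightarrow> nat" where
  "modulus M = (\<Prod>p | prime p \<and> p \<le> M. p ^ M)"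

lemma modulus_pos [simp]: "modulus M > 0"
  unfolding modulus_def by (rule prod_pos) (auto dest: prime_gt_0_nat)

lemma prime_pow_dvd_modulus: "prime p \<Longrightarrow> p \<le> M \<Longrightarrow> p ^ M dvd modulus M"
  unfolding modulus_def by (rule dvd_prodI[of _ _ "\<lambda>p. p ^ M"]) auto

lemma periodic_sum:
  assumes "\<And>i. i \<in> I \<Longrightarrow> periodic q (f i)" "q > 0"
  shows "periodic q (\<lambda>n. \<Sum>i\<in>I. f i n)"
  using assms by (auto simp: periodic_def intro: sum.cong)

lemma periodic_excess: "periodic (modulus M) (excess c M)"
proof -
  have "periodic (modulus M) (\<lambda>n. log_abund_upto M (2 * n + b))" for b
    unfolding log_abund_upto_def
  proof (rule periodic_sum)
    fix p assume p: "p \<in> {p. prime p \<and> p \<le> M}"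
    then have "periodic (p ^ M) (\<lambda>n. capped_val p M (2 * n + b))"
      by (intro periodic_capped_val) (auto dest: prime_gt_0_nat)
    then have "periodic (p ^ M) (\<lambda>n. log_sigma_pow p (capped_val p M (2 * n + b)))"
      by (rule periodic_compose)
    then show "periodic (modulus M) (\<lambda>n. log_sigma_pow p (capped_val p M (2 * n + b)))"
      using p by (intro periodic_dvd[OF _ prime_pow_dvd_modulus]) auto
  qed simp
  then show ?thesis unfolding excess_def by (intro periodic_compose2[where h = "(-)"])
qed

text \<open>The two abundancy indices have different denominators, and ln (1 + 1 / (2 n)) = ln ((2 n
  + 1) / (2 n)) is exactly the correction.\<close>

lemma mem_B_iff: "n \<in> B \<longleftrightarrow> n \<ge> 1 \<and> log_abund (2 * n + 1) + ln (1 + 1 / (2 * real n)) \<ge> log_abund (2 * n)"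
proof (cases "n \<ge> 1")
  case True
  have s: "divisor_sigma (2 * n) > 0" "divisor_sigma (2 * n + 1) > 0"
    using True by (auto intro!: divisor_sigma_pos)
  have "1 + 1 / (2 * real n) = real (2 * n + 1) / real (2 * n)" using True by (simp add: field_simps)
  then have "log_abund (2 * n + 1) + ln (1 + 1 / (2 * real n)) = ln (real (divisor_sigma (2 * n + 1)) / real (2 * n))"
    using True s ln_mult_pos[of "real (divisor_sigma (2 * n + 1)) / real (2 * n + 1)" "1 + 1 / (2 * real n)"]
    by (simp add: log_abund_def)
  then have "log_abund (2 * n + 1) + ln (1 + 1 / (2 * real n)) \<ge> log_abund (2 * n)
      \<longleftrightarrow> real (divisor_sigma (2 * n)) / real (2 * n) \<le> real (divisor_sigma (2 * n + 1)) / real (2 * n)"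
    using True s by (simp add: log_abund_def)
  also have "\<dots> \<longleftrightarrow> divisor_sigma (2 * n) \<le> divisor_sigma (2 * n + 1)"
    using True by (simp add: field_simps)
  finally show ?thesis using True by (simp add: B_def)
qed (simp add: B_def)

text \<open>One \<delta> pays for truncating at 2 * n + 1, the other for ln (1 + 1 / (2 n)) <= 1 /
  (2 n) once n exceeds 1 / \<delta>. Truncating at 2 * n only lowers the subtracted term.\<close>

lemma upper_density_B:
  assumes "M > 0" "\<delta> > 0"
  shows "upper_density_le B (avg (modulus M) (\<lambda>n. of_bool (excess 1 M n \<ge> - 2 * \<delta>)) + 2 / (real M * \<delta>))"
proof -
  let ?T = "{n. n \<ge> 1 \<and> log_abund (2 * n + 1) - log_abund_upto M (2 * n + 1) > \<delta>}"
  have "B \<subseteq> ({n. excess 1 M n \<ge> - 2 * \<delta>} \<union> ?T) \<union> {..nat \<lceil>1 / \<delta>\<rceil>}"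
  proof
    fix n assume n: "n \<in> B"
    then have n1: "n \<ge> 1" by (simp add: B_def)
    consider "n \<in> ?T" | "n \<le> nat \<lceil>1 / \<delta>\<rceil>" | "n \<notin> ?T" "n > nat \<lceil>1 / \<delta>\<rceil>" by linarith
    then show "n \<in> ({n. excess 1 M n \<ge> - 2 * \<delta>} \<union> ?T) \<union> {..nat \<lceil>1 / \<delta>\<rceil>}"
    proof cases
      case 3
      have tail: "log_abund (2 * n + 1) - log_abund_upto M (2 * n + 1) \<le> \<delta>" using 3(1) n1 by simp
      have "1 / \<delta> < real n" using 3(2) by linarith
      then have "1 < \<delta> * real n" using assms(2) by (simp add: field_simps)
      have "ln (1 + 1 / (2 * real n)) \<le> 1 / (2 * real n)" by (intro ln_add_one_self_le_self) auto
      also have "\<dots> \<le> \<delta>" using \<open>1 < \<delta> * real n\<close> n1 by (simp add: field_simps)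
      finally have "log_abund (2 * n + 1) + \<delta> \<ge> log_abund (2 * n)" using n mem_B_iff by force
      moreover have "log_abund_upto M (2 * n) \<le> log_abund (2 * n)"
        using n1 by (intro log_abund_truncation(1)) auto
      ultimately show ?thesis using tail by (simp add: excess_def)
    qed auto
  qed
  moreover have dens: "upper_density_le {n. excess 1 M n \<ge> - 2 * \<delta>} (avg (modulus M) (\<lambda>n. of_bool (excess 1 M n \<ge> - 2 * \<delta>)))"
    by (rule upper_density_le_periodic) (rule periodic_compose[OF periodic_excess])
  ultimately show ?thesis
    using upper_density_le_Un[OF upper_density_le_Un[OF dens upper_density_log_abund_tail[OF assms, of 1]]
        upper_density_le_finite, of "{..nat \<lceil>1 / \<delta>\<rceil>}"]
    by (rule_tac upper_density_le_subset) auto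
qed

text \<open>Here ln (1 + 1 / (2 n)) >= 0 works in favour of the claim, so the truncation at 2 * n is
  the only loss; the threshold - 2 \<delta> is kept for symmetry with
  \<open>upper_density_B\<close>.\<close>

lemma upper_density_compl_B:
  assumes "M > 0" "\<delta> > 0"
  shows "upper_density_le (- B) (avg (modulus M) (\<lambda>n. of_bool (excess 0 M n \<ge> - 2 * \<delta>)) + 2 / (real M * \<delta>))"
proof -
  let ?T = "{n. n \<ge> 1 \<and> log_abund (2 * n + 0) - log_abund_upto M (2 * n + 0) > \<delta>}"
  have "- B \<subseteq> ({n. excess 0 M n \<ge> - 2 * \<delta>} \<union> ?T) \<union> {0}"
  proof
    fix n assume n: "n \<in> - B"
    consider "n \<in> ?T" | "n = 0" | "log_abund (2 * n) - log_abund_upto M (2 * n) \<le> \<delta>" "n \<ge> 1"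
      by fastforce
    then show "n \<in> ({n. excess 0 M n \<ge> - 2 * \<delta>} \<union> ?T) \<union> {0}"
    proof cases
      case 3
      have "ln (1 + 1 / (2 * real n)) \<ge> 0" by (intro ln_ge_zero) auto
      moreover have "\<not> log_abund (2 * n) \<le> log_abund (2 * n + 1) + ln (1 + 1 / (2 * real n))"
        using n 3(2) mem_B_iff[of n] by blast
      ultimately have "log_abund (2 * n + 1) < log_abund (2 * n)" by linarith
      moreover have "log_abund_upto M (2 * n + 1) \<le> log_abund (2 * n + 1)"
        by (intro log_abund_truncation(1)) auto
      ultimately show ?thesis using 3(1) assms(2) by (simp add: excess_def)
    qed auto
  qed
  moreover have dens: "upper_density_le {n. excess 0 M n \<ge> - 2 * \<delta>} (avg (modulus M) (\<lambda>n. of_bool (excess 0 M n \<ge> - 2 * \<delta>)))"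
    by (rule upper_density_le_periodic) (rule periodic_compose[OF periodic_excess])
  ultimately show ?thesis
    using upper_density_le_Un[OF upper_density_le_Un[OF dens upper_density_log_abund_tail[OF assms, of 0]]
        upper_density_le_finite, of "{0}"]
    by (rule_tac upper_density_le_subset) auto
qed

section \<open>Local distributions\<close>

definition prime_term :: "nat \<Rightarrow> nat \<Rightarrow> nat \<Rightarrow> nat \<Rightarrow> real" where
  "prime_term c M p n = log_sigma_pow p (capped_val p M (2 * n + c))
     - log_sigma_pow p (capped_val p M (2 * n + (1 - c)))"

definition part_excess :: "nat \<Rightarrow> nat \<Rightarrow> nat set \<Rightarrow> nat \<Rightarrow> real" where
  "part_excess c M P n = (\<Sum>p\<in>P. prime_term c M p n)"

text \<open>The average is over the full \<open>modulus M\<close> whatever \<open>P\<close> is, so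
  that different prime sets live on one probability space.\<close>

definition tail_prob :: "nat \<Rightarrow> nat \<Rightarrow> nat set \<Rightarrow> real \<Rightarrow> real" where
  "tail_prob c M P x = avg (modulus M) (\<lambda>n. of_bool (part_excess c M P n \<ge> x))"

lemma excess_eq_part_excess: "excess c M = part_excess c M {p. prime p \<and> p \<le> M}"
  by (auto simp: excess_def part_excess_def prime_term_def log_abund_upto_def sum_subtractf)

lemma tail_prob_antimono: "x \<le> y \<Longrightarrow> tail_prob c M P y \<le> tail_prob c M P x"
  unfolding tail_prob_def by (intro avg_mono) auto

lemma tail_prob_nonneg: "tail_prob c M P x \<ge> 0"
  unfolding tail_prob_def avg_def by (intro divide_nonneg_nonneg sum_nonneg) auto

lemma tail_prob_le_1: "tail_prob c M P x \<le> 1"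
proof -
  have "tail_prob c M P x \<le> avg (modulus M) (\<lambda>_. 1)"
    unfolding tail_prob_def by (intro avg_mono) auto
  then show ?thesis by simp
qed

lemma periodic_prime_term: "prime p \<Longrightarrow> periodic (p ^ M) (prime_term c M p)"
  unfolding prime_term_def
  by (intro periodic_compose2[where h = "\<lambda>a b. log_sigma_pow p a - log_sigma_pow p b"] periodic_capped_val)
     (auto dest: prime_gt_0_nat)

lemma periodic_part_excess:
  assumes "finite P" "\<And>p. p \<in> P \<Longrightarrow> prime p"
  shows "periodic (\<Prod>p\<in>P. p ^ M) (part_excess c M P)"
  unfolding part_excess_def
proof (rule periodic_sum)
  show pos: "(\<Prod>p\<in>P. p ^ M) > 0" using assms(2) by (intro prod_pos) (auto dest: prime_gt_0_nat)
  fix p assume p: "p \<in> P"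
  show "periodic (\<Prod>p\<in>P. p ^ M) (prime_term c M p)"
    by (rule periodic_dvd[OF periodic_prime_term _ pos])
      (use assms p in \<open>auto intro: dvd_prodI[of _ _ "\<lambda>p. p ^ M"]\<close>)
qed

lemma avg_mult_prime:
  assumes "prime p" "p \<le> M" "P \<subseteq> {q. prime q \<and> q \<le> M}" "p \<notin> P"
    and "periodic (p ^ M) f" "periodic (\<Prod>q\<in>P. q ^ M) g"
  shows "avg (modulus M) (\<lambda>n. f n * g n) = avg (modulus M) f * avg (modulus M) g"
proof (rule avg_mult[OF assms(5,6)])
  have fin: "finite P" using assms(3) finite_subset finite_primes_le by blast
  have "coprime p q" if "q \<in> P" for q
    using that assms primes_coprime by blast
  then show "coprime (p ^ M) (\<Prod>q\<in>P. q ^ M)"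
    by (intro prod_coprime_right) simp
  have "(\<Prod>q\<in>insert p P. q ^ M) dvd modulus M"
    unfolding modulus_def using assms by (intro prod_dvd_prod_subset) auto
  then show "p ^ M * (\<Prod>q\<in>P. q ^ M) dvd modulus M" using assms(4) fin by simp
qed simp

section \<open>Probabilities of divisibility and the insertion of one prime\<close>

definition div_prob :: "nat \<Rightarrow> nat \<Rightarrow> nat \<Rightarrow> nat \<Rightarrow> real" where
  "div_prob c M p j = avg (modulus M) (\<lambda>n. of_bool (p ^ j dvd 2 * n + c))"

lemma avg_of_bool_eq_card: "avg q (\<lambda>n. of_bool (P n)) = real (card {n. n < q \<and> P n}) / real q"
proof -
  have "{..<q} \<inter> {n. P n} = {n. n < q \<and> P n}" by auto
  then show ?thesis by (simp add: avg_def of_bool_def sum.If_cases)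
qed

lemma dvd_odd_iff:
  assumes "odd (q::nat)" "n < q"
  shows "q dvd 2 * n + 1 \<longleftrightarrow> n = (q - 1) div 2"
proof
  assume "q dvd 2 * n + 1"
  then obtain k where k: "2 * n + 1 = q * k" by auto
  have "k < 2" using k assms(2) mult_le_mono2[of 2 k q] by linarith
  then have "k = 1" using k by (cases k) auto
  then show "n = (q - 1) div 2" using k by simp
next
  assume "n = (q - 1) div 2"
  then have "2 * n + 1 = q" using assms by presburger
  then show "q dvd 2 * n + 1" by simp
qed

text \<open>As 2 is invertible modulo p^j, exactly one residue class of n qualifies.\<close>

lemma div_prob_odd:
  assumes "prime p" "odd p" "p \<le> M" "j \<le> M" "c \<le> 1"
  shows "div_prob c M p j = 1 / real p ^ j"
proof -
  define q where "q = p ^ j"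
  have q: "q > 0" "odd q" using assms prime_gt_0_nat[of p] by (auto simp: q_def)
  have "q dvd modulus M"
    using prime_pow_dvd_modulus[OF assms(1,3)] le_imp_power_dvd[OF assms(4)] dvd_trans unfolding q_def by blast
  then have "div_prob c M p j = avg q (\<lambda>n. of_bool (q dvd 2 * n + c))"
    unfolding div_prob_def q_def[symmetric]
    by (intro avg_dvd) (auto intro!: periodic_compose[of _ _ of_bool] periodic_dvd_affine q)
  also have "{n. n < q \<and> q dvd 2 * n + c} = (if c = 0 then {0} else {(q - 1) div 2})"
  proof (cases "c = 0")
    case True
    have "coprime q 2" using q(2) by (simp add: coprime_commute)
    then have "q dvd 2 * n \<longleftrightarrow> q dvd n" for n by (simp add: coprime_dvd_mult_right_iff)
    then show ?thesis using True q(1) by (auto dest: dvd_imp_le intro: ccontr)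
  next
    case False
    then have "c = 1" using assms(5) by simp
    then show ?thesis using dvd_odd_iff[OF q(2)] q(1) by (auto)
  qed
  then have "avg q (\<lambda>n. of_bool (q dvd 2 * n + c)) = 1 / real q"
    unfolding avg_of_bool_eq_card by simp
  finally show ?thesis by (simp add: q_def)
qed

text \<open>2^j divides 2 * n exactly when 2^(j - 1) divides n, whence the shifted exponent.\<close>

lemma div_prob_two_0:
  assumes "2 \<le> M" "1 \<le> j" "j \<le> M"
  shows "div_prob 0 M 2 j = 1 / 2 ^ (j - 1)"
proof -
  define q :: nat where "q = 2 ^ (j - 1)"
  have q: "q > 0" by (simp add: q_def)
  have pow: "(2::nat) ^ j = 2 * q" using assms(2) by (cases j) (auto simp: q_def)
  have "q dvd (2::nat) ^ M" unfolding q_def using assms(3) by (intro le_imp_power_dvd) simp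
  then have "q dvd modulus M"
    using prime_pow_dvd_modulus[OF two_is_prime_nat assms(1)] dvd_trans by blast
  then have "div_prob 0 M 2 j = avg q (\<lambda>n. of_bool (q dvd 1 * n + 0))"
    unfolding div_prob_def pow
    using avg_dvd[of q "\<lambda>n. of_bool (q dvd 1 * n + 0)" "modulus M"] periodic_dvd_affine[OF q, of 1 0]
    by (simp add: periodic_compose)
  also have "{n. n < q \<and> q dvd 1 * n + 0} = {0}" using q by (auto dest: dvd_imp_le)
  then have "avg q (\<lambda>n. of_bool (q dvd 1 * n + 0)) = 1 / real q"
    unfolding avg_of_bool_eq_card by simp
  finally show ?thesis by (simp add: q_def)
qed

lemma sum_indicator_telescope:
  fixes a :: "nat \<Rightarrow> real"
  assumes "\<And>j. 1 \<le> j \<Longrightarrow> j \<le> K \<Longrightarrow> D j \<longleftrightarrow> j \<le> k"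
  shows "(\<Sum>j=1..K. of_bool (D j) * (a j - a (j - 1))) = a (min k K) - a 0"
  using assms
proof (induction K)
  case (Suc K)
  then have "(\<Sum>j=1..K. of_bool (D j) * (a j - a (j - 1))) = a (min k K) - a 0" by simp
  moreover have "D (Suc K) \<longleftrightarrow> Suc K \<le> k" using Suc.prems[of "Suc K"] by simp
  ultimately show ?case by (auto simp: min_def)
qed simp

lemma capped_val_consecutive:
  assumes "prime p" "c \<le> 1"
  shows "capped_val p M (2 * n + c) = 0 \<or> capped_val p M (2 * n + (1 - c)) = 0"
proof (rule ccontr)
  assume *: "\<not> ?thesis"
  then have "1 \<le> M" using capped_val_le[of p M "2 * n + c"] by linarith
  then have "p dvd 2 * n + c" "p dvd 2 * n + (1 - c)"
    using * capped_val_ge_iff[of 1 M p "2 * n + c"] capped_val_ge_iff[of 1 M p "2 * n + (1 - c)"]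
    by (simp_all add: Suc_le_eq)
  moreover have "c = 0 \<or> c = 1" using assms(2) by auto
  ultimately have "p dvd 2 * n" "p dvd 2 * n + 1" by auto
  then have "p dvd 1" using dvd_add_right_iff by blast
  then show False using assms(1) not_prime_unit by blast
qed

text \<open>The value at the new prime is at most \<open>u j\<close> or \<open>- v j\<close> when \<open>p\<close> divides \<open>2 * n + c\<close> or
  \<open>2 * n + (1 - c)\<close> to the order \<open>j\<close>, capped at \<open>K1\<close> or \<open>K2\<close>. Abel summation leads to the
  probabilities that \<open>p ^ j\<close> divides, so that the order itself never enters.\<close>

lemma tail_prob_insert:
  assumes p: "prime p" "p \<le> M" and P: "P \<subseteq> {q. prime q \<and> q \<le> M}" "p \<notin> P" and c: "c \<le> 1"
    and K: "K1 \<le> M" "K2 \<le> M"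
    and u: "u 0 = 0" "\<And>n. log_sigma_pow p (capped_val p M (2 * n + c)) \<le> u (min (capped_val p M (2 * n + c)) K1)"
    and v: "v 0 = 0" "\<And>k. v (min k K2) \<le> log_sigma_pow p k"
  shows "tail_prob c M (insert p P) x \<le> tail_prob c M P x
    + (\<Sum>j=1..K1. div_prob c M p j * (tail_prob c M P (x - u j) - tail_prob c M P (x - u (j - 1))))
    + (\<Sum>j=1..K2. div_prob (1 - c) M p j * (tail_prob c M P (x + v j) - tail_prob c M P (x + v (j - 1))))"
proof -
  let ?T = "part_excess c M P"
  define g where "g y n = (of_bool (?T n \<ge> y) :: real)" for y n
  define D where "D b j n = (of_bool (p ^ j dvd 2 * n + b) :: real)" for b j n
  have fin: "finite P" using P(1) finite_subset finite_primes_le by blast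
  have gavg: "avg (modulus M) (g y) = tail_prob c M P y" for y
    by (simp add: avg_def tail_prob_def g_def)
  have gper: "periodic (\<Prod>q\<in>P. q ^ M) (\<lambda>n. g y n - g z n)" for y z
    unfolding g_def
    by (intro periodic_compose2[of _ _ _ "(-)"] periodic_compose[of _ _ "\<lambda>t. of_bool (t \<ge> _)"] periodic_part_excess fin) (use P in auto)
  have Dper: "periodic (p ^ M) (D b j)" if "j \<le> M" for b j
    unfolding D_def
    by (rule periodic_dvd[of "p ^ j"])
      (use p that prime_gt_0_nat in \<open>auto intro!: periodic_compose[of _ _ of_bool] periodic_dvd_affine le_imp_power_dvd\<close>)
  have avg_term: "avg (modulus M) (\<lambda>n. D b j n * (g y n - g z n)) = div_prob b M p j * (tail_prob c M P y - tail_prob c M P z)"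
    if "j \<le> M" for b j y z
  proof -
    have "avg (modulus M) (D b j) = div_prob b M p j" by (simp add: avg_def div_prob_def D_def)
    then show ?thesis
      using avg_mult_prime[OF p P Dper[OF that] gper] by (simp add: avg_diff tail_prob_def g_def)
  qed
  have pointwise: "of_bool (part_excess c M (insert p P) n \<ge> x) \<le> g x n
      + (\<Sum>j=1..K1. D c j n * (g (x - u j) n - g (x - u (j - 1)) n))
      + (\<Sum>j=1..K2. D (1 - c) j n * (g (x + v j) n - g (x + v (j - 1)) n))" (is "_ \<le> ?R") for n
  proof -
    define a where "a = capped_val p M (2 * n + c)"
    define b where "b = capped_val p M (2 * n + (1 - c))"
    have "(\<Sum>j=1..K1. D c j n * (g (x - u j) n - g (x - u (j - 1)) n)) = g (x - u (min a K1)) n - g (x - u 0) n"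
      unfolding D_def a_def
      by (rule sum_indicator_telescope[of K1 _ _ "\<lambda>j. g (x - u j) n"]) (use K capped_val_ge_iff in auto)
    moreover have "(\<Sum>j=1..K2. D (1 - c) j n * (g (x + v j) n - g (x + v (j - 1)) n)) = g (x + v (min b K2)) n - g (x + v 0) n"
      unfolding D_def b_def
      by (rule sum_indicator_telescope[of K2 _ _ "\<lambda>j. g (x + v j) n"]) (use K capped_val_ge_iff in auto)
    \<comment> \<open>Both sums telescope. Since a or b is 0, one of the three terms cancels
      \<open>g x n\<close> and the single relevant shift remains.\<close>
    ultimately have R: "?R = g (x - u (min a K1)) n + g (x + v (min b K2)) n - g x n"
      using u(1) v(1) by simp
    have sum: "part_excess c M (insert p P) n = ?T n + (log_sigma_pow p a - log_sigma_pow p b)"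
      using P(2) fin by (simp add: part_excess_def prime_term_def a_def b_def)
    have "a = 0 \<or> b = 0" unfolding a_def b_def by (rule capped_val_consecutive[OF p(1) c])
    then show ?thesis
    proof
      assume "b = 0"
      then have "?R = g (x - u (min a K1)) n" using R v(1) by simp
      then show ?thesis using sum \<open>b = 0\<close> u(2)[of n, folded a_def] by (auto simp: g_def)
    next
      assume "a = 0"
      then have "?R = g (x + v (min b K2)) n" using R u(1) by simp
      then show ?thesis using sum \<open>a = 0\<close> v(2)[of b] by (auto simp: g_def)
    qed
  qed
  have "tail_prob c M (insert p P) x \<le> avg (modulus M) (\<lambda>n. g x n
      + (\<Sum>j=1..K1. D c j n * (g (x - u j) n - g (x - u (j - 1)) n))
      + (\<Sum>j=1..K2. D (1 - c) j n * (g (x + v j) n - g (x + v (j - 1)) n)))"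
    unfolding tail_prob_def by (intro avg_mono pointwise)
  also have "\<dots> = tail_prob c M P x
    + (\<Sum>j=1..K1. div_prob c M p j * (tail_prob c M P (x - u j) - tail_prob c M P (x - u (j - 1))))
    + (\<Sum>j=1..K2. div_prob (1 - c) M p j * (tail_prob c M P (x + v j) - tail_prob c M P (x + v (j - 1))))"
    unfolding avg_add avg_sum using K by (simp add: avg_term gavg)
  finally show ?thesis .
qed

lemma log_sigma_pow_le:
  assumes "prime p"
  shows "log_sigma_pow p k \<le> ln (real p / real (p - 1))"
proof -
  have p: "real p > 1" using prime_gt_1_nat[OF assms] by simp
  have "(\<Sum>j\<le>k. 1 / real p ^ j) = (\<Sum>j<Suc k. (1 / real p) ^ j)"
    by (simp add: lessThan_Suc_atMost power_one_over)
  also have "\<dots> = (1 - (1 / real p) ^ Suc k) / (1 - 1 / real p)"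
    using p by (subst sum_gp_strict) auto
  also have "\<dots> \<le> 1 / (1 - 1 / real p)"
    using p by (intro divide_right_mono) auto
  also have "\<dots> = real p / real (p - 1)" using p by (simp add: field_simps of_nat_diff)
  finally show ?thesis
    unfolding log_sigma_pow_def using sum_pow_ge_1[of p k] p by (subst ln_le_cancel_iff) (auto intro: less_le_trans[OF zero_less_one])
qed

lemma log_sigma_pow_1: "log_sigma_pow p 1 = ln (1 + 1 / real p)"
  by (simp add: log_sigma_pow_def)

section \<open>Exponential moments\<close>

lemma avg_prod_prime:
  assumes "finite P" "P \<subseteq> {q. prime q \<and> q \<le> M}" "\<And>p. p \<in> P \<Longrightarrow> periodic (p ^ M) (f p)"
  shows "avg (modulus M) (\<lambda>n. \<Prod>p\<in>P. f p n) = (\<Prod>p\<in>P. avg (modulus M) (f p))"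
  using assms
proof (induction P rule: finite_induct)
  case (insert p P)
  have pos: "(\<Prod>q\<in>P. q ^ M) > 0" using insert.prems(1) by (intro prod_pos) (auto dest: prime_gt_0_nat)
  have "periodic (\<Prod>q\<in>P. q ^ M) (f q)" if "q \<in> P" for q
    by (rule periodic_dvd[OF _ _ pos, of "q ^ M"])
      (use insert that in \<open>auto intro: dvd_prodI[of _ _ "\<lambda>p. p ^ M"]\<close>)
  then have "periodic (\<Prod>q\<in>P. q ^ M) (\<lambda>n. \<Prod>q\<in>P. f q n)"
    using pos by (auto simp: periodic_def intro: prod.cong)
  then have "avg (modulus M) (\<lambda>n. f p n * (\<Prod>q\<in>P. f q n)) = avg (modulus M) (f p) * avg (modulus M) (\<lambda>n. \<Prod>q\<in>P. f q n)"
    using insert by (intro avg_mult_prime[of p M P]) auto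
  then show ?case using insert by simp
qed simp

lemma avg_nonneg: "(\<And>n. f n \<ge> 0) \<Longrightarrow> avg Q f \<ge> 0"
  unfolding avg_def by (intro divide_nonneg_nonneg sum_nonneg) auto

lemma prime_term_le:
  assumes "prime p"
  shows "prime_term c M p n \<le> ln (real p / real (p - 1))"
  using log_sigma_pow_le[OF assms, of "capped_val p M (2 * n + c)"]
    log_sigma_pow_nonneg[of p "capped_val p M (2 * n + (1 - c))"]
  by (simp add: prime_term_def)

text \<open>Two disjoint events of probability 1 / p matter. On the first the term is at most its
  supremum ln (p / (p - 1)); on the second it is at most - ln (1 + 1 / p), the value for exact order
  1.\<close>

lemma avg_exp_prime_term:
  assumes "prime p" "odd p" "p \<le> M" "c \<le> 1" "l \<ge> 0"
  shows "avg (modulus M) (\<lambda>n. exp (l * prime_term c M p n))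
    \<le> 1 + (exp (l * ln (real p / real (p - 1))) - 1 + (exp (- (l * ln (1 + 1 / real p))) - 1)) / real p"
proof -
  define A where "A = exp (l * ln (real p / real (p - 1))) - 1"
  define C where "C = exp (- (l * ln (1 + 1 / real p))) - 1"
  have M: "1 \<le> M" using assms(1,3) prime_gt_1_nat[of p] by linarith
  have lnp: "ln (real p / real (p - 1)) \<ge> 0"
    using log_sigma_pow_le[OF assms(1), of 0] by simp
  then have A0: "A \<ge> 0" using assms(5) by (simp add: A_def)
  have pw: "exp (l * prime_term c M p n)
      \<le> 1 + (of_bool (p ^ 1 dvd 2 * n + c) * A + of_bool (p ^ 1 dvd 2 * n + (1 - c)) * C)" for n
  proof (cases "p ^ 1 dvd 2 * n + (1 - c)")
    case True
    then have 1: "capped_val p M (2 * n + (1 - c)) \<ge> 1"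
      using capped_val_ge_iff[of 1 M p] M by simp
    then have 0: "capped_val p M (2 * n + c) = 0"
      using capped_val_consecutive[OF assms(1,4), of M n] by simp
    then have "\<not> p ^ 1 dvd 2 * n + c" using capped_val_ge_iff[of 1 M p "2 * n + c"] M by simp
    moreover have "prime_term c M p n \<le> - ln (1 + 1 / real p)"
      using 0 log_sigma_pow_mono[OF 1, of p] log_sigma_pow_1[of p] by (simp add: prime_term_def)
    then have "l * prime_term c M p n \<le> - (l * ln (1 + 1 / real p))"
      using mult_left_mono[OF _ assms(5)] by fastforce
    ultimately show ?thesis using True by (simp add: C_def)
  next
    case False
    then have 1: "capped_val p M (2 * n + (1 - c)) = 0"
      using capped_val_ge_iff[of 1 M p "2 * n + (1 - c)"] M by simp
    show ?thesis
    proof (cases "p ^ 1 dvd 2 * n + c")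
      case True
      have "l * prime_term c M p n \<le> l * ln (real p / real (p - 1))"
        using prime_term_le[OF assms(1)] assms(5) by (rule mult_left_mono)
      then show ?thesis using True False by (simp add: A_def)
    next
      case F: False
      then have "capped_val p M (2 * n + c) = 0"
        using capped_val_ge_iff[of 1 M p "2 * n + c"] M by simp
      then show ?thesis using 1 F False by (simp add: prime_term_def)
    qed
  qed
  have "avg (modulus M) (\<lambda>n. exp (l * prime_term c M p n))
    \<le> avg (modulus M) (\<lambda>n. 1 + (of_bool (p ^ 1 dvd 2 * n + c) * A + of_bool (p ^ 1 dvd 2 * n + (1 - c)) * C))"
    by (intro avg_mono pw)
  also have "\<dots> = 1 + (A * div_prob c M p 1 + C * div_prob (1 - c) M p 1)"
    unfolding div_prob_def avg_add avg_cmult[symmetric] by (simp add: mult.commute)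
  also have "\<dots> = 1 + (A + C) / real p"
    using div_prob_odd[OF assms(1-3) M] assms(4) by (simp add: add_divide_distrib)
  finally show ?thesis by (simp add: A_def C_def)
qed

text \<open>With p = 2 k + 1, a = l / (2 k) and b = l / (2 k + 2), the two exponentials are at most
  1 + a + a^2 and 1 - b + b^2 / 2. The linear terms nearly cancel, a - b being of order l / k^2, and
  the quadratic ones give the factor 3/2. The condition on \<open>l\<close> ensures a <= 1. Division
  by p leaves order k^-3, put into a form that telescopes.\<close>

lemma exp_moment_bound:
  fixes l :: real
  assumes "k \<ge> 2" "0 \<le> l" "l \<le> 2 * real k"
  defines "p \<equiv> 2 * k + 1"
  shows "(exp (l * ln (real p / real (p - 1))) - 1 + (exp (- (l * ln (1 + 1 / real p))) - 1)) / real p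
    \<le> (2 * l + 3 / 2 * l\<^sup>2) / 8 * (1 / (real (k - 1) * real k * real (k + 1)))"
proof -
  define x where "x = real k"
  have x: "x \<ge> 2" using assms(1) by (simp add: x_def)
  define a where "a = l / (2 * x)"
  define b where "b = l / (2 * x + 2)"
  have a: "0 \<le> a" "a \<le> 1" using assms x by (auto simp: a_def x_def)
  have b: "0 \<le> b" "b \<le> a" using assms(2) x by (auto simp: a_def b_def intro!: divide_left_mono)
  have p: "real p = 2 * x + 1" "real (p - 1) = 2 * x" by (auto simp: p_def x_def)
  have "ln (real p / real (p - 1)) = ln (1 + 1 / (2 * x))" unfolding p using x by (simp add: field_simps)
  also have "\<dots> \<le> 1 / (2 * x)" using x by (intro ln_add_one_self_le_self) auto
  finally have "l * ln (real p / real (p - 1)) \<le> l * (1 / (2 * x))" using assms(2) by (rule mult_left_mono)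
  then have "exp (l * ln (real p / real (p - 1))) \<le> exp a" by (simp add: a_def)
  also have "\<dots> \<le> 1 + a + a\<^sup>2" using a by (intro exp_bound)
  finally have 1: "exp (l * ln (real p / real (p - 1))) \<le> 1 + a + a\<^sup>2" .
  have "- ln (1 + 1 / real p) = ln (1 - 1 / (2 * x + 2))"
    using x by (subst ln_inverse[symmetric]) (simp add: p field_simps)
  also have "\<dots> \<le> - (1 / (2 * x + 2))" using ln_add_one_self_le_self2[of "- (1 / (2 * x + 2))"] x by simp
  finally have "l * (1 / (2 * x + 2)) \<le> l * ln (1 + 1 / real p)" using assms(2) by (intro mult_left_mono) auto
  then have "exp (- (l * ln (1 + 1 / real p))) \<le> inverse (exp b)" by (simp add: b_def exp_minus[symmetric])
  also have "\<dots> \<le> inverse (1 + b + b\<^sup>2 / 2)"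
    using exp_lower_Taylor_quadratic[OF b(1)] b by (intro le_imp_inverse_le) (auto intro: add_pos_nonneg)
  also have "\<dots> \<le> 1 - b + b\<^sup>2 / 2"
  proof -
    have "(1 - b + b\<^sup>2 / 2) * (1 + b + b\<^sup>2 / 2) = 1 + b ^ 4 / 4"
      by (simp add: power2_eq_square power4_eq_xxxx algebra_simps)
    moreover have "1 + b + b\<^sup>2 / 2 > 0" using b by (simp add: add_pos_nonneg)
    ultimately show ?thesis by (simp add: inverse_eq_divide divide_le_eq)
  qed
  finally have 2: "exp (- (l * ln (1 + 1 / real p))) \<le> 1 - b + b\<^sup>2 / 2" .
  have "b\<^sup>2 \<le> a\<^sup>2" using b by (intro power_mono)
  have ab: "a - b \<le> 2 * l / (4 * x\<^sup>2)"
  proof -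
    have "a - b = 2 * l / ((2 * x) * (2 * x + 2))" using x by (simp add: a_def b_def diff_frac_eq algebra_simps)
    also have "(2 * x) * (2 * x + 2) = 4 * x * (x + 1)" by (simp add: algebra_simps)
    finally have "a - b = 2 * l / (4 * x * (x + 1))" .
    also have "2 * l / (4 * x * (x + 1)) \<le> 2 * l / (4 * x\<^sup>2)"
      using assms(2) x by (intro divide_left_mono) (auto simp: power2_eq_square)
    finally show ?thesis .
  qed
  have a2: "a\<^sup>2 = l\<^sup>2 / (4 * x\<^sup>2)" by (simp add: a_def power_divide power_mult_distrib)
  have "exp (l * ln (real p / real (p - 1))) - 1 + (exp (- (l * ln (1 + 1 / real p))) - 1) \<le> a - b + 3 / 2 * a\<^sup>2"
    using 1 2 \<open>b\<^sup>2 \<le> a\<^sup>2\<close> by linarith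
  also have "\<dots> \<le> (2 * l + 3 / 2 * l\<^sup>2) / (4 * x\<^sup>2)"
    using ab unfolding a2 by (simp add: add_divide_distrib)
  finally have "(exp (l * ln (real p / real (p - 1))) - 1 + (exp (- (l * ln (1 + 1 / real p))) - 1)) / real p
    \<le> (2 * l + 3 / 2 * l\<^sup>2) / (4 * x\<^sup>2) / real p"
    by (rule divide_right_mono) simp
  also have "\<dots> = (2 * l + 3 / 2 * l\<^sup>2) * (1 / (4 * x\<^sup>2 * (2 * x + 1)))" by (simp add: p)
  also have "\<dots> \<le> (2 * l + 3 / 2 * l\<^sup>2) * (1 / (8 * ((x - 1) * x * (x + 1))))"
  proof (intro mult_left_mono divide_left_mono)
    have "4 * x\<^sup>2 * (2 * x + 1) - 8 * ((x - 1) * x * (x + 1)) = 4 * x\<^sup>2 + 8 * x"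
      by (simp add: power2_eq_square algebra_simps)
    moreover have "4 * x\<^sup>2 + 8 * x \<ge> 0" using x by simp
    ultimately show "8 * ((x - 1) * x * (x + 1)) \<le> 4 * x\<^sup>2 * (2 * x + 1)" by linarith
  qed (use x assms(2) in auto)
  also have "\<dots> = (2 * l + 3 / 2 * l\<^sup>2) / 8 * (1 / (real (k - 1) * real k * real (k + 1)))"
  proof -
    have "real (k - 1) = x - 1" "real k = x" "real (k + 1) = x + 1" using assms(1) by (simp_all add: x_def of_nat_diff)
    then show ?thesis by simp
  qed
  finally show ?thesis .
qed

text \<open>Each summand is half the difference of 1 / ((k - 1) k) and 1 / (k (k + 1)).\<close>

lemma sum_inverse_triple_le:
  assumes "k0 \<ge> 2"
  shows "(\<Sum>k\<in>{k0..<K}. 1 / (real (k - 1) * real k * real (k + 1))) \<le> 1 / (2 * real (k0 - 1) * real k0)"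
proof (cases "k0 \<le> K")
  case True
  then have "(\<Sum>k\<in>{k0..<K}. 1 / (real (k - 1) * real k * real (k + 1)))
      = 1 / (2 * real (k0 - 1) * real k0) - 1 / (2 * real (K - 1) * real K)"
  proof (induction K rule: dec_induct)
    case (step n)
    have n: "real n \<ge> 2" using assms step by simp
    have "1 / (real (n - 1) * real n * real (n + 1)) = 1 / (2 * real (n - 1) * real n) - 1 / (2 * real n * real (n + 1))"
      using n assms step by (simp add: of_nat_diff divide_simps)
    then show ?case using step by simp
  qed simp
  then show ?thesis by simp
qed simp

text \<open>Chernoff's bound: the exponential moment factors by independence, and each factor 1 + h
  is at most exp h. Summing h over all odd numbers above 2 * k0 instead of the primes gives a bound
  uniform in \<open>M\<close>.\<close>

lemma tail_prob_large_primes: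
  fixes l :: real
  assumes "k0 \<ge> 2" "0 \<le> l" "l \<le> 2 * real k0" "c \<le> 1"
  shows "tail_prob c M {p. prime p \<and> 2 * k0 < p \<and> p \<le> M} x
    \<le> exp ((2 * l + 3 / 2 * l\<^sup>2) / (16 * real (k0 - 1) * real k0) - l * x)"
proof -
  define P where "P = {p. prime p \<and> 2 * k0 < p \<and> p \<le> M}"
  define h where "h k = (2 * l + 3 / 2 * l\<^sup>2) / 8 * (1 / (real (k - 1) * real k * real (k + 1)))" for k
  have P: "P \<subseteq> {q. prime q \<and> q \<le> M}" "finite P" unfolding P_def by (auto intro: finite_subset[OF _ finite_primes_le])
  have oddp: "odd p" if "p \<in> P" for p
    using that assms(1) prime_odd_nat[of p] by (auto simp: P_def)
  have h0: "h k \<ge> 0" for k using assms(2) by (simp add: h_def)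
  have "tail_prob c M P x \<le> avg (modulus M) (\<lambda>n. exp (- l * x) * exp (l * part_excess c M P n))"
    unfolding tail_prob_def
  proof (rule avg_mono)
    fix n
    have "exp (- l * x) * exp (l * part_excess c M P n) = exp (l * (part_excess c M P n - x))"
      by (simp add: exp_add[symmetric] algebra_simps)
    then show "of_bool (part_excess c M P n \<ge> x) \<le> exp (- l * x) * exp (l * part_excess c M P n)"
      using assms(2) by (auto simp: of_bool_def)
  qed
  also have "\<dots> = exp (- l * x) * avg (modulus M) (\<lambda>n. \<Prod>p\<in>P. exp (l * prime_term c M p n))"
    using P(2) by (simp add: avg_cmult part_excess_def sum_distrib_left exp_sum)
  also have "avg (modulus M) (\<lambda>n. \<Prod>p\<in>P. exp (l * prime_term c M p n)) = (\<Prod>p\<in>P. avg (modulus M) (\<lambda>n. exp (l * prime_term c M p n)))"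
    using P by (intro avg_prod_prime) (auto intro!: periodic_compose[of _ _ "\<lambda>t. exp (l * t)"] periodic_prime_term)
  also have "\<dots> \<le> (\<Prod>p\<in>P. exp (h (p div 2)))"
  proof (intro prod_mono conjI avg_nonneg)
    fix p assume p: "p \<in> P"
    define k where "k = p div 2"
    have pk: "p = 2 * k + 1" using oddp[OF p] by (simp add: k_def)
    have k: "k \<ge> k0" using p pk by (simp add: P_def)
    have "avg (modulus M) (\<lambda>n. exp (l * prime_term c M p n))
      \<le> 1 + (exp (l * ln (real p / real (p - 1))) - 1 + (exp (- (l * ln (1 + 1 / real p))) - 1)) / real p"
      using p oddp[OF p] assms by (intro avg_exp_prime_term) (auto simp: P_def)
    also have "\<dots> \<le> 1 + h k"
      using exp_moment_bound[of k l] assms k unfolding pk h_def by (intro add_left_mono) auto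
    also have "\<dots> \<le> exp (h k)" by (rule exp_ge_add_one_self)
    finally show "avg (modulus M) (\<lambda>n. exp (l * prime_term c M p n)) \<le> exp (h (p div 2))" by (simp add: k_def)
  qed auto
  also have "\<dots> = exp (\<Sum>p\<in>P. h (p div 2))" using P(2) by (simp add: exp_sum)
  also have "(\<Sum>p\<in>P. h (p div 2)) \<le> (2 * l + 3 / 2 * l\<^sup>2) / 8 * (1 / (2 * real (k0 - 1) * real k0))"
  proof -
    have "inj_on (\<lambda>p. p div 2) P" using oddp by (intro inj_onI) (metis odd_two_times_div_two_succ)
    then have "(\<Sum>p\<in>P. h (p div 2)) = (\<Sum>k\<in>(\<lambda>p. p div 2) ` P. h k)" by (simp add: sum.reindex)
    also have "\<dots> \<le> (\<Sum>k\<in>{k0..<Suc M}. h k)"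
      by (intro sum_mono2) (auto simp: P_def h0)
    also have "\<dots> = (2 * l + 3 / 2 * l\<^sup>2) / 8 * (\<Sum>k\<in>{k0..<Suc M}. 1 / (real (k - 1) * real k * real (k + 1)))"
      unfolding h_def sum_distrib_left ..
    also have "\<dots> \<le> (2 * l + 3 / 2 * l\<^sup>2) / 8 * (1 / (2 * real (k0 - 1) * real k0))"
      using assms by (intro mult_left_mono sum_inverse_triple_le) auto
    finally show ?thesis .
  qed
  finally have "tail_prob c M P x \<le> exp (- l * x) * exp ((2 * l + 3 / 2 * l\<^sup>2) / 8 * (1 / (2 * real (k0 - 1) * real k0)))"
    by (simp add: mult_left_mono)
  also have "\<dots> = exp ((2 * l + 3 / 2 * l\<^sup>2) / (16 * real (k0 - 1) * real k0) - l * x)"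
    by (simp add: exp_add[symmetric])
  finally show ?thesis by (simp add: P_def)
qed

section \<open>Anticoncentration\<close>

text \<open>Erdos' argument: if the primes above \<open>k\<close> contributed at most \<open>1/2\<close>, then half of the
  numbers up to \<open>s\<^sup>2\<close> would be \<open>k\<close>-smooth, hence determined by their square part and by the
  set of primes \<open>p \<le> k\<close> with odd exponent.\<close>

lemma prime_reciprocals_unbounded:
  "\<exists>N. (\<Sum>p | prime p \<and> k < p \<and> p \<le> N. 1 / real p) > 1 / 2"
proof (rule ccontr)
  assume "\<not> ?thesis"
  then have small: "(\<Sum>p | prime p \<and> k < p \<and> p \<le> N. 1 / real p) \<le> 1 / 2" for N
    by (simp add: not_less)
  \<comment> \<open>There are at most 2^(k + 1) * s smooth numbers, so if half of the numbers up to
    s^2 are smooth then s <= 2^(k + 2); this \<open>s\<close> is one larger.\<close>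
  define s :: nat where "s = 2 ^ (k + 2) + 1"
  define N where "N = s ^ 2"
  define Sm where "Sm = {n \<in> {1..N}. \<forall>p. prime p \<longrightarrow> p dvd n \<longrightarrow> p \<le> k}"
  have fin: "finite {p. prime p \<and> k < p \<and> p \<le> N}" by (rule finite_subset[of _ "{..N}"]) auto
  have "{1..N} \<subseteq> Sm \<union> (\<Union>p\<in>{p. prime p \<and> k < p \<and> p \<le> N}. {n \<in> {1..N}. p dvd n})"
    by (auto simp: Sm_def not_le) (metis dvd_imp_le le_trans not_less not_less_eq_eq)
  then have "card {1..N} \<le> card (Sm \<union> (\<Union>p\<in>{p. prime p \<and> k < p \<and> p \<le> N}. {n \<in> {1..N}. p dvd n}))"
    using fin by (intro card_mono) (auto simp: Sm_def)
  also have "\<dots> \<le> card Sm + card (\<Union>p\<in>{p. prime p \<and> k < p \<and> p \<le> N}. {n \<in> {1..N}. p dvd n})"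
    by (rule card_Un_le)
  also have "card (\<Union>p\<in>{p. prime p \<and> k < p \<and> p \<le> N}. {n \<in> {1..N}. p dvd n})
      \<le> (\<Sum>p | prime p \<and> k < p \<and> p \<le> N. card {n \<in> {1..N}. p dvd n})"
    by (rule card_UN_le[OF fin])
  finally have "real N \<le> real (card Sm) + (\<Sum>p | prime p \<and> k < p \<and> p \<le> N. real (card {n \<in> {1..N}. p dvd n}))"
    by (simp flip: of_nat_sum of_nat_add)
  also have "(\<Sum>p | prime p \<and> k < p \<and> p \<le> N. real (card {n \<in> {1..N}. p dvd n}))
      \<le> (\<Sum>p | prime p \<and> k < p \<and> p \<le> N. real N * (1 / real p))"
  proof (rule sum_mono)
    fix p assume "p \<in> {p. prime p \<and> k < p \<and> p \<le> N}"
    then have p: "p > 0" by auto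
    have "{n \<in> {1..N}. p dvd n} \<subseteq> (\<lambda>k. p * k) ` {1..N div p}"
      using p by (auto simp: dvd_def image_iff less_eq_div_iff_mult_less_eq mult.commute)
    then have "card {n \<in> {1..N}. p dvd n} \<le> card ((\<lambda>k. p * k) ` {1..N div p})"
      by (intro card_mono) auto
    also have "\<dots> \<le> N div p" using card_image_le[of "{1..N div p}" "\<lambda>k. p * k"] by simp
    finally have "real (card {n \<in> {1..N}. p dvd n}) \<le> real (N div p)" by simp
    moreover have "real (N div p) * real p \<le> real N" by (metis div_times_less_eq_dividend of_nat_le_iff of_nat_mult)
    then have "real (N div p) \<le> real N / real p" using p by (simp add: field_simps)
    ultimately show "real (card {n \<in> {1..N}. p dvd n}) \<le> real N * (1 / real p)" by simp
  qed
  also have "\<dots> = real N * (\<Sum>p | prime p \<and> k < p \<and> p \<le> N. 1 / real p)" by (simp add: sum_distrib_left)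
  also have "\<dots> \<le> real N * (1 / 2)" using small by (intro mult_left_mono) auto
  finally have large: "real N \<le> 2 * real (card Sm)" by simp
  define f where "f n = ({p. p \<le> k \<and> prime p \<and> odd (multiplicity p n)}, square_part n)" for n :: nat
  have "inj_on f Sm"
  proof (rule inj_onI)
    fix n m assume nm: "n \<in> Sm" "m \<in> Sm" "f n = f m"
    show "n = m"
    proof (rule multiplicity_eq_nat)
      fix p :: nat assume p: "prime p"
      show "multiplicity p n = multiplicity p m"
      proof (cases "p \<le> k")
        case True
        have "odd (multiplicity p n) \<longleftrightarrow> odd (multiplicity p m)" using nm(3) True p by (auto simp: f_def)
        moreover have "multiplicity p n div 2 = multiplicity p m div 2"
          using nm(3) prime_multiplicity_square_part[OF p] by (metis f_def snd_conv)
        ultimately show ?thesis by presburger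
      next
        case False
        then have "\<not> p dvd n" "\<not> p dvd m" using nm p by (auto simp: Sm_def)
        then show ?thesis by (simp add: not_dvd_imp_multiplicity_0)
      qed
    qed (use nm in \<open>auto simp: Sm_def\<close>)
  qed
  moreover have "f ` Sm \<subseteq> Pow {..k} \<times> {1..s}"
  proof
    fix y assume "y \<in> f ` Sm"
    then obtain n where n: "n \<in> Sm" "y = f n" by auto
    have n0: "n > 0" "n \<le> N" using n(1) by (auto simp: Sm_def)
    have "square_part n ^ 2 \<le> n" using n0 by (intro dvd_imp_le) auto
    then have "square_part n ^ 2 \<le> s ^ 2" using n0 unfolding N_def by linarith
    then have "square_part n \<le> s" by (rule power2_le_imp_le) simp
    moreover have "0 < square_part n" using n0 square_part_0_iff[of n] by (intro gr0I) simp
    ultimately have "square_part n \<in> {1..s}" by simp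
    then show "y \<in> Pow {..k} \<times> {1..s}" unfolding n(2) f_def by (intro SigmaI) auto
  qed
  ultimately have "card Sm \<le> card (Pow {..k} \<times> {1..s})" using card_inj_on_le by blast
  also have "\<dots> = 2 ^ (k + 1) * s" by (simp add: card_Pow)
  finally have "card Sm \<le> 2 ^ (k + 1) * s" .
  moreover have "N \<le> 2 * card Sm" using large by linarith
  ultimately have "N \<le> 2 * (2 ^ (k + 1) * s)" by linarith
  then have "s * s \<le> 2 ^ (k + 2) * s" by (simp add: N_def power2_eq_square mult.assoc)
  then have "s \<le> 2 ^ (k + 2)" by (simp add: s_def)
  then show False by (simp add: s_def)
qed

text \<open>Disjoint blocks of primes, each contributing more than 1/2, are appended one beyond the
  other.\<close>

lemma prime_reciprocals_diverge:
  "\<exists>N. (\<Sum>p | prime p \<and> k < p \<and> p \<le> N. 1 / real p) > C"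
proof -
  have "\<exists>N. (\<Sum>p | prime p \<and> k < p \<and> p \<le> N. 1 / real p) \<ge> real m / 2" for m
  proof (induction m)
    case (Suc m)
    then obtain N where N: "(\<Sum>p | prime p \<and> k < p \<and> p \<le> N. 1 / real p) \<ge> real m / 2" by blast
    obtain N' where N': "(\<Sum>p | prime p \<and> max k N < p \<and> p \<le> N'. 1 / real p) > 1 / 2"
      using prime_reciprocals_unbounded by blast
    have fin: "finite {p. prime p \<and> a < p \<and> p \<le> b}" for a b :: nat by (rule finite_subset[of _ "{..b}"]) auto
    have "(\<Sum>p | prime p \<and> k < p \<and> p \<le> N. 1 / real p) + (\<Sum>p | prime p \<and> max k N < p \<and> p \<le> N'. 1 / real p)
        = (\<Sum>p\<in>{p. prime p \<and> k < p \<and> p \<le> N} \<union> {p. prime p \<and> max k N < p \<and> p \<le> N'}. 1 / real p)"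
      using fin by (intro sum.union_disjoint[symmetric]) auto
    also have "\<dots> \<le> (\<Sum>p | prime p \<and> k < p \<and> p \<le> max N N'. 1 / real p)"
      using fin by (intro sum_mono2) auto
    finally show ?case using N N' by (intro exI[of _ "max N N'"]) (simp add: add_divide_distrib)
  qed (simp add: sum_nonneg)
  moreover obtain m where "real m / 2 > C" using reals_Archimedean2[of "2 * C"] by (auto simp: field_simps)
  ultimately show ?thesis by (meson less_le_trans)
qed

text \<open>An interval of length \<open>2 * r\<close> cannot be hit often: if \<open>p\<close> exactly divides \<open>2 * n + 1\<close> for
  some \<open>p \<in> W\<close>, removing that factor moves the value by \<open>- ln (1 + 1 / p)\<close>, and these shifts are
  pairwise separated by more than \<open>2 * r\<close>.\<close>

lemma anticoncentration:
  assumes W: "W \<subseteq> {p. prime p \<and> p \<le> M}" "\<And>p. p \<in> W \<Longrightarrow> p \<ge> p1" "p1 \<ge> 3" and M: "M \<ge> 2"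
    and sep: "\<And>p q. p \<in> W \<Longrightarrow> q \<in> W \<Longrightarrow> p \<noteq> q \<Longrightarrow> \<bar>ln (1 + 1 / real p) - ln (1 + 1 / real q)\<bar> > 2 * r"
  shows "avg (modulus M) (\<lambda>n. of_bool (\<bar>excess 1 M n\<bar> \<le> r))
    \<le> (\<Prod>p\<in>W. 1 - (1 / real p - 1 / real p ^ 2)) + 1 / (real p1 - 2)"
proof -
  define Q where "Q = {p. prime p \<and> p \<le> M}"
  define Z where "Z = excess 1 M"
  \<comment> \<open>\<open>s\<close> indicates that p divides 2 * n + 1 exactly once,
    \<open>i\<close> that p divides neither 2 * n nor 2 * n + 1.\<close>
  define s where "s p n = (of_bool (p ^ 1 dvd 2 * n + 1) - of_bool (p ^ 2 dvd 2 * n + 1) :: real)" for p n :: nat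
  define i where "i p n = (1 - of_bool (p ^ 1 dvd 2 * n + 0) - of_bool (p ^ 1 dvd 2 * n + 1) :: real)" for p n :: nat
  have finW: "finite W" using W(1) finite_subset finite_primes_le by blast
  have odd: "odd p" if "p \<in> W" for p
    using that W(1) W(2)[OF that] W(3) prime_odd_nat[of p] by auto
  have s01: "s p n = 0 \<or> s p n = 1" for p n
    using dvd_trans[OF le_imp_power_dvd[of 1 2 p], of "2 * n + 1"] by (auto simp: s_def)
  have i01: "i p n = 0 \<or> i p n = 1" if "p \<in> W" for p n
  proof -
    have "\<not> (p dvd 2 * n \<and> p dvd 2 * n + 1)"
    proof
      assume "p dvd 2 * n \<and> p dvd 2 * n + 1"
      then have "p dvd 1" using dvd_add_right_iff by blast
      then show False using W(2)[OF that] W(3) by simp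
    qed
    then show ?thesis by (auto simp: i_def)
  qed
  have sper: "periodic (p ^ M) (s p)" and iper: "periodic (p ^ M) (i p)" if "p \<in> W" for p
  proof -
    have p: "p > 0" using that W by force
    have d: "periodic (p ^ M) (\<lambda>n. of_bool (p ^ j dvd 2 * n + b) :: real)" if "j \<le> M" for j b
      by (rule periodic_dvd[of "p ^ j"])
        (use p that in \<open>auto intro!: periodic_compose[of _ _ of_bool] periodic_dvd_affine le_imp_power_dvd\<close>)
    show "periodic (p ^ M) (s p)" "periodic (p ^ M) (i p)"
      using d[of 1 0] d[of 1 1] d[of 2 1] M unfolding periodic_def s_def i_def by auto
  qed
  have avg_s: "avg (modulus M) (s p) = 1 / real p - 1 / real p ^ 2" if "p \<in> W" for p
    unfolding s_def avg_diff using that W(1) M odd[OF that] div_prob_odd[of p M 1 1] div_prob_odd[of p M 2 1]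
    by (simp add: div_prob_def subset_iff)
  have avg_i: "avg (modulus M) (i p) = (real p - 2) / real p" if "p \<in> W" for p
    unfolding i_def avg_diff using that W M odd[OF that] div_prob_odd[of p M 1 0] div_prob_odd[of p M 1 1]
    by (force simp: div_prob_def subset_iff field_simps)
  have active: "avg (modulus M) (\<lambda>n. s p n * of_bool (\<bar>Z n\<bar> \<le> r))
      \<le> 1 / (real p1 - 2) * avg (modulus M) (\<lambda>n. of_bool (\<bar>ln (1 + 1 / real p) + Z n\<bar> \<le> r))" if p: "p \<in> W" for p
  proof -
    define Z' where "Z' = part_excess 1 M (Q - {p})"
    define g where "g n = (of_bool (\<bar>ln (1 + 1 / real p) + Z' n\<bar> \<le> r) :: real)" for n
    have pr: "prime p" "p \<le> M" "p \<ge> 3" using p W by force+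
    have Z: "Z n = prime_term 1 M p n + Z' n" for n
      unfolding Z_def Z'_def excess_eq_part_excess part_excess_def Q_def
      using pr by (subst sum.remove[of _ p]) auto
    have gper: "periodic (\<Prod>q\<in>Q - {p}. q ^ M) g"
      unfolding g_def Z'_def
      by (intro periodic_compose[of _ _ "\<lambda>t. of_bool (\<bar>_ + t\<bar> \<le> r)"] periodic_part_excess) (auto simp: Q_def)
    have Q: "Q - {p} \<subseteq> {q. prime q \<and> q \<le> M}" "p \<notin> Q - {p}" by (auto simp: Q_def)
    have "avg (modulus M) (\<lambda>n. s p n * of_bool (\<bar>Z n\<bar> \<le> r)) \<le> avg (modulus M) (\<lambda>n. s p n * g n)"
    proof (rule avg_mono)
      fix n
      show "s p n * of_bool (\<bar>Z n\<bar> \<le> r) \<le> s p n * g n"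
      proof (cases "s p n = 0")
        case False
        moreover have "p ^ 1 dvd 2 * n + 1" if "p ^ 2 dvd 2 * n + 1"
          by (rule dvd_trans[OF le_imp_power_dvd that]) simp
        ultimately have d: "p ^ 1 dvd 2 * n + 1" "\<not> p ^ 2 dvd 2 * n + 1"
          by (cases "p ^ 2 dvd 2 * n + 1"; cases "p ^ 1 dvd 2 * n + 1"; auto simp: s_def)+
        then have v1: "capped_val p M (2 * n + 1) = 1"
          using capped_val_ge_iff[of 1 M p "2 * n + 1"] capped_val_ge_iff[of 2 M p "2 * n + 1"] M by auto
        then have "capped_val p M (2 * n + 0) = 0"
          using capped_val_consecutive[OF pr(1), of 1 M n] by simp
        then have "prime_term 1 M p n = ln (1 + 1 / real p)"
          using v1 log_sigma_pow_1[of p] by (simp add: prime_term_def)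
        then show ?thesis using Z[of n] by (simp add: g_def)
      qed simp
    qed
    also have "\<dots> = avg (modulus M) (s p) * avg (modulus M) g"
      by (rule avg_mult_prime[OF pr(1,2) Q sper[OF p] gper])
    \<comment> \<open>Both conditions on p are independent of \<open>Z'\<close>. Exact divisibility
      has probability below 1 / p and divisibility of neither number has probability (p - 2) / p, so
      exchanging them costs at most the factor 1 / (p1 - 2). On the second event \<open>Z\<close>
      equals \<open>Z'\<close>.\<close>
    also have "\<dots> \<le> 1 / (real p1 - 2) * avg (modulus M) (i p) * avg (modulus M) g"
    proof (intro mult_right_mono avg_nonneg)
      have "real p \<ge> real p1" "real p1 \<ge> 3" using W(2)[OF p] W(3) by auto
      then have "1 / real p \<le> 1 / (real p1 - 2) * ((real p - 2) / real p)"
        by (simp add: field_simps)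
      moreover have "1 / real p - 1 / real p ^ 2 \<le> 1 / real p" by simp
      ultimately show "avg (modulus M) (s p) \<le> 1 / (real p1 - 2) * avg (modulus M) (i p)"
        unfolding avg_s[OF p] avg_i[OF p] by linarith
    qed (simp add: g_def)
    also have "\<dots> = 1 / (real p1 - 2) * avg (modulus M) (\<lambda>n. i p n * g n)"
      using avg_mult_prime[OF pr(1,2) Q iper[OF p] gper] by simp
    also have "\<dots> \<le> 1 / (real p1 - 2) * avg (modulus M) (\<lambda>n. of_bool (\<bar>ln (1 + 1 / real p) + Z n\<bar> \<le> r))"
    proof (intro mult_left_mono avg_mono)
      fix n
      show "i p n * g n \<le> of_bool (\<bar>ln (1 + 1 / real p) + Z n\<bar> \<le> r)"
      proof (cases "i p n = 0")
        case False
        then have i1: "i p n = 1" using i01[OF p] by blast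
        then have "\<not> p ^ 1 dvd 2 * n + 0" "\<not> p ^ 1 dvd 2 * n + 1"
          by (cases "p ^ 1 dvd 2 * n + 0"; cases "p ^ 1 dvd 2 * n + 1"; simp add: i_def)+
        then have "capped_val p M (2 * n + 1) = 0" "capped_val p M (2 * n + 0) = 0"
          using capped_val_ge_iff[of 1 M p "2 * n + 1"] capped_val_ge_iff[of 1 M p "2 * n + 0"] M by auto
        then have "prime_term 1 M p n = 0" by (simp add: prime_term_def)
        then show ?thesis using Z[of n] i1 by (simp add: g_def)
      qed simp
    qed (use W(3) in simp)
    finally show ?thesis .
  qed
  \<comment> \<open>Either no p in \<open>W\<close> divides 2 * n + 1 exactly once, which the
    product records, or one summand equals the whole indicator.\<close>
  have "avg (modulus M) (\<lambda>n. of_bool (\<bar>Z n\<bar> \<le> r))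
      \<le> avg (modulus M) (\<lambda>n. (\<Prod>p\<in>W. 1 - s p n) + (\<Sum>p\<in>W. s p n * of_bool (\<bar>Z n\<bar> \<le> r)))"
  proof (rule avg_mono)
    fix n
    have nn: "(\<Prod>p\<in>W. 1 - s p n) \<ge> 0"
      using s01 by (intro prod_nonneg) (metis diff_ge_0_iff_ge order_refl zero_le_one)
    have nn2: "s p n * of_bool (\<bar>Z n\<bar> \<le> r) \<ge> 0" for p using s01[of p n] by auto
    show "of_bool (\<bar>Z n\<bar> \<le> r) \<le> (\<Prod>p\<in>W. 1 - s p n) + (\<Sum>p\<in>W. s p n * of_bool (\<bar>Z n\<bar> \<le> r))"
    proof (cases "\<exists>p\<in>W. s p n = 1")
      case True
      then obtain p where p: "p \<in> W" "s p n = 1" by blast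
      have "of_bool (\<bar>Z n\<bar> \<le> r) \<le> (\<Sum>p\<in>W. s p n * of_bool (\<bar>Z n\<bar> \<le> r))"
        using p member_le_sum[OF p(1), of "\<lambda>p. s p n * of_bool (\<bar>Z n\<bar> \<le> r)"] nn2 finW by simp
      then show ?thesis using nn by linarith
    next
      case False
      then have "\<forall>p\<in>W. s p n = 0" using s01 by blast
      then show ?thesis by simp
    qed
  qed
  also have "\<dots> = (\<Prod>p\<in>W. 1 - (1 / real p - 1 / real p ^ 2)) + (\<Sum>p\<in>W. avg (modulus M) (\<lambda>n. s p n * of_bool (\<bar>Z n\<bar> \<le> r)))"
  proof -
    have "avg (modulus M) (\<lambda>n. \<Prod>p\<in>W. 1 - s p n) = (\<Prod>p\<in>W. avg (modulus M) (\<lambda>n. 1 - s p n))"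
      using W(1) finW by (intro avg_prod_prime periodic_compose[OF sper]) auto
    also have "\<dots> = (\<Prod>p\<in>W. 1 - (1 / real p - 1 / real p ^ 2))"
      by (intro prod.cong) (auto simp: avg_diff avg_s)
    finally show ?thesis by (simp add: avg_add avg_sum)
  qed
  also have "(\<Sum>p\<in>W. avg (modulus M) (\<lambda>n. s p n * of_bool (\<bar>Z n\<bar> \<le> r)))
      \<le> (\<Sum>p\<in>W. 1 / (real p1 - 2) * avg (modulus M) (\<lambda>n. of_bool (\<bar>ln (1 + 1 / real p) + Z n\<bar> \<le> r)))"
    by (intro sum_mono active)
  also have "\<dots> = 1 / (real p1 - 2) * avg (modulus M) (\<lambda>n. \<Sum>p\<in>W. of_bool (\<bar>ln (1 + 1 / real p) + Z n\<bar> \<le> r))"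
    by (simp add: avg_sum sum_distrib_left)
  also have "\<dots> \<le> 1 / (real p1 - 2) * avg (modulus M) (\<lambda>_. 1)"
  proof (intro mult_left_mono avg_mono)
    fix n
    \<comment> \<open>Two different p would have shifts within 2 * r of each other.\<close>
    have "card {p \<in> W. \<bar>ln (1 + 1 / real p) + Z n\<bar> \<le> r} \<le> 1"
    proof (rule card_le_Suc0_iff_eq[THEN iffD2, folded One_nat_def])
      show "\<forall>p\<in>{p \<in> W. \<bar>ln (1 + 1 / real p) + Z n\<bar> \<le> r}. \<forall>q\<in>{p \<in> W. \<bar>ln (1 + 1 / real p) + Z n\<bar> \<le> r}. p = q"
      proof (intro ballI, rule ccontr)
        fix p q assume pq: "p \<in> {p \<in> W. \<bar>ln (1 + 1 / real p) + Z n\<bar> \<le> r}" "q \<in> {p \<in> W. \<bar>ln (1 + 1 / real p) + Z n\<bar> \<le> r}" "p \<noteq> q"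
        then show False using sep[of p q] by (simp; linarith)
      qed
    qed (use finW in auto)
    moreover have "(\<Sum>p\<in>W. of_bool (\<bar>ln (1 + 1 / real p) + Z n\<bar> \<le> r)) = real (card {p \<in> W. \<bar>ln (1 + 1 / real p) + Z n\<bar> \<le> r})"
      using finW by (simp add: of_bool_def sum.If_cases Int_def)
    ultimately show "(\<Sum>p\<in>W. of_bool (\<bar>ln (1 + 1 / real p) + Z n\<bar> \<le> r)) \<le> (1::real)" by simp
  qed (use W(3) in simp)
  finally show ?thesis by (simp add: Z_def)
qed

text \<open>Half of e pays for each term: \<open>p1\<close> is chosen with 1 / (p1 - 2) <= e / 2,
  and each factor is at most exp (- 1 / (2 p)) because p^-2 <= 1 / (2 p), so a reciprocal sum above
  2 ln (2 / e) suffices. Finitely many distinct shifts have a positive least distance.\<close>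

lemma exists_separated_primes:
  assumes "e > 0"
  obtains W p1 r where "finite W" "\<And>p. p \<in> W \<Longrightarrow> prime p \<and> p \<ge> p1" "p1 \<ge> 3" "r > 0"
    "(\<Prod>p\<in>W. 1 - (1 / real p - 1 / real p ^ 2)) + 1 / (real p1 - 2) \<le> e"
    "\<And>p q. p \<in> W \<Longrightarrow> q \<in> W \<Longrightarrow> p \<noteq> q \<Longrightarrow> \<bar>ln (1 + 1 / real p) - ln (1 + 1 / real q)\<bar> > 2 * r"
proof -
  define p1 where "p1 = nat \<lceil>2 / e\<rceil> + 3"
  have "2 / e \<le> real p1 - 2" unfolding p1_def by linarith
  moreover have "0 < 2 / e" using assms by simp
  ultimately have "1 / (real p1 - 2) \<le> 1 / (2 / e)" using assms by (intro divide_left_mono mult_pos_pos) linarith+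
  then have p1: "1 / (real p1 - 2) \<le> e / 2" by simp
  obtain N where N: "(\<Sum>p | prime p \<and> p1 < p \<and> p \<le> N. 1 / real p) > 2 * ln (2 / e)"
    using prime_reciprocals_diverge by blast
  define W where "W = {p. prime p \<and> p1 < p \<and> p \<le> N}"
  have fin: "finite W" unfolding W_def by (rule finite_subset[of _ "{..N}"]) auto
  have "(\<Prod>p\<in>W. 1 - (1 / real p - 1 / real p ^ 2)) \<le> (\<Prod>p\<in>W. exp (- (1 / real p) / 2))"
  proof (intro prod_mono conjI)
    fix p assume "p \<in> W"
    then have p: "real p \<ge> 2" using prime_ge_2_nat by (auto simp: W_def)
    define y where "y = 1 / real p"
    have y: "0 \<le> y" "y \<le> 1 / 2" using p by (auto simp: y_def intro: divide_left_mono)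
    then have "y\<^sup>2 \<le> y / 2" using mult_left_mono[of y "1 / 2" y] by (simp add: power2_eq_square)
    moreover have "1 + - y / 2 \<le> exp (- y / 2)" by (rule exp_ge_add_one_self)
    ultimately have "0 \<le> 1 - (y - y\<^sup>2)" "1 - (y - y\<^sup>2) \<le> exp (- y / 2)" using y zero_le_power2[of y] by linarith+
    then show "0 \<le> 1 - (1 / real p - 1 / real p ^ 2)"
      and "1 - (1 / real p - 1 / real p ^ 2) \<le> exp (- (1 / real p) / 2)"
      by (simp_all add: y_def power_one_over)
  qed
  also have "\<dots> = exp (- (\<Sum>p\<in>W. 1 / real p) / 2)"
    using fin by (simp add: exp_sum[symmetric] sum_negf sum_divide_distrib)
  also have "\<dots> \<le> exp (- ln (2 / e))" using N by (simp add: W_def)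
  also have "\<dots> = e / 2" using assms by (simp add: exp_minus)
  finally have prod: "(\<Prod>p\<in>W. 1 - (1 / real p - 1 / real p ^ 2)) + 1 / (real p1 - 2) \<le> e" using p1 by simp
  define G where "G = (\<lambda>(p, q). \<bar>ln (1 + 1 / real p) - ln (1 + 1 / real q)\<bar>) ` {(p, q). p \<in> W \<and> q \<in> W \<and> p \<noteq> q}"
  have "finite {(p, q). p \<in> W \<and> q \<in> W \<and> p \<noteq> q}"
    by (rule finite_subset[of _ "W \<times> W"]) (use fin in auto)
  \<comment> \<open>The inserted 1 keeps \<open>Min\<close> meaningful when \<open>W\<close> has
    fewer than two elements.\<close>
  then have finG: "finite (insert 1 G)" by (simp add: G_def)
  have "\<forall>x\<in>insert 1 G. x > 0"
  proof
    fix x assume "x \<in> insert 1 G"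
    then consider "x = 1" | p q where "p \<in> W" "q \<in> W" "p \<noteq> q" "x = \<bar>ln (1 + 1 / real p) - ln (1 + 1 / real q)\<bar>"
      by (auto simp: G_def)
    then show "x > 0"
    proof cases
      case 2
      have pos: "p > 0" "q > 0" using 2 by (auto simp: W_def)
      then have "1 + 1 / real p > 0" "1 + 1 / real q > 0" by (simp_all add: add_pos_pos)
      then have "ln (1 + 1 / real p) \<noteq> ln (1 + 1 / real q)" using pos 2(3) by (simp add: ln_inj_iff)
      then show ?thesis using 2 by simp
    qed simp
  qed
  then have m: "Min (insert 1 G) > 0" using finG by simp
  show ?thesis
  proof (rule that[of W p1 "Min (insert 1 G) / 3"])
    fix p q assume "p \<in> W" "q \<in> W" "p \<noteq> q"
    then have "\<bar>ln (1 + 1 / real p) - ln (1 + 1 / real q)\<bar> \<in> insert 1 G" by (auto simp: G_def)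
    then have "Min (insert 1 G) \<le> \<bar>ln (1 + 1 / real p) - ln (1 + 1 / real q)\<bar>" using finG by simp
    then show "\<bar>ln (1 + 1 / real p) - ln (1 + 1 / real q)\<bar> > 2 * (Min (insert 1 G) / 3)" using m by linarith
  qed (use fin prod m in \<open>auto simp: W_def p1_def\<close>)
qed

text \<open>Since \<open>excess 0\<close> is the negative of \<open>excess 1\<close>, the events
  bounding \<open>B\<close> and its complement overlap only where the excess lies in [- r, r];
  \<open>anticoncentration\<close> bounds this overlap.\<close>

lemma density_gap_B:
  assumes "e > 0"
  shows "\<exists>u v. upper_density_le B u \<and> upper_density_le (- B) v \<and> u + v \<le> 1 + e"
proof -
  obtain W p1 r where W: "finite W" "\<And>p. p \<in> W \<Longrightarrow> prime p \<and> p \<ge> p1" "p1 \<ge> 3" "r > 0"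
    "(\<Prod>p\<in>W. 1 - (1 / real p - 1 / real p ^ 2)) + 1 / (real p1 - 2) \<le> e / 2"
    "\<And>p q. p \<in> W \<Longrightarrow> q \<in> W \<Longrightarrow> p \<noteq> q \<Longrightarrow> \<bar>ln (1 + 1 / real p) - ln (1 + 1 / real q)\<bar> > 2 * r"
    by (rule exists_separated_primes[OF half_gt_zero[OF assms]]) (rule that)
  \<comment> \<open>The summand 16 / (r * e) makes 2 / (M * d) at most e / 4 for d = r / 2.\<close>
  define M where "M = Max (insert 2 W) + nat \<lceil>16 / (r * e)\<rceil>"
  have M: "M \<ge> 2" "\<And>p. p \<in> W \<Longrightarrow> p \<le> M"
  proof -
    have "2 \<le> Max (insert 2 W)" "\<And>p. p \<in> W \<Longrightarrow> p \<le> Max (insert 2 W)" using W(1) by auto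
    then show "M \<ge> 2" "\<And>p. p \<in> W \<Longrightarrow> p \<le> M" unfolding M_def using trans_le_add1 by blast+
  qed
  define d where "d = r / 2"
  define u where "u c = avg (modulus M) (\<lambda>n. of_bool (excess c M n \<ge> - 2 * d))" for c
  have d: "d > 0" using W(4) by (simp add: d_def)
  have "16 / (r * e) \<le> real M" unfolding M_def by linarith
  then have Md: "2 / (real M * d) \<le> e / 4" using W(4) assms M(1) by (simp add: d_def field_simps)
  have neg: "excess 0 M n = - excess 1 M n" for n by (simp add: excess_def)
  have "u 1 + u 0 \<le> avg (modulus M) (\<lambda>n. 1 + of_bool (\<bar>excess 1 M n\<bar> \<le> r))"
    unfolding u_def avg_add[symmetric] by (rule avg_mono) (auto simp: neg d_def)
  also have "\<dots> = 1 + avg (modulus M) (\<lambda>n. of_bool (\<bar>excess 1 M n\<bar> \<le> r))" by (simp add: avg_add)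
  also have "avg (modulus M) (\<lambda>n. of_bool (\<bar>excess 1 M n\<bar> \<le> r)) \<le> e / 2"
    using anticoncentration[of W M p1 r, OF _ _ W(3) M(1) W(6)] W(2,5) M(2) by fastforce
  finally have "u 1 + u 0 \<le> 1 + e / 2" by simp
  moreover have "x + t + (y + t) \<le> 1 + e" if "x + y \<le> 1 + e / 2" "t \<le> e / 4" for x y t
    using that by linarith
  ultimately have "(u 1 + 2 / (real M * d)) + (u 0 + 2 / (real M * d)) \<le> 1 + e" using Md by blast
  then show ?thesis
    using upper_density_B[of M d] upper_density_compl_B[of M d] M(1) d unfolding u_def by fastforce
qed

section \<open>Octal arithmetic by rewriting\<close>

text \<open>The digit functions act as constructors: rewriting with the rules below evaluates terms
  built from them, so that large computations can be carried out by \<open>simp only\<close>.\<close>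

definition X0 :: "nat \<Rightarrow> nat" where "X0 n = 8 * n"
definition X1 :: "nat \<Rightarrow> nat" where "X1 n = 8 * n + 1"
definition X2 :: "nat \<Rightarrow> nat" where "X2 n = 8 * n + 2"
definition X3 :: "nat \<Rightarrow> nat" where "X3 n = 8 * n + 3"
definition X4 :: "nat \<Rightarrow> nat" where "X4 n = 8 * n + 4"
definition X5 :: "nat \<Rightarrow> nat" where "X5 n = 8 * n + 5"
definition X6 :: "nat \<Rightarrow> nat" where "X6 n = 8 * n + 6"
definition X7 :: "nat \<Rightarrow> nat" where "X7 n = 8 * n + 7"

lemmas X_defs = X0_def X1_def X2_def X3_def X4_def X5_def X6_def X7_def

definition ad :: "nat \<Rightarrow> nat \<Rightarrow> nat" where "ad a b = a + b"
definition adc :: "nat \<Rightarrow> nat \<Rightarrow> nat" where "adc a b = a + b + 1"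
definition sh :: "nat \<Rightarrow> nat" where "sh a = a div 8"
definition mul :: "nat \<Rightarrow> nat \<Rightarrow> nat" where "mul w a = w * a"
definition leq :: "nat \<Rightarrow> nat \<Rightarrow> bool" where "leq a b \<longleftrightarrow> a \<le> b"
definition shift :: "nat \<Rightarrow> nat \<Rightarrow> nat" where "shift k a = a div 8 ^ k"

lemma ad_rules:
  "ad (X0 a) (X0 b) = X0 (ad a b)" "ad (X0 a) (X1 b) = X1 (ad a b)"
  "ad (X0 a) (X2 b) = X2 (ad a b)" "ad (X0 a) (X3 b) = X3 (ad a b)"
  "ad (X0 a) (X4 b) = X4 (ad a b)" "ad (X0 a) (X5 b) = X5 (ad a b)"
  "ad (X0 a) (X6 b) = X6 (ad a b)" "ad (X0 a) (X7 b) = X7 (ad a b)"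
  "ad (X1 a) (X0 b) = X1 (ad a b)" "ad (X1 a) (X1 b) = X2 (ad a b)"
  "ad (X1 a) (X2 b) = X3 (ad a b)" "ad (X1 a) (X3 b) = X4 (ad a b)"
  "ad (X1 a) (X4 b) = X5 (ad a b)" "ad (X1 a) (X5 b) = X6 (ad a b)"
  "ad (X1 a) (X6 b) = X7 (ad a b)" "ad (X1 a) (X7 b) = X0 (adc a b)"
  "ad (X2 a) (X0 b) = X2 (ad a b)" "ad (X2 a) (X1 b) = X3 (ad a b)"
  "ad (X2 a) (X2 b) = X4 (ad a b)" "ad (X2 a) (X3 b) = X5 (ad a b)"
  "ad (X2 a) (X4 b) = X6 (ad a b)" "ad (X2 a) (X5 b) = X7 (ad a b)"
  "ad (X2 a) (X6 b) = X0 (adc a b)" "ad (X2 a) (X7 b) = X1 (adc a b)"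
  "ad (X3 a) (X0 b) = X3 (ad a b)" "ad (X3 a) (X1 b) = X4 (ad a b)"
  "ad (X3 a) (X2 b) = X5 (ad a b)" "ad (X3 a) (X3 b) = X6 (ad a b)"
  "ad (X3 a) (X4 b) = X7 (ad a b)" "ad (X3 a) (X5 b) = X0 (adc a b)"
  "ad (X3 a) (X6 b) = X1 (adc a b)" "ad (X3 a) (X7 b) = X2 (adc a b)"
  "ad (X4 a) (X0 b) = X4 (ad a b)" "ad (X4 a) (X1 b) = X5 (ad a b)"
  "ad (X4 a) (X2 b) = X6 (ad a b)" "ad (X4 a) (X3 b) = X7 (ad a b)"
  "ad (X4 a) (X4 b) = X0 (adc a b)" "ad (X4 a) (X5 b) = X1 (adc a b)"
  "ad (X4 a) (X6 b) = X2 (adc a b)" "ad (X4 a) (X7 b) = X3 (adc a b)"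
  "ad (X5 a) (X0 b) = X5 (ad a b)" "ad (X5 a) (X1 b) = X6 (ad a b)"
  "ad (X5 a) (X2 b) = X7 (ad a b)" "ad (X5 a) (X3 b) = X0 (adc a b)"
  "ad (X5 a) (X4 b) = X1 (adc a b)" "ad (X5 a) (X5 b) = X2 (adc a b)"
  "ad (X5 a) (X6 b) = X3 (adc a b)" "ad (X5 a) (X7 b) = X4 (adc a b)"
  "ad (X6 a) (X0 b) = X6 (ad a b)" "ad (X6 a) (X1 b) = X7 (ad a b)"
  "ad (X6 a) (X2 b) = X0 (adc a b)" "ad (X6 a) (X3 b) = X1 (adc a b)"
  "ad (X6 a) (X4 b) = X2 (adc a b)" "ad (X6 a) (X5 b) = X3 (adc a b)"
  "ad (X6 a) (X6 b) = X4 (adc a b)" "ad (X6 a) (X7 b) = X5 (adc a b)"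
  "ad (X7 a) (X0 b) = X7 (ad a b)" "ad (X7 a) (X1 b) = X0 (adc a b)"
  "ad (X7 a) (X2 b) = X1 (adc a b)" "ad (X7 a) (X3 b) = X2 (adc a b)"
  "ad (X7 a) (X4 b) = X3 (adc a b)" "ad (X7 a) (X5 b) = X4 (adc a b)"
  "ad (X7 a) (X6 b) = X5 (adc a b)" "ad (X7 a) (X7 b) = X6 (adc a b)"
  "adc (X0 a) (X0 b) = X1 (ad a b)" "adc (X0 a) (X1 b) = X2 (ad a b)"
  "adc (X0 a) (X2 b) = X3 (ad a b)" "adc (X0 a) (X3 b) = X4 (ad a b)"
  "adc (X0 a) (X4 b) = X5 (ad a b)" "adc (X0 a) (X5 b) = X6 (ad a b)"
  "adc (X0 a) (X6 b) = X7 (ad a b)" "adc (X0 a) (X7 b) = X0 (adc a b)"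
  "adc (X1 a) (X0 b) = X2 (ad a b)" "adc (X1 a) (X1 b) = X3 (ad a b)"
  "adc (X1 a) (X2 b) = X4 (ad a b)" "adc (X1 a) (X3 b) = X5 (ad a b)"
  "adc (X1 a) (X4 b) = X6 (ad a b)" "adc (X1 a) (X5 b) = X7 (ad a b)"
  "adc (X1 a) (X6 b) = X0 (adc a b)" "adc (X1 a) (X7 b) = X1 (adc a b)"
  "adc (X2 a) (X0 b) = X3 (ad a b)" "adc (X2 a) (X1 b) = X4 (ad a b)"
  "adc (X2 a) (X2 b) = X5 (ad a b)" "adc (X2 a) (X3 b) = X6 (ad a b)"
  "adc (X2 a) (X4 b) = X7 (ad a b)" "adc (X2 a) (X5 b) = X0 (adc a b)"
  "adc (X2 a) (X6 b) = X1 (adc a b)" "adc (X2 a) (X7 b) = X2 (adc a b)"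
  "adc (X3 a) (X0 b) = X4 (ad a b)" "adc (X3 a) (X1 b) = X5 (ad a b)"
  "adc (X3 a) (X2 b) = X6 (ad a b)" "adc (X3 a) (X3 b) = X7 (ad a b)"
  "adc (X3 a) (X4 b) = X0 (adc a b)" "adc (X3 a) (X5 b) = X1 (adc a b)"
  "adc (X3 a) (X6 b) = X2 (adc a b)" "adc (X3 a) (X7 b) = X3 (adc a b)"
  "adc (X4 a) (X0 b) = X5 (ad a b)" "adc (X4 a) (X1 b) = X6 (ad a b)"
  "adc (X4 a) (X2 b) = X7 (ad a b)" "adc (X4 a) (X3 b) = X0 (adc a b)"
  "adc (X4 a) (X4 b) = X1 (adc a b)" "adc (X4 a) (X5 b) = X2 (adc a b)"
  "adc (X4 a) (X6 b) = X3 (adc a b)" "adc (X4 a) (X7 b) = X4 (adc a b)"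
  "adc (X5 a) (X0 b) = X6 (ad a b)" "adc (X5 a) (X1 b) = X7 (ad a b)"
  "adc (X5 a) (X2 b) = X0 (adc a b)" "adc (X5 a) (X3 b) = X1 (adc a b)"
  "adc (X5 a) (X4 b) = X2 (adc a b)" "adc (X5 a) (X5 b) = X3 (adc a b)"
  "adc (X5 a) (X6 b) = X4 (adc a b)" "adc (X5 a) (X7 b) = X5 (adc a b)"
  "adc (X6 a) (X0 b) = X7 (ad a b)" "adc (X6 a) (X1 b) = X0 (adc a b)"
  "adc (X6 a) (X2 b) = X1 (adc a b)" "adc (X6 a) (X3 b) = X2 (adc a b)"
  "adc (X6 a) (X4 b) = X3 (adc a b)" "adc (X6 a) (X5 b) = X4 (adc a b)"
  "adc (X6 a) (X6 b) = X5 (adc a b)" "adc (X6 a) (X7 b) = X6 (adc a b)"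
  "adc (X7 a) (X0 b) = X0 (adc a b)" "adc (X7 a) (X1 b) = X1 (adc a b)"
  "adc (X7 a) (X2 b) = X2 (adc a b)" "adc (X7 a) (X3 b) = X3 (adc a b)"
  "adc (X7 a) (X4 b) = X4 (adc a b)" "adc (X7 a) (X5 b) = X5 (adc a b)"
  "adc (X7 a) (X6 b) = X6 (adc a b)" "adc (X7 a) (X7 b) = X7 (adc a b)"
  "ad 0 (X0 a) = X0 a" "ad (X0 a) 0 = X0 a"
  "adc 0 (X0 a) = X1 a" "adc (X0 a) 0 = X1 a"
  "ad 0 (X1 a) = X1 a" "ad (X1 a) 0 = X1 a"
  "adc 0 (X1 a) = X2 a" "adc (X1 a) 0 = X2 a"
  "ad 0 (X2 a) = X2 a" "ad (X2 a) 0 = X2 a"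
  "adc 0 (X2 a) = X3 a" "adc (X2 a) 0 = X3 a"
  "ad 0 (X3 a) = X3 a" "ad (X3 a) 0 = X3 a"
  "adc 0 (X3 a) = X4 a" "adc (X3 a) 0 = X4 a"
  "ad 0 (X4 a) = X4 a" "ad (X4 a) 0 = X4 a"
  "adc 0 (X4 a) = X5 a" "adc (X4 a) 0 = X5 a"
  "ad 0 (X5 a) = X5 a" "ad (X5 a) 0 = X5 a"
  "adc 0 (X5 a) = X6 a" "adc (X5 a) 0 = X6 a"
  "ad 0 (X6 a) = X6 a" "ad (X6 a) 0 = X6 a"
  "adc 0 (X6 a) = X7 a" "adc (X6 a) 0 = X7 a"
  "ad 0 (X7 a) = X7 a" "ad (X7 a) 0 = X7 a"
  "adc 0 (X7 a) = X0 (adc 0 a)" "adc (X7 a) 0 = X0 (adc 0 a)"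
  "ad 0 0 = 0" "adc 0 0 = X1 0"
  by (simp_all add: ad_def adc_def X_defs)

lemma sh_rules:
  "sh (X0 a) = a" "sh (X1 a) = a" "sh (X2 a) = a" "sh (X3 a) = a"
  "sh (X4 a) = a" "sh (X5 a) = a" "sh (X6 a) = a" "sh (X7 a) = a"
  "sh 0 = 0"
  by (simp_all add: sh_def X_defs)

text \<open>8 a + i <= 8 b + j reduces to a <= b if i <= j and to a + 1 <= b otherwise;
  \<open>adc 0 a\<close> is the successor.\<close>

lemma leq_rules:
  "leq (X0 a) (X0 b) = leq a b" "leq (X0 a) (X1 b) = leq a b"
  "leq (X0 a) (X2 b) = leq a b" "leq (X0 a) (X3 b) = leq a b"
  "leq (X0 a) (X4 b) = leq a b" "leq (X0 a) (X5 b) = leq a b"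
  "leq (X0 a) (X6 b) = leq a b" "leq (X0 a) (X7 b) = leq a b"
  "leq (X1 a) (X0 b) = leq (adc 0 a) b" "leq (X1 a) (X1 b) = leq a b"
  "leq (X1 a) (X2 b) = leq a b" "leq (X1 a) (X3 b) = leq a b"
  "leq (X1 a) (X4 b) = leq a b" "leq (X1 a) (X5 b) = leq a b"
  "leq (X1 a) (X6 b) = leq a b" "leq (X1 a) (X7 b) = leq a b"
  "leq (X2 a) (X0 b) = leq (adc 0 a) b" "leq (X2 a) (X1 b) = leq (adc 0 a) b"
  "leq (X2 a) (X2 b) = leq a b" "leq (X2 a) (X3 b) = leq a b"
  "leq (X2 a) (X4 b) = leq a b" "leq (X2 a) (X5 b) = leq a b"
  "leq (X2 a) (X6 b) = leq a b" "leq (X2 a) (X7 b) = leq a b"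
  "leq (X3 a) (X0 b) = leq (adc 0 a) b" "leq (X3 a) (X1 b) = leq (adc 0 a) b"
  "leq (X3 a) (X2 b) = leq (adc 0 a) b" "leq (X3 a) (X3 b) = leq a b"
  "leq (X3 a) (X4 b) = leq a b" "leq (X3 a) (X5 b) = leq a b"
  "leq (X3 a) (X6 b) = leq a b" "leq (X3 a) (X7 b) = leq a b"
  "leq (X4 a) (X0 b) = leq (adc 0 a) b" "leq (X4 a) (X1 b) = leq (adc 0 a) b"
  "leq (X4 a) (X2 b) = leq (adc 0 a) b" "leq (X4 a) (X3 b) = leq (adc 0 a) b"
  "leq (X4 a) (X4 b) = leq a b" "leq (X4 a) (X5 b) = leq a b"
  "leq (X4 a) (X6 b) = leq a b" "leq (X4 a) (X7 b) = leq a b"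
  "leq (X5 a) (X0 b) = leq (adc 0 a) b" "leq (X5 a) (X1 b) = leq (adc 0 a) b"
  "leq (X5 a) (X2 b) = leq (adc 0 a) b" "leq (X5 a) (X3 b) = leq (adc 0 a) b"
  "leq (X5 a) (X4 b) = leq (adc 0 a) b" "leq (X5 a) (X5 b) = leq a b"
  "leq (X5 a) (X6 b) = leq a b" "leq (X5 a) (X7 b) = leq a b"
  "leq (X6 a) (X0 b) = leq (adc 0 a) b" "leq (X6 a) (X1 b) = leq (adc 0 a) b"
  "leq (X6 a) (X2 b) = leq (adc 0 a) b" "leq (X6 a) (X3 b) = leq (adc 0 a) b"
  "leq (X6 a) (X4 b) = leq (adc 0 a) b" "leq (X6 a) (X5 b) = leq (adc 0 a) b"
  "leq (X6 a) (X6 b) = leq a b" "leq (X6 a) (X7 b) = leq a b"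
  "leq (X7 a) (X0 b) = leq (adc 0 a) b" "leq (X7 a) (X1 b) = leq (adc 0 a) b"
  "leq (X7 a) (X2 b) = leq (adc 0 a) b" "leq (X7 a) (X3 b) = leq (adc 0 a) b"
  "leq (X7 a) (X4 b) = leq (adc 0 a) b" "leq (X7 a) (X5 b) = leq (adc 0 a) b"
  "leq (X7 a) (X6 b) = leq (adc 0 a) b" "leq (X7 a) (X7 b) = leq a b"
  "leq 0 b = True" "leq (X0 a) 0 = leq a 0" "leq (X1 a) 0 = False"
  "leq (X2 a) 0 = False" "leq (X3 a) 0 = False" "leq (X4 a) 0 = False"
  "leq (X5 a) 0 = False" "leq (X6 a) 0 = False" "leq (X7 a) 0 = False"
  by (simp_all add: leq_def adc_def X_defs) presburger+

text \<open>Double-and-add along the binary digits of the first factor, an ordinary numeral; only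
  the second factor is octal.\<close>

lemma mul_rules:
  "mul 0 a = 0" "mul 1 a = a" "mul (numeral num.One) a = a"
  "mul (numeral (num.Bit0 w)) a = mul (numeral w) (ad a a)"
  "mul (numeral (num.Bit1 w)) a = ad a (mul (numeral w) (ad a a))"
  by (simp_all only: mul_def ad_def numeral.simps distrib_left distrib_right mult_1_left mult_0 add.commute add.left_commute)

text \<open>Dividing by 8^k drops k digits, which is why the weights of a row are taken relative to
  8^k.\<close>

lemma shift_rules:
  "shift 1 a = sh a" "shift 2 a = sh (sh a)" "shift 3 a = sh (sh (sh a))" "shift 4 a = sh (sh (sh (sh a)))"
  "shift 5 a = sh (sh (sh (sh (sh a))))" "shift 6 a = sh (sh (sh (sh (sh (sh a)))))"
  by (simp_all add: shift_def sh_def div_mult2_eq[symmetric])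

text \<open>The third argument is the continuation of the list, so that the rules halving the count
  build runs without appending.\<close>

definition rep :: "nat \<Rightarrow> 'a \<Rightarrow> 'a list \<Rightarrow> 'a list" where
  "rep n x xs = replicate n x @ xs"

lemma rep_rules:
  "rep 0 x xs = xs" "rep 1 x xs = x # xs" "rep (numeral num.One) x xs = x # xs"
  "rep (numeral (num.Bit0 n)) x xs = rep (numeral n) x (rep (numeral n) x xs)"
  "rep (numeral (num.Bit1 n)) x xs = x # rep (numeral n) x (rep (numeral n) x xs)"
  by (simp_all only: rep_def numeral.simps replicate_add append_assoc append_Cons append_Nil
      replicate_0 One_nat_def replicate_Suc add_Suc_right add_0_right)

section \<open>Tables of upper bounds\<close>

text \<open>A table is a nonempty list whose last entry bounds all later values too; this is harmless
  because only antitone functions are tabulated.\<close>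

definition tabulates :: "nat list \<Rightarrow> (int \<Rightarrow> real) \<Rightarrow> int \<Rightarrow> bool" where
  "tabulates xs G i \<longleftrightarrow> xs \<noteq> [] \<and> (\<forall>j<length xs. G (i + int j) \<le> real (xs ! j))"

text \<open>\<open>adv x ys\<close> stands for \<open>advance (x # ys)\<close>: the window moves by
  one place, but a sole remaining entry is kept, since it bounds all later values.\<close>

fun adv :: "nat \<Rightarrow> nat list \<Rightarrow> nat list" where
  "adv x [] = [x]"
| "adv x (y # ys) = y # ys"

fun advance :: "nat list \<Rightarrow> nat list" where
  "advance [] = []"
| "advance (x # xs) = adv x xs"

definition drp :: "nat \<Rightarrow> nat list \<Rightarrow> nat list" where
  "drp n xs = (advance ^^ n) xs"

lemma drp_rules:
  "drp 0 xs = xs" "drp 1 xs = advance xs" "drp (numeral num.One) xs = advance xs"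
  "drp (numeral (num.Bit0 n)) xs = drp (numeral n) (drp (numeral n) xs)"
  "drp (numeral (num.Bit1 n)) xs = advance (drp (numeral n) (drp (numeral n) xs))"
  by (simp_all only: drp_def numeral_Bit0[of n] numeral_Bit1[of n] funpow_add o_apply)
    (simp_all add: funpow_swap1 numeral_One)

lemma tabulates_Cons:
  "tabulates (x # xs) G i \<longleftrightarrow> G i \<le> real x \<and> (xs = [] \<or> tabulates xs G (i + 1))"
proof -
  have "(\<forall>j<Suc (length xs). G (i + int j) \<le> real ((x # xs) ! j))
      \<longleftrightarrow> G i \<le> real x \<and> (\<forall>j<length xs. G (i + 1 + int j) \<le> real (xs ! j))"
    by (auto simp: less_Suc_eq_0_disj algebra_simps)
  then show ?thesis by (auto simp: tabulates_def)
qed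

lemma tabulates_advance:
  assumes "tabulates xs G i" "antimono G"
  shows "tabulates (advance xs) G (i + 1)"
proof (cases xs)
  case Nil
  then show ?thesis using assms by (simp add: tabulates_def)
next
  case (Cons x ys)
  show ?thesis
  proof (cases ys)
    case Nil
    have "G (i + 1) \<le> G i" using assms(2) by (simp add: antimono_def)
    then show ?thesis using assms(1) Cons Nil by (simp add: tabulates_Cons)
  next
    case (Cons y zs)
    then show ?thesis using assms(1) \<open>xs = x # ys\<close> by (simp add: tabulates_Cons)
  qed
qed

lemma tabulates_drp:
  "tabulates xs G i \<Longrightarrow> antimono G \<Longrightarrow> tabulates (drp n xs) G (i + int n)"
proof (induction n)
  case (Suc n)
  then have "tabulates (advance (drp n xs)) G (i + int n + 1)" by (intro tabulates_advance) auto
  then show ?case by (simp add: drp_def algebra_simps)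
qed (simp add: drp_def)

lemma tabulates_rep:
  assumes "tabulates xs G i" "\<And>j. G j \<le> real s"
  shows "tabulates (rep n s xs) G (i - int n)"
proof (induction n)
  case (Suc n)
  have "rep (Suc n) s xs = s # rep n s xs" by (simp add: rep_def)
  then show ?case using Suc assms(2) by (simp add: tabulates_Cons)
qed (use assms in \<open>simp add: rep_def\<close>)

lemma tabulates_last:
  assumes "tabulates xs G i" "antimono G" "j \<ge> length xs - 1"
  shows "G (i + int j) \<le> real (last xs)"
proof -
  have "xs \<noteq> []" using assms(1) by (simp add: tabulates_def)
  then have "G (i + int (length xs - 1)) \<le> real (last xs)"
    using assms(1) by (simp add: tabulates_def last_conv_nth)
  moreover have "G (i + int j) \<le> G (i + int (length xs - 1))"
    using assms(2) by (rule antimonoD) (use assms(3) in simp)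
  ultimately show ?thesis by simp
qed

lemma real_div_bounds:
  assumes "q > (0::nat)"
  shows "real (y div q) \<le> real y / real q" and "real y / real q \<le> real (y div q) + 1"
proof -
  have "real y = real q * real (y div q) + real (y mod q)"
    by (metis mult_div_mod_eq of_nat_add of_nat_mult)
  moreover have "real (y mod q) < real q" using assms by simp
  moreover have "real (y mod q) \<ge> 0" by simp
  ultimately show "real (y div q) \<le> real y / real q" and "real y / real q \<le> real (y div q) + 1"
    using assms by (auto simp: field_simps)
qed

text \<open>One table entry after adding a prime: \<open>b\<close> is the old entry at the same
  place, \<open>a1\<close> and \<open>a2\<close> are those for the upward moves of order 1 and at
  least 2, and \<open>c\<close> is that for the downward move. The added 1 turns the floor into an
  upper bound.\<close>

definition mix :: "nat \<Rightarrow> nat \<Rightarrow> nat \<Rightarrow> nat \<Rightarrow> nat \<Rightarrow> nat \<Rightarrow> nat \<Rightarrow> nat \<Rightarrow> nat" where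
  "mix w d v k b a1 a2 c = b + (w * (a1 + c) + (v * a2 + d * c)) div 8 ^ k + 1"

lemma mix_rule:
  "mix w d v k b a1 a2 c = adc b (shift k (ad (mul w (ad a1 c)) (ad (mul v a2) (mul d c))))"
  by (simp add: mix_def adc_def ad_def mul_def shift_def)

lemma mix_ge:
  "real b + (real w * (real a1 + real c) + (real v * real a2 + real d * real c)) / 8 ^ k \<le> real (mix w d v k b a1 a2 c)"
proof -
  define y where "y = w * (a1 + c) + (v * a2 + d * c)"
  have "real y / real (8 ^ k) \<le> real (y div 8 ^ k) + 1"
    using real_div_bounds(2)[of "8 ^ k" y] by simp
  then show ?thesis by (simp add: mix_def y_def)
qed

text \<open>The entries of the mixed table stop as soon as they fall below the cut-off \<open>h\<close> once the
  fourth table is exhausted.\<close>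

fun mixz :: "nat \<Rightarrow> nat \<Rightarrow> nat \<Rightarrow> nat \<Rightarrow> nat \<Rightarrow> nat list \<Rightarrow> nat list \<Rightarrow> nat list \<Rightarrow> nat list \<Rightarrow> nat list" where
  "mixz w d v k h [] A1 Bs C = []"
| "mixz w d v k h (a2 # A2) A1 Bs C =
    (let y = mix w d v k (hd Bs) (hd A1) a2 (hd C)
     in if A2 = [] \<or> tl C = [] \<and> y \<le> h then [y]
        else y # mixz w d v k h A2 (advance A1) (advance Bs) (advance C))"

text \<open>\<open>mixc\<close> and \<open>mixd\<close> stage the conditional of
  \<open>mixz\<close>: the comparison becomes an argument that must be rewritten to
  \<open>True\<close> or \<open>False\<close> before the recursion can unfold.\<close>

definition mixc :: "nat \<Rightarrow> nat \<Rightarrow> nat \<Rightarrow> nat \<Rightarrow> nat \<Rightarrow> nat \<Rightarrow> nat list \<Rightarrow> nat list \<Rightarrow> nat list \<Rightarrow> nat list \<Rightarrow> nat list" where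
  "mixc y w d v k h A2 A1 Bs C = (if y \<le> h then [y] else y # mixz w d v k h A2 A1 Bs C)"

definition mixd :: "bool \<Rightarrow> nat \<Rightarrow> nat \<Rightarrow> nat \<Rightarrow> nat \<Rightarrow> nat \<Rightarrow> nat \<Rightarrow> nat list \<Rightarrow> nat list \<Rightarrow> nat list \<Rightarrow> nat list \<Rightarrow> nat list" where
  "mixd t y w d v k h A2 A1 Bs C = (if t then [y] else y # mixz w d v k h A2 A1 Bs C)"

lemma mixz_rules:
  "mixz w d v k h [a2] (a1 # A1) (b # Bs) (c # C) = [mix w d v k b a1 a2 c]"
  "mixz w d v k h (a2 # a2' # A2) (a1 # A1) (b # Bs) (c # c' # C) =
     mix w d v k b a1 a2 c # mixz w d v k h (a2' # A2) (adv a1 A1) (adv b Bs) (c' # C)"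
  "mixz w d v k h (a2 # a2' # A2) (a1 # A1) (b # Bs) [c] =
     mixc (mix w d v k b a1 a2 c) w d v k h (a2' # A2) (adv a1 A1) (adv b Bs) [c]"
  "mixc y w d v k h A2 A1 Bs C = mixd (leq y h) y w d v k h A2 A1 Bs C"
  "mixd True y w d v k h A2 A1 Bs C = [y]"
  "mixd False y w d v k h A2 A1 Bs C = y # mixz w d v k h A2 A1 Bs C"
  by (simp_all add: Let_def mixc_def mixd_def leq_def)

lemma tabulates_hd: "tabulates xs G i \<Longrightarrow> G i \<le> real (hd xs)"
  by (cases xs) (auto simp: tabulates_def dest: spec[of _ 0])

text \<open>The formula is monotone in all four entries, so upper bounds may be inserted. Stopping
  early is sound because \<open>tabulates\<close> constrains only the listed places.\<close>

lemma tabulates_mixz: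
  assumes "tabulates A2 G2 i" "tabulates A1 G1 i" "tabulates Bs GB i" "tabulates C GC i"
    and "antimono G1" "antimono GB" "antimono GC"
    and H: "\<And>i. H i \<le> GB i + (real w * (G1 i + GC i) + (real v * G2 i + real d * GC i)) / 8 ^ k"
  shows "tabulates (mixz w d v k h A2 A1 Bs C) H i"
  using assms(1-4)
proof (induction A2 arbitrary: A1 Bs C i)
  case Nil
  then show ?case by (simp add: tabulates_def)
next
  case (Cons a2 A2)
  define y where "y = mix w d v k (hd Bs) (hd A1) a2 (hd C)"
  have le: "GB i \<le> hd Bs" "G1 i \<le> hd A1" "G2 i \<le> a2" "GC i \<le> hd C"
    using Cons.prems tabulates_hd[of "a2 # A2"] by (auto simp: tabulates_hd)
  have "H i \<le> GB i + (real w * (G1 i + GC i) + (real v * G2 i + real d * GC i)) / 8 ^ k" by (rule H)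
  also have "\<dots> \<le> hd Bs + (real w * (hd A1 + hd C) + (real v * a2 + real d * hd C)) / 8 ^ k"
    using le by (intro add_mono divide_right_mono mult_left_mono) auto
  also have "\<dots> \<le> y" using mix_ge by (simp add: y_def)
  finally have y: "H i \<le> y" .
  show ?case
  proof (cases "A2 = [] \<or> tl C = [] \<and> y \<le> h")
    case True
    then show ?thesis using y by (simp add: y_def[symmetric] Let_def tabulates_Cons)
  next
    case False
    then have "tabulates A2 G2 (i + 1)" using Cons.prems(1) by (simp add: tabulates_Cons)
    then have "tabulates (mixz w d v k h A2 (advance A1) (advance Bs) (advance C)) H (i + 1)"
      using Cons.prems assms(5-7) by (intro Cons.IH tabulates_advance)
    then show ?thesis using y False by (simp add: y_def[symmetric] Let_def tabulates_Cons)
  qed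
qed

section \<open>Adding the odd primes one by one\<close>

text \<open>A row \<open>(p, k, w, d, v, m, n, u, e)\<close> prescribes for the prime \<open>p\<close> integer weights with
  denominator \<open>8 ^ k + 2 * w + d + v\<close> and the lattice shifts: \<open>u\<close> for \<open>ln (1 + 1 / p)\<close> (rounded up),
  \<open>u + e\<close> for \<open>ln (p / (p - 1))\<close> (rounded up) and \<open>m + n\<close> for \<open>ln (1 + 1 / p)\<close> (rounded down).
  The new table starts \<open>m\<close> places further left, the first \<open>n\<close> possible entries being trivial.\<close>

type_synonym row = "nat \<times> nat \<times> nat \<times> nat \<times> nat \<times> nat \<times> nat \<times> nat \<times> nat"

text \<open>With W = 8^k + 2 w + d + v the first three conditions read (w + v) / W >= 1 / p, v / W
  >= 1 / p^2 and (w + d) / W <= 1 / p: upward moves get too much weight, the downward move too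
  little. The others are the rational estimates of \<open>ln_one_plus_inverse_bounds\<close>,
  cleared of denominators.\<close>

definition row_ok :: "nat \<Rightarrow> row \<Rightarrow> bool" where
  "row_ok E = (\<lambda>(p, k, w, d, v, m, n, u, e).
     8 ^ k + 2 * w + d + v \<le> (w + v) * p \<and> 8 ^ k + 2 * w + d + v \<le> v * (p * p)
     \<and> (w + d) * p \<le> 8 ^ k + 2 * w + d + v
     \<and> E * (2 * p + 1) \<le> 2 * p * (p + 1) * u \<and> E * (2 * p - 1) \<le> 2 * p * (p - 1) * (u + e)
     \<and> (m + n) * (2 * p + 1) \<le> 2 * E)"

text \<open>The new scale is s * W / 8^k rounded down. Rounding down is the safe direction, because
  the table has to dominate the scale times a probability.\<close>

definition scale_step :: "nat \<Rightarrow> nat \<Rightarrow> nat \<Rightarrow> nat \<Rightarrow> nat \<Rightarrow> nat" where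
  "scale_step w d v k s = s + (w * (s + s) + (v * s + d * s)) div 8 ^ k"

lemma scale_step_rule:
  "scale_step w d v k s = ad s (shift k (ad (mul w (ad s s)) (ad (mul v s) (mul d s))))"
  by (simp add: scale_step_def ad_def mul_def shift_def)

text \<open>\<open>shift1\<close> and \<open>shift2\<close> make the extended lists arguments, so
  that each is in normal form before it is used twice.\<close>

definition shift2 :: "nat \<Rightarrow> nat \<Rightarrow> nat \<Rightarrow> nat \<Rightarrow> nat \<Rightarrow> nat \<Rightarrow> nat \<Rightarrow> nat list \<Rightarrow> nat list \<Rightarrow> nat list \<Rightarrow> nat list" where
  "shift2 e w d v k s h A1 Bs C = mixz w d v k h (rep e s A1) A1 Bs C"

definition shift1 :: "nat \<Rightarrow> nat \<Rightarrow> nat \<Rightarrow> nat \<Rightarrow> nat \<Rightarrow> nat \<Rightarrow> nat \<Rightarrow> nat \<Rightarrow> nat list \<Rightarrow> nat list \<Rightarrow> nat list" where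
  "shift1 u e w d v k s h Bs C = shift2 e w d v k s h (rep u s Bs) Bs C"

text \<open>The cut-off undergoes the same recursion as an entry of a constant table, so apart from
  rounding it stays a fixed fraction of the scale.\<close>

fun run :: "row list \<Rightarrow> nat \<Rightarrow> nat \<Rightarrow> nat list \<Rightarrow> nat \<times> nat list" where
  "run [] s h N = (s, N)"
| "run ((p, k, w, d, v, m, n, u, e) # rs) s h N =
    run rs (scale_step w d v k s) (mix w d v k h h h h)
      (shift1 u e w d v k s (mix w d v k h h h h) (rep m s N) (drp n N))"

lemmas run_rules = run.simps shift1_def shift2_def scale_step_rule mix_rule mixz_rules
  adv.simps advance.simps drp_rules rep_rules shift_rules mul_rules ad_rules sh_rules leq_rules

definition scaled_tail :: "nat \<Rightarrow> nat \<Rightarrow> nat \<Rightarrow> nat set \<Rightarrow> nat \<Rightarrow> int \<Rightarrow> real" where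
  "scaled_tail E c M P s i = real s * tail_prob c M P (of_int i / real E)"

lemma antimono_scaled_tail: "E > 0 \<Longrightarrow> antimono (scaled_tail E c M P s)"
  unfolding scaled_tail_def
  by (intro antimonoI mult_left_mono tail_prob_antimono divide_right_mono) auto

lemma scaled_tail_le: "scaled_tail E c M P s i \<le> real s"
  unfolding scaled_tail_def using tail_prob_le_1[of c M P "of_int i / real E"]
  by (simp add: mult_left_le)

text \<open>The upper bound is the trapezoidal estimate of the integral of 1 / t, proved by a
  derivative of x^2 / (2 (1 + x)^2); the third claim is the same estimate at p - 1. The lower bound
  is the first term of the atanh series.\<close>

lemma ln_one_plus_inverse_bounds:
  assumes "p > (1::nat)"
  shows "2 / (2 * real p + 1) \<le> ln (1 + 1 / real p)"
    and "ln (1 + 1 / real p) \<le> (2 * real p + 1) / (2 * real p * (real p + 1))"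
    and "ln (real p / real (p - 1)) \<le> (2 * real p - 1) / (2 * real p * (real p - 1))"
proof -
  have upper: "ln (1 + 1 / y) \<le> (2 * y + 1) / (2 * y * (y + 1))" if "y > 0" for y :: real
  proof -
    define f where "f x = x * (2 + x) / (2 * (1 + x)) - ln (1 + x)" for x :: real
    have "f 0 \<le> f (1 / y)"
    proof (rule DERIV_nonneg_imp_nondecreasing[where f = f])
      fix x :: real assume x: "0 \<le> x" "x \<le> 1 / y"
      have "(f has_real_derivative ((2 + 2 * x) * (2 * (1 + x)) - x * (2 + x) * 2) / (2 * (1 + x))\<^sup>2 - 1 / (1 + x)) (at x)"
        unfolding f_def using x
        by (auto intro!: derivative_eq_intros simp: power2_eq_square algebra_simps)
      moreover have "((2 + 2 * x) * (2 * (1 + x)) - x * (2 + x) * 2) / (2 * (1 + x))\<^sup>2 - 1 / (1 + x) = x\<^sup>2 / (2 * (1 + x)\<^sup>2)"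
        using x by (simp add: divide_simps power2_eq_square) (simp add: algebra_simps)
      ultimately show "\<exists>z. (f has_real_derivative z) (at x) \<and> 0 \<le> z" by fastforce
    qed (use that in simp)
    moreover have "1 / y * (2 + 1 / y) / (2 * (1 + 1 / y)) = (2 * y + 1) / (2 * y * (y + 1))"
      using that by (simp add: divide_simps add_pos_pos)
    ultimately show ?thesis by (simp add: f_def)
  qed
  have p: "real p > 1" using assms by simp
  show "ln (1 + 1 / real p) \<le> (2 * real p + 1) / (2 * real p * (real p + 1))" using upper[of "real p"] p by simp
  have "real p / real (p - 1) = 1 + 1 / (real p - 1)" using p by (simp add: of_nat_diff field_simps)
  then show "ln (real p / real (p - 1)) \<le> (2 * real p - 1) / (2 * real p * (real p - 1))"
    using upper[of "real p - 1"] p by (simp add: mult.commute mult.left_commute)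
  have "ln (1 + 1 / real p) \<ge> (\<Sum>k<1. 2 * ((1 + 1 / real p - 1) / (1 + 1 / real p + 1)) ^ (2 * k + 1) / real (2 * k + 1))"
    using ln_approx_bounds[of "1 + 1 / real p" 1] p by (simp only: atLeastAtMost_iff) auto
  moreover have "(1 + 1 / real p - 1) / (1 + 1 / real p + 1) = 1 / (2 * real p + 1)" using p by (simp add: field_simps)
  ultimately show "2 / (2 * real p + 1) \<le> ln (1 + 1 / real p)" by simp
qed

lemma tabulates_row:
  assumes E: "E > 0" and row: "row_ok E (p, k, w, d, v, m, n, u, e)"
    and p: "prime p" "odd p" "p \<le> M" "2 \<le> M" and P: "P \<subseteq> {q. prime q \<and> q \<le> M}" "p \<notin> P" and c: "c \<le> 1"
    and N: "tabulates N (scaled_tail E c M P s) L"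
  shows "tabulates (shift1 u e w d v k s h (rep m s N) (drp n N))
     (scaled_tail E c M (insert p P) (scale_step w d v k s)) (L - int m)"
proof -
  let ?F = "tail_prob c M P"
  let ?G = "scaled_tail E c M P s"
  have p3: "real p \<ge> 3" "p > 1" using p(1,2) prime_ge_2_nat[of p] by (cases "p = 2"; auto)+
  have anti: "antimono ?G" by (rule antimono_scaled_tail[OF E])
  have antishift: "antimono (\<lambda>i. ?G (i - z))" for z
    using anti by (auto simp: antimono_def)
  have sh: "tabulates xs G j \<Longrightarrow> i - z = j \<Longrightarrow> tabulates xs (\<lambda>i. G (i - z)) i" for xs i j z and G :: "int \<Rightarrow> real"
    unfolding tabulates_def by (auto simp: algebra_simps)
  have Bs: "tabulates (rep m s N) ?G (L - int m)" by (rule tabulates_rep[OF N scaled_tail_le])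
  have "tabulates (rep u s (rep m s N)) ?G (L - int m - int u)"
    by (rule tabulates_rep[OF Bs scaled_tail_le])
  moreover from this have "tabulates (rep e s (rep u s (rep m s N))) ?G (L - int m - int u - int e)"
    by (rule tabulates_rep[OF _ scaled_tail_le])
  moreover have "tabulates (drp n N) ?G (L + int n)" by (rule tabulates_drp[OF N anti])
  ultimately have tabs:
    "tabulates (rep u s (rep m s N)) (\<lambda>i. ?G (i - int u)) (L - int m)"
    "tabulates (rep e s (rep u s (rep m s N))) (\<lambda>i. ?G (i - int (u + e))) (L - int m)"
    "tabulates (drp n N) (\<lambda>i. ?G (i - (- int (m + n)))) (L - int m)"
    by - (rule sh, assumption, simp)+
  have row': "8 ^ k + 2 * w + d + v \<le> (w + v) * p" "8 ^ k + 2 * w + d + v \<le> v * (p * p)"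
    "(w + d) * p \<le> 8 ^ k + 2 * w + d + v"
    "E * (2 * p + 1) \<le> 2 * p * (p + 1) * u" "E * (2 * p - 1) \<le> 2 * p * (p - 1) * (u + e)"
    "(m + n) * (2 * p + 1) \<le> 2 * E"
    using row by (simp_all add: row_ok_def)
  have E0: "real E > 0" using E by simp
  have l1: "ln (1 + 1 / real p) \<le> real u / real E"
  proof -
    have "real (E * (2 * p + 1)) \<le> real (2 * p * (p + 1) * u)" using row'(4) of_nat_le_iff by blast
    moreover have "2 * real p * (real p + 1) > 0" using p3 by simp
    ultimately have "(2 * real p + 1) / (2 * real p * (real p + 1)) \<le> real u / real E"
      using E0 by (simp only: pos_divide_le_eq times_divide_eq_left pos_le_divide_eq) (simp add: algebra_simps)
    then show ?thesis using ln_one_plus_inverse_bounds(2)[OF p3(2)] by linarith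
  qed
  have l2: "ln (real p / real (p - 1)) \<le> real (u + e) / real E"
  proof -
    have "real (E * (2 * p - 1)) \<le> real (2 * p * (p - 1) * (u + e))" using row'(5) of_nat_le_iff by blast
    then have "(2 * real p - 1) / (2 * real p * (real p - 1)) \<le> real (u + e) / real E"
      using p3 E0 by (simp add: divide_simps of_nat_diff mult.commute mult.left_commute)
    then show ?thesis using ln_one_plus_inverse_bounds(3)[OF p3(2)] by linarith
  qed
  have l3: "real (m + n) / real E \<le> ln (1 + 1 / real p)"
  proof -
    have "real ((m + n) * (2 * p + 1)) \<le> real (2 * E)" using row'(6) of_nat_le_iff by blast
    moreover have "2 * real p + 1 > 0" using p3 by simp
    ultimately have "real (m + n) / real E \<le> 2 / (2 * real p + 1)"
      using E0 by (simp only: pos_divide_le_eq times_divide_eq_left pos_le_divide_eq) (simp add: algebra_simps)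
    then show ?thesis using ln_one_plus_inverse_bounds(1)[OF p3(2)] by linarith
  qed
  define W where "W = 8 ^ k + 2 * real w + real d + real v"
  have W0: "W > 0" by (simp add: W_def add_pos_nonneg)
  have weights: "W \<le> (real w + real v) * real p" "W \<le> real v * (real p * real p)" "(real w + real d) * real p \<le> W"
  proof -
    have "real (8 ^ k + 2 * w + d + v) \<le> real ((w + v) * p)"
      "real (8 ^ k + 2 * w + d + v) \<le> real (v * (p * p))" "real ((w + d) * p) \<le> real (8 ^ k + 2 * w + d + v)"
      using row'(1-3) of_nat_le_iff by blast+
    then show "W \<le> (real w + real v) * real p" "W \<le> real v * (real p * real p)" "(real w + real d) * real p \<le> W"
      by (simp_all add: W_def)
  qed
  have main: "scaled_tail E c M (insert p P) (scale_step w d v k s) i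
      \<le> ?G i + (real w * (?G (i - int u) + ?G (i - (- int (m + n))))
        + (real v * ?G (i - int (u + e)) + real d * ?G (i - (- int (m + n))))) / 8 ^ k" for i
  proof -
    define x where "x = of_int i / real E"
    \<comment> \<open>Upward, order 1 gets its own value and all higher orders share the limit ln (p
      / (p - 1)); downward, every positive order is replaced by order 1.\<close>
    define uu where "uu j = (if j = 0 then 0 else if j = 1 then real u / real E else real (u + e) / real E)" for j :: nat
    define vv where "vv j = (if j = 0 then 0 else real (m + n) / real E)" for j :: nat
    have u: "log_sigma_pow p j \<le> uu (min j 2)" for j
    proof -
      consider "j = 0" | "j = 1" | "j \<ge> 2" by linarith
      then show ?thesis
      proof cases
        case 3
        then show ?thesis using log_sigma_pow_le[OF p(1), of j] l2 by (simp add: uu_def min_def)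
      qed (use l1 log_sigma_pow_1[of p] in \<open>auto simp: uu_def\<close>)
    qed
    have v: "vv (min j 1) \<le> log_sigma_pow p j" for j
    proof (cases "j = 0")
      case False
      then show ?thesis using log_sigma_pow_mono[of 1 j p] log_sigma_pow_1[of p] l3 by (simp add: vv_def min_def)
    qed (simp add: vv_def)
    define f0 f1 f2 g where "f0 = ?F x" and "f1 = ?F (x - real u / real E)"
      and "f2 = ?F (x - real (u + e) / real E)" and "g = ?F (x + real (m + n) / real E)"
    have dp: "div_prob b M p j = 1 / real p ^ j" if "j \<le> 2" "b \<le> 1" for b j
      using div_prob_odd[OF p(1-3)] that p(4) by simp
    have "tail_prob c M (insert p P) x
        \<le> f0 + (1 / real p * (f1 - f0) + 1 / real p ^ 2 * (f2 - f1)) + 1 / real p * (g - f0)"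
      using tail_prob_insert[OF p(1,3) P c, of 2 1 uu vv x] u v p(4) dp c
      by (simp add: uu_def vv_def numeral_2_eq_2 f0_def f1_def f2_def g_def del: of_nat_add)
    \<comment> \<open>These signs decide the direction of rounding of the weights: increments
      towards smaller thresholds are nonnegative, the one towards a larger threshold is
      nonpositive.\<close>
    moreover have mono: "f0 \<le> f1" "f1 \<le> f2" "g \<le> f0"
      unfolding f0_def f1_def f2_def g_def using E0
      by (auto intro!: tail_prob_antimono divide_right_mono)
    have g0: "g \<ge> 0" unfolding g_def by (rule tail_prob_nonneg)
    have 1: "1 / real p * (f1 - f0) \<le> (real w + real v) / W * (f1 - f0)"
      using weights(1) W0 p3 mono by (intro mult_right_mono) (auto simp: divide_simps mult.commute)
    have 2: "1 / real p ^ 2 * (f2 - f1) \<le> real v / W * (f2 - f1)"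
      using weights(2) W0 p3 mono by (intro mult_right_mono) (auto simp: divide_simps power2_eq_square mult.commute)
    have 3: "1 / real p * (g - f0) \<le> (real w + real d) / W * (g - f0)"
      using weights(3) W0 p3 mono by (intro mult_right_mono_neg) (auto simp: divide_simps mult.commute)
    ultimately have "tail_prob c M (insert p P) x
        \<le> f0 + ((real w + real v) / W * (f1 - f0) + real v / W * (f2 - f1)) + (real w + real d) / W * (g - f0)"
      using 1 2 by linarith
    also have "\<dots> = (8 ^ k * f0 + (real w * (f1 + g) + (real v * f2 + real d * g))) / W"
      using W0 by (simp add: divide_simps) (simp add: W_def algebra_simps)
    finally have F: "tail_prob c M (insert p P) x \<le> (8 ^ k * f0 + (real w * (f1 + g) + (real v * f2 + real d * g))) / W" .
    have s: "real (scale_step w d v k s) \<le> real s * W / 8 ^ k"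
    proof -
      have "real ((w * (s + s) + (v * s + d * s)) div 8 ^ k) \<le> real (w * (s + s) + (v * s + d * s)) / real (8 ^ k)"
        by (intro real_div_bounds) simp
      then have "real (scale_step w d v k s) \<le> real s + real (w * (s + s) + (v * s + d * s)) / real (8 ^ k)"
        by (simp add: scale_step_def)
      also have "\<dots> = real s * W / 8 ^ k" by (simp add: W_def field_simps)
      finally show ?thesis .
    qed
    have "scaled_tail E c M (insert p P) (scale_step w d v k s) i
        = real (scale_step w d v k s) * tail_prob c M (insert p P) x" by (simp add: scaled_tail_def x_def)
    also have "\<dots> \<le> (real s * W / 8 ^ k) * ((8 ^ k * f0 + (real w * (f1 + g) + (real v * f2 + real d * g))) / W)"
      using s F by (intro mult_mono) (auto simp: tail_prob_nonneg W_def)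
    also have "\<dots> = real s * f0 + (real w * (real s * f1 + real s * g) + (real v * (real s * f2) + real d * (real s * g))) / 8 ^ k"
      using W0 by (simp add: divide_simps) (simp add: algebra_simps)
    finally have "scaled_tail E c M (insert p P) (scale_step w d v k s) i
        \<le> real s * f0 + (real w * (real s * f1 + real s * g) + (real v * (real s * f2) + real d * (real s * g))) / 8 ^ k" .
    moreover have "real s * f0 = ?G i" "real s * f1 = ?G (i - int u)" "real s * f2 = ?G (i - int (u + e))"
      by (simp_all add: scaled_tail_def x_def f0_def f1_def f2_def diff_divide_distrib)
    moreover have "real s * g = ?G (i - (- int (m + n)))"
    proof -
      have "x + real (m + n) / real E = of_int (i - (- int (m + n))) / real E"
        unfolding x_def add_divide_distrib[symmetric] by simp
      then show ?thesis by (simp only: scaled_tail_def g_def)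
    qed
    ultimately show ?thesis by (simp only:)
  qed
  show ?thesis
    unfolding shift1_def shift2_def
    by (rule tabulates_mixz[OF tabs(2,1) Bs tabs(3) antishift anti antishift main])
qed

definition prime_set :: "row list \<Rightarrow> nat set" where
  "prime_set rs = fst ` set rs"

definition total_shift :: "row list \<Rightarrow> nat" where
  "total_shift rs = (\<Sum>(p, k, w, d, v, m, n, u, e)\<leftarrow>rs. m)"

lemma tabulates_run:
  assumes "E > 0" "2 \<le> M" "c \<le> 1"
    and "\<And>r. r \<in> set rs \<Longrightarrow> row_ok E r \<and> prime (fst r) \<and> odd (fst r) \<and> fst r \<le> M"
    and "distinct (map fst rs)" "P \<inter> prime_set rs = {}" "P \<subseteq> {q. prime q \<and> q \<le> M}"
    and "tabulates N (scaled_tail E c M P s) L"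
  shows "case run rs s h N of (s', N') \<Rightarrow>
    tabulates N' (scaled_tail E c M (P \<union> prime_set rs) s') (L - int (total_shift rs))"
  using assms(4-8)
proof (induction rs arbitrary: s h N L P)
  case Nil
  then show ?case by (simp add: prime_set_def total_shift_def)
next
  case (Cons r rs)
  obtain p k w d v m n u e where r: "r = (p, k, w, d, v, m, n, u, e)" by (cases r) auto
  have ok: "row_ok E (p, k, w, d, v, m, n, u, e)" "prime p" "odd p" "p \<le> M" "p \<notin> P" "p \<notin> prime_set rs"
    using Cons.prems(1)[of r] Cons.prems(2,3) r by (auto simp: prime_set_def)
  have "tabulates (shift1 u e w d v k s (mix w d v k h h h h) (rep m s N) (drp n N))
     (scaled_tail E c M (insert p P) (scale_step w d v k s)) (L - int m)"
    using tabulates_row[OF assms(1) ok(1-4) assms(2) Cons.prems(4) ok(5) assms(3) Cons.prems(5)] by simp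
  then have "case run rs (scale_step w d v k s) (mix w d v k h h h h) (shift1 u e w d v k s (mix w d v k h h h h) (rep m s N) (drp n N)) of (s', N') \<Rightarrow>
    tabulates N' (scaled_tail E c M (insert p P \<union> prime_set rs) s') (L - int m - int (total_shift rs))"
    using Cons.prems ok by (intro Cons.IH) (auto simp: prime_set_def)
  moreover have "insert p P \<union> prime_set rs = P \<union> prime_set (r # rs)" by (auto simp: r prime_set_def)
  moreover have "L - int m - int (total_shift rs) = L - int (total_shift (r # rs))"
    by (simp add: r total_shift_def)
  ultimately show ?case by (simp add: r)
qed

section \<open>The primes 2, 3, 5, 7\<close>

text \<open>These primes are treated by summing over their finitely many local states. A state is a
  pair of an integer weight and an offset; offsets have resolution \<open>1 / (64 * E)\<close>, so that the
  lattice rounding happens only once, in the final table lookup \<open>f\<close>.\<close>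

fun lookup_sum :: "(nat \<Rightarrow> nat) \<Rightarrow> (nat \<times> nat) list list \<Rightarrow> nat \<Rightarrow> nat" where
  "lookup_sum f [] j = f (j div 64)"
| "lookup_sum f (st # sts) j = (\<Sum>(w, t)\<leftarrow>st. w * lookup_sum f sts (j + t))"

definition state_sum :: "(nat \<Rightarrow> nat) \<Rightarrow> (nat \<times> nat) list \<Rightarrow> (nat \<times> nat) list list \<Rightarrow> nat \<Rightarrow> nat" where
  "state_sum f st sts j = (\<Sum>(w, t)\<leftarrow>st. w * lookup_sum f sts (j + t))"

lemma lookup_rules:
  "lookup_sum f [] j = f (sh (sh j))"
  "lookup_sum f (st # sts) j = state_sum f st sts j"
  "state_sum f [] sts j = 0"
  "state_sum f ((w, t) # st) sts j = ad (mul w (lookup_sum f sts (ad j t))) (state_sum f st sts j)"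
  by (simp_all add: state_sum_def sh_def ad_def mul_def div_mult2_eq[symmetric])

text \<open>The index \<open>C\<close> stands for the threshold 0, so that all indices stay natural
  numbers; \<open>D\<close> is the product of the weight denominators of the states in
  \<open>sts\<close>.\<close>

definition dominates :: "nat \<Rightarrow> nat \<Rightarrow> nat \<Rightarrow> nat set \<Rightarrow> nat \<Rightarrow> (nat \<Rightarrow> nat) \<Rightarrow> (nat \<times> nat) list list \<Rightarrow> nat \<Rightarrow> nat \<Rightarrow> bool" where
  "dominates E c M P s f sts D C \<longleftrightarrow>
     (\<forall>j. real (D * s) * tail_prob c M P ((real j - real C) / (64 * real E)) \<le> real (lookup_sum f sts j))"

text \<open>Rounding the index down to a multiple of 64 lowers the threshold, which can only enlarge
  the tail.\<close>

lemma dominates_Nil: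
  assumes "E > 0" "\<And>j. scaled_tail E c M P s (int j - int Z) \<le> real (f j)"
  shows "dominates E c M P s f [] 1 (64 * Z)"
  unfolding dominates_def
proof
  fix j :: nat
  have "64 * (j div 64) \<le> j" by simp
  then have "64 * (real (j div 64) - real Z) \<le> real j - 64 * real Z"
    using of_nat_le_iff[where 'a = real] by fastforce
  then have "(real (j div 64) - real Z) / real E \<le> (real j - real (64 * Z)) / (64 * real E)"
    using assms(1) by (simp add: divide_simps)
  then have "tail_prob c M P ((real j - real (64 * Z)) / (64 * real E)) \<le> tail_prob c M P (of_int (int (j div 64) - int Z) / real E)"
    by (intro tail_prob_antimono) simp
  then have "real s * tail_prob c M P ((real j - real (64 * Z)) / (64 * real E)) \<le> scaled_tail E c M P s (int (j div 64) - int Z)"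
    unfolding scaled_tail_def by (rule mult_left_mono) simp
  also have "\<dots> \<le> real (f (j div 64))" by (rule assms(2))
  finally show "real (1 * s) * tail_prob c M P ((real j - real (64 * Z)) / (64 * real E)) \<le> real (lookup_sum f [] j)"
    by simp
qed

lemma sum_tails_swap:
  fixes w b :: "nat \<Rightarrow> real"
  shows "(\<Sum>i=1..K. (\<Sum>j=i..K. w j) * b i) = (\<Sum>j=1..K. w j * (\<Sum>i=1..j. b i))"
proof (induction K)
  case (Suc K)
  have "(\<Sum>i=1..Suc K. (\<Sum>j=i..Suc K. w j) * b i)
      = (\<Sum>i=1..K. (\<Sum>j=i..Suc K. w j) * b i) + w (Suc K) * b (Suc K)" by simp
  also have "(\<Sum>i=1..K. (\<Sum>j=i..Suc K. w j) * b i) = (\<Sum>i=1..K. (\<Sum>j=i..K. w j) * b i + w (Suc K) * b i)"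
    by (intro sum.cong) (auto simp: algebra_simps)
  also have "\<dots> = (\<Sum>j=1..K. w j * (\<Sum>i=1..j. b i)) + w (Suc K) * (\<Sum>i=1..K. b i)"
    unfolding sum.distrib Suc.IH by (simp add: sum_distrib_left)
  finally show ?case by (simp add: algebra_simps)
qed simp

lemma sum_diff_telescope: "(\<Sum>i=1..j::nat. a i - a (i - 1)) = a j - (a 0 :: real)"
  by (induction j) auto

text \<open>If \<open>al i\<close> is the probability of order at least i, then w j / D is that of
  order exactly j, the last index collecting all higher orders. This turns the divisibility form of
  \<open>tail_prob_insert\<close> into a sum over states.\<close>

lemma abel_weights:
  fixes a al w :: "nat \<Rightarrow> real"
  assumes "\<And>i. 1 \<le> i \<Longrightarrow> i \<le> K \<Longrightarrow> D * al i = (\<Sum>j=i..K. w j)"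
  shows "D * (\<Sum>i=1..K. al i * (a i - a (i - 1))) = (\<Sum>j=1..K. w j * a j) - (\<Sum>j=1..K. w j) * a 0"
proof -
  have "D * (\<Sum>i=1..K. al i * (a i - a (i - 1))) = (\<Sum>i=1..K. (\<Sum>j=i..K. w j) * (a i - a (i - 1)))"
    unfolding sum_distrib_left using assms by (intro sum.cong) (auto simp: mult.assoc[symmetric])
  also have "\<dots> = (\<Sum>j=1..K. w j * (\<Sum>i=1..j. a i - a (i - 1)))" by (rule sum_tails_swap)
  also have "\<dots> = (\<Sum>j=1..K. w j * (a j - a 0))" by (simp only: sum_diff_telescope)
  finally show ?thesis by (simp add: right_diff_distrib sum_subtractf sum_distrib_right)
qed

text \<open>The common offset \<open>k\<close> is at least every entry of \<open>us\<close>, so the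
  subtraction is not truncated; it is undone by lowering the index of the threshold 0 by
  \<open>k\<close>.\<close>

definition states :: "nat \<Rightarrow> nat \<Rightarrow> nat list \<Rightarrow> nat list \<Rightarrow> nat list \<Rightarrow> nat list \<Rightarrow> (nat \<times> nat) list" where
  "states w0 k ws us xs vs = (w0, k) # zip ws (map (\<lambda>u. k - u) us) @ zip xs (map (\<lambda>v. k + v) vs)"

lemma sum_list_zip_map:
  assumes "length ws = length us"
  shows "real (\<Sum>(w, t)\<leftarrow>zip ws (map g us). w * h t) = (\<Sum>i=1..length us. real (ws ! (i - 1)) * real (h (g (us ! (i - 1)))))"
proof -
  have "(\<Sum>(w, t)\<leftarrow>zip ws (map g us). w * h t) = (\<Sum>i<length us. ws ! i * h (g (us ! i)))"
    using assms by (simp add: sum_list_sum_nth lessThan_atLeast0)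
  also have "real \<dots> = (\<Sum>i<length us. real (ws ! i) * real (h (g (us ! i))))" by simp
  also have "\<dots> = (\<Sum>i=1..length us. real (ws ! (i - 1)) * real (h (g (us ! (i - 1)))))"
    by (rule sum.reindex_bij_witness[of _ "\<lambda>i. i - 1" Suc]) auto
  finally show ?thesis .
qed

text \<open>The upper state values \<open>us\<close> are for the valuations \<open>1, 2, \<dots>\<close> of \<open>2 * n + c\<close>, the last one
  standing for all larger valuations; the lower ones \<open>vs\<close> are for those of \<open>2 * n + (1 - c)\<close>.\<close>

lemma dominates_Cons:
  assumes E: "E > 0" and p: "prime p" "p \<le> M" and P: "P \<subseteq> {q. prime q \<and> q \<le> M}" "p \<notin> P" and c: "c \<le> 1"
    and len: "length us \<le> M" "length vs \<le> M" "length ws = length us" "length xs = length vs"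
    and us: "\<And>i. Suc i < length us \<Longrightarrow> log_sigma_pow p (Suc i) \<le> real (us ! i) / (64 * real E)"
      "us \<noteq> [] \<Longrightarrow> ln (real p / real (p - 1)) \<le> real (last us) / (64 * real E)"
      "\<And>u. u \<in> set us \<Longrightarrow> u \<le> k"
      "us = [] \<Longrightarrow> \<forall>n. capped_val p M (2 * n + c) = 0"
    and vs: "\<And>i. i < length vs \<Longrightarrow> real (vs ! i) / (64 * real E) \<le> log_sigma_pow p (Suc i)"
    and ws: "\<And>i. i < length us \<Longrightarrow> real D' * div_prob c M p (Suc i) = (\<Sum>j=i..<length us. real (ws ! j))"
    and xs: "\<And>i. i < length vs \<Longrightarrow> real D' * div_prob (1 - c) M p (Suc i) = (\<Sum>j=i..<length vs. real (xs ! j))"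
    and total: "w0 + sum_list ws + sum_list xs = D'" and C: "k \<le> C"
    and dom: "dominates E c M P s f sts D C"
  shows "dominates E c M (insert p P) s f (states w0 k ws us xs vs # sts) (D' * D) (C - k)"
  unfolding dominates_def
proof
  fix j
  define R where "R = 64 * real E"
  define x where "x = (real j - real (C - k)) / R"
  define u where "u i = (if i = 0 then 0 else real (us ! (i - 1)) / R)" for i
  define v where "v i = (if i = 0 then 0 else real (vs ! (i - 1)) / R)" for i
  define F where "F = tail_prob c M P"
  define K1 K2 where "K1 = length us" and "K2 = length vs"
  define S where "S t = real (lookup_sum f sts (j + t))" for t
  have R: "R > 0" using E by (simp add: R_def)
  have u': "log_sigma_pow p (capped_val p M (2 * n + c)) \<le> u (min (capped_val p M (2 * n + c)) K1)" for n
  proof -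
    define a where "a = capped_val p M (2 * n + c)"
    consider "a = 0" | "0 < a" "a < K1" | "0 < a" "K1 \<le> a" by linarith
    then have "log_sigma_pow p a \<le> u (min a K1)"
    proof cases
      case 2
      then show ?thesis using us(1)[of "a - 1"] by (simp add: u_def R_def K1_def)
    next
      case 3
      then have ne: "us \<noteq> []" using us(4) by (auto simp: a_def)
      then have "u (min a K1) = real (last us) / R" using 3 by (simp add: u_def K1_def last_conv_nth)
      then show ?thesis using us(2)[OF ne] log_sigma_pow_le[OF p(1), of a] by (simp add: R_def)
    qed (simp add: u_def)
    then show ?thesis by (simp add: a_def)
  qed
  have v': "v (min i K2) \<le> log_sigma_pow p i" for i
  proof (cases "min i K2 = 0")
    case True
    then show ?thesis by (simp add: v_def log_sigma_pow_nonneg)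
  next
    case False
    define q where "q = min i K2"
    have "q > 0" "q \<le> length vs" using False by (simp_all add: q_def K2_def)
    then have "v q \<le> log_sigma_pow p q"
      using vs[of "q - 1"] by (simp add: v_def R_def)
    then have "v (min i K2) \<le> log_sigma_pow p (min i K2)" by (simp add: q_def)
    also have "\<dots> \<le> log_sigma_pow p i" by (intro log_sigma_pow_mono) simp
    finally show ?thesis .
  qed
  have sum_shift: "(\<Sum>j=i-1..<K. g j) = (\<Sum>j=i..K. g (j - 1))" if "1 \<le> i" for i K and g :: "nat \<Rightarrow> real"
    by (rule sum.reindex_bij_witness[of _ "\<lambda>j. j - 1" Suc]) (use that in auto)
  have w1: "real D' * (\<Sum>i=1..K1. div_prob c M p i * (F (x - u i) - F (x - u (i - 1))))
      = (\<Sum>i=1..K1. real (ws ! (i - 1)) * F (x - u i)) - (\<Sum>i=1..K1. real (ws ! (i - 1))) * F (x - u 0)"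
  proof (rule abel_weights[where a = "\<lambda>i. F (x - u i)"])
    fix i assume "1 \<le> i" "i \<le> K1"
    then show "real D' * div_prob c M p i = (\<Sum>j=i..K1. real (ws ! (j - 1)))"
      using ws[of "i - 1"] sum_shift[of i "\<lambda>j. real (ws ! j)" K1] by (simp add: K1_def)
  qed
  have w2: "real D' * (\<Sum>i=1..K2. div_prob (1 - c) M p i * (F (x + v i) - F (x + v (i - 1))))
      = (\<Sum>i=1..K2. real (xs ! (i - 1)) * F (x + v i)) - (\<Sum>i=1..K2. real (xs ! (i - 1))) * F (x + v 0)"
  proof (rule abel_weights[where a = "\<lambda>i. F (x + v i)"])
    fix i assume "1 \<le> i" "i \<le> K2"
    then show "real D' * div_prob (1 - c) M p i = (\<Sum>j=i..K2. real (xs ! (j - 1)))"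
      using xs[of "i - 1"] sum_shift[of i "\<lambda>j. real (xs ! j)" K2] by (simp add: K2_def)
  qed
  have sums: "(\<Sum>i=1..K1. real (ws ! (i - 1))) = real (sum_list ws)" "(\<Sum>i=1..K2. real (xs ! (i - 1))) = real (sum_list xs)"
    using sum_shift[of 1 "\<lambda>j. real (ws ! j)" K1] sum_shift[of 1 "\<lambda>j. real (xs ! j)" K2] len
    by (simp_all add: sum_list_sum_nth K1_def K2_def)
  have "tail_prob c M (insert p P) x \<le> F x
    + (\<Sum>i=1..K1. div_prob c M p i * (F (x - u i) - F (x - u (i - 1))))
    + (\<Sum>i=1..K2. div_prob (1 - c) M p i * (F (x + v i) - F (x + v (i - 1))))"
    unfolding F_def using len
    by (intro tail_prob_insert[OF p P c] u' v') (auto simp: K1_def K2_def u_def v_def)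
  then have "real D' * tail_prob c M (insert p P) x \<le> real D' * (F x
    + (\<Sum>i=1..K1. div_prob c M p i * (F (x - u i) - F (x - u (i - 1))))
    + (\<Sum>i=1..K2. div_prob (1 - c) M p i * (F (x + v i) - F (x + v (i - 1)))))"
    by (rule mult_left_mono) simp
  also have "\<dots> = (real D' - real (sum_list ws) - real (sum_list xs)) * F x
      + (\<Sum>i=1..K1. real (ws ! (i - 1)) * F (x - u i)) + (\<Sum>i=1..K2. real (xs ! (i - 1)) * F (x + v i))"
    unfolding distrib_left w1 w2 sums by (simp add: u_def v_def algebra_simps)
  also have "real D' - real (sum_list ws) - real (sum_list xs) = real w0"
    unfolding total[symmetric] of_nat_add by simp
  finally have step: "real D' * tail_prob c M (insert p P) x \<le> real w0 * F x
      + (\<Sum>i=1..K1. real (ws ! (i - 1)) * F (x - u i)) + (\<Sum>i=1..K2. real (xs ! (i - 1)) * F (x + v i))" .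
  have domS: "real (D * s) * F ((real (j + t) - real C) / R) \<le> S t" for t
    using dom unfolding dominates_def F_def S_def R_def by blast
  have S0: "real (D * s) * F x \<le> S k" using domS[of k] C by (simp add: x_def of_nat_diff algebra_simps)
  have S1: "real (D * s) * F (x - u i) \<le> S (k - us ! (i - 1))" if "i \<in> {1..K1}" for i
  proof -
    have "us ! (i - 1) \<in> set us" by (rule nth_mem) (use that in \<open>auto simp: K1_def\<close>)
    then have "us ! (i - 1) \<le> k" by (rule us(3))
    then have "x - u i = (real (j + (k - us ! (i - 1))) - real C) / R"
      using that C by (simp add: x_def u_def of_nat_diff diff_divide_distrib[symmetric])
    then show ?thesis using domS by (simp only:)
  qed
  have S2: "real (D * s) * F (x + v i) \<le> S (k + vs ! (i - 1))" if "i \<in> {1..K2}" for i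
  proof -
    have "x + v i = (real (j + (k + vs ! (i - 1))) - real C) / R"
      using that C by (simp add: x_def v_def of_nat_diff add_divide_distrib[symmetric])
    then show ?thesis using domS by (simp only:)
  qed
  have "real (D' * D * s) * tail_prob c M (insert p P) x = real (D * s) * (real D' * tail_prob c M (insert p P) x)"
    by simp
  also have "\<dots> \<le> real (D * s) * (real w0 * F x
      + (\<Sum>i=1..K1. real (ws ! (i - 1)) * F (x - u i)) + (\<Sum>i=1..K2. real (xs ! (i - 1)) * F (x + v i)))"
    using step by (rule mult_left_mono) simp
  also have "\<dots> = real w0 * (real (D * s) * F x)
      + (\<Sum>i=1..K1. real (ws ! (i - 1)) * (real (D * s) * F (x - u i))) + (\<Sum>i=1..K2. real (xs ! (i - 1)) * (real (D * s) * F (x + v i)))"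
    unfolding distrib_left sum_distrib_left by (simp only: mult.left_commute)
  also have "\<dots> \<le> real w0 * S k
      + (\<Sum>i=1..K1. real (ws ! (i - 1)) * S (k - us ! (i - 1))) + (\<Sum>i=1..K2. real (xs ! (i - 1)) * S (k + vs ! (i - 1)))"
    using S0 S1 S2 by (intro add_mono sum_mono mult_left_mono) auto
  also have "\<dots> = real (lookup_sum f (states w0 k ws us xs vs # sts) j)"
    unfolding S_def K1_def K2_def
    using sum_list_zip_map[OF len(3), where g = "\<lambda>u. k - u" and h = "\<lambda>t. lookup_sum f sts (j + t)"]
      sum_list_zip_map[OF len(4), where g = "\<lambda>v. k + v" and h = "\<lambda>t. lookup_sum f sts (j + t)"]
    by (simp add: states_def)
  finally show "real (D' * D * s) * tail_prob c M (insert p P) ((real j - real (C - k)) / (64 * real E))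
      \<le> real (lookup_sum f (states w0 k ws us xs vs # sts) j)"
    by (simp add: x_def R_def)
qed

section \<open>The primes from 11 to 6000\<close>

text \<open>Primes decrease, in the order in which \<open>run\<close> adds them. Throughout, k = 6
  and v = d + 1, so w + d and w + v are neighbouring integers around W / p.\<close>

definition rows1 :: "row list" where "rows1 = [
   (5987,6,43,0,1,0,0,1,0),(5981,6,43,0,1,0,0,1,0),(5953,6,44,0,1,0,0,1,0),(5939,6,44,0,1,0,0,1,0),
   (5927,6,44,0,1,0,0,1,0),(5923,6,44,0,1,0,0,1,0),(5903,6,44,0,1,0,0,1,0),(5897,6,44,0,1,0,0,1,0),
   (5881,6,44,0,1,0,0,1,0),(5879,6,44,0,1,0,0,1,0),(5869,6,44,0,1,0,0,1,0),(5867,6,44,0,1,0,0,1,0),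
   (5861,6,44,0,1,0,0,1,0),(5857,6,44,0,1,0,0,1,0),(5851,6,44,0,1,0,0,1,0),(5849,6,44,0,1,0,0,1,0),
   (5843,6,44,0,1,0,0,1,0),(5839,6,44,0,1,0,0,1,0),(5827,6,45,0,1,0,0,1,0),(5821,6,45,0,1,0,0,1,0),
   (5813,6,45,0,1,0,0,1,0),(5807,6,45,0,1,0,0,1,0),(5801,6,45,0,1,0,0,1,0),(5791,6,45,0,1,1,0,2,0),
   (5783,6,45,0,1,0,1,2,0),(5779,6,45,0,1,0,1,2,0),(5749,6,45,0,1,0,1,2,0),(5743,6,45,0,1,0,1,2,0),
   (5741,6,45,0,1,0,1,2,0),(5737,6,45,0,1,0,1,2,0),(5717,6,45,0,1,0,1,2,0),(5711,6,45,0,1,0,1,2,0),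
   (5701,6,45,0,1,0,1,2,0),(5693,6,46,0,1,0,1,2,0),(5689,6,46,0,1,0,1,2,0),(5683,6,46,0,1,0,1,2,0),
   (5669,6,46,0,1,0,1,2,0),(5659,6,46,0,1,0,1,2,0),(5657,6,46,0,1,0,1,2,0),(5653,6,46,0,1,0,1,2,0)]"
definition rows2 :: "row list" where "rows2 = [
   (5651,6,46,0,1,0,1,2,0),(5647,6,46,0,1,0,1,2,0),(5641,6,46,0,1,0,1,2,0),(5639,6,46,0,1,0,1,2,0),
   (5623,6,46,0,1,0,1,2,0),(5591,6,46,0,1,0,1,2,0),(5581,6,46,0,1,0,1,2,0),(5573,6,47,0,1,0,1,2,0),
   (5569,6,47,0,1,0,1,2,0),(5563,6,47,0,1,0,1,2,0),(5557,6,47,0,1,0,1,2,0),(5531,6,47,0,1,0,1,2,0),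
   (5527,6,47,0,1,0,1,2,0),(5521,6,47,0,1,0,1,2,0),(5519,6,47,0,1,0,1,2,0),(5507,6,47,0,1,0,1,2,0),
   (5503,6,47,0,1,0,1,2,0),(5501,6,47,0,1,0,1,2,0),(5483,6,47,0,1,0,1,2,0),(5479,6,47,0,1,0,1,2,0),
   (5477,6,47,0,1,0,1,2,0),(5471,6,47,0,1,0,1,2,0),(5449,6,48,0,1,0,1,2,0),(5443,6,48,0,1,0,1,2,0),
   (5441,6,48,0,1,0,1,2,0),(5437,6,48,0,1,0,1,2,0),(5431,6,48,0,1,0,1,2,0),(5419,6,48,0,1,0,1,2,0),
   (5417,6,48,0,1,0,1,2,0),(5413,6,48,0,1,0,1,2,0),(5407,6,48,0,1,0,1,2,0),(5399,6,48,0,1,0,1,2,0),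
   (5393,6,48,0,1,0,1,2,0),(5387,6,48,0,1,0,1,2,0),(5381,6,48,0,1,0,1,2,0),(5351,6,49,0,1,0,1,2,0),
   (5347,6,49,0,1,0,1,2,0),(5333,6,49,0,1,0,1,2,0),(5323,6,49,0,1,0,1,2,0),(5309,6,49,0,1,0,1,2,0)]"
definition rows3 :: "row list" where "rows3 = [
   (5303,6,49,0,1,0,1,2,0),(5297,6,49,0,1,0,1,2,0),(5281,6,49,0,1,0,1,2,0),(5279,6,49,0,1,0,1,2,0),
   (5273,6,49,0,1,0,1,2,0),(5261,6,49,0,1,0,1,2,0),(5237,6,50,0,1,0,1,2,0),(5233,6,50,0,1,0,1,2,0),
   (5231,6,50,0,1,0,1,2,0),(5227,6,50,0,1,0,1,2,0),(5209,6,50,0,1,0,1,2,0),(5197,6,50,0,1,0,1,2,0),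
   (5189,6,50,0,1,0,1,2,0),(5179,6,50,0,1,0,1,2,0),(5171,6,50,0,1,0,1,2,0),(5167,6,50,0,1,0,1,2,0),
   (5153,6,50,0,1,0,1,2,0),(5147,6,50,0,1,0,1,2,0),(5119,6,51,0,1,0,1,2,0),(5113,6,51,0,1,0,1,2,0),
   (5107,6,51,0,1,0,1,2,0),(5101,6,51,0,1,0,1,2,0),(5099,6,51,0,1,0,1,2,0),(5087,6,51,0,1,0,1,2,0),
   (5081,6,51,0,1,0,1,2,0),(5077,6,51,0,1,0,1,2,0),(5059,6,51,0,1,0,1,2,0),(5051,6,51,0,1,0,1,2,0),
   (5039,6,52,0,1,0,1,2,0),(5023,6,52,0,1,0,1,2,0),(5021,6,52,0,1,0,1,2,0),(5011,6,52,0,1,0,1,2,0),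
   (5009,6,52,0,1,0,1,2,0),(5003,6,52,0,1,0,1,2,0),(4999,6,52,0,1,0,1,2,0),(4993,6,52,0,1,0,1,2,0),
   (4987,6,52,0,1,0,1,2,0),(4973,6,52,0,1,0,1,2,0),(4969,6,52,0,1,0,1,2,0),(4967,6,52,0,1,0,1,2,0)]"
definition rows4 :: "row list" where "rows4 = [
   (4957,6,52,0,1,0,1,2,0),(4951,6,52,0,1,0,1,2,0),(4943,6,53,0,1,0,1,2,0),(4937,6,53,0,1,0,1,2,0),
   (4933,6,53,0,1,0,1,2,0),(4931,6,53,0,1,0,1,2,0),(4919,6,53,0,1,0,1,2,0),(4909,6,53,0,1,0,1,2,0),
   (4903,6,53,0,1,0,1,2,0),(4889,6,53,0,1,0,1,2,0),(4877,6,53,0,1,0,1,2,0),(4871,6,53,0,1,0,1,2,0),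
   (4861,6,53,0,1,0,1,2,0),(4831,6,54,0,1,0,1,2,0),(4817,6,54,0,1,0,1,2,0),(4813,6,54,0,1,0,1,2,0),
   (4801,6,54,0,1,0,1,2,0),(4799,6,54,0,1,0,1,2,0),(4793,6,54,0,1,0,1,2,0),(4789,6,54,0,1,0,1,2,0),
   (4787,6,54,0,1,0,1,2,0),(4783,6,54,0,1,0,1,2,0),(4759,6,55,0,1,0,1,2,0),(4751,6,55,0,1,0,1,2,0),
   (4733,6,55,0,1,0,1,2,0),(4729,6,55,0,1,0,1,2,0),(4723,6,55,0,1,0,1,2,0),(4721,6,55,0,1,0,1,2,0),
   (4703,6,55,0,1,0,1,2,0),(4691,6,55,0,1,0,1,2,0),(4679,6,56,0,1,0,1,2,0),(4673,6,56,0,1,0,1,2,0),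
   (4663,6,56,0,1,0,1,2,0),(4657,6,56,0,1,0,1,2,0),(4651,6,56,0,1,0,1,2,0),(4649,6,56,0,1,0,1,2,0),
   (4643,6,56,0,1,0,1,2,0),(4639,6,56,0,1,0,1,2,0),(4637,6,56,0,1,0,1,2,0),(4621,6,56,0,1,0,1,2,0)]"
definition rows5 :: "row list" where "rows5 = [
   (4603,6,56,0,1,0,1,2,0),(4597,6,57,0,1,0,1,2,0),(4591,6,57,0,1,0,1,2,0),(4583,6,57,0,1,0,1,2,0),
   (4567,6,57,0,1,0,1,2,0),(4561,6,57,0,1,0,1,2,0),(4549,6,57,0,1,0,1,2,0),(4547,6,57,0,1,0,1,2,0),
   (4523,6,57,0,1,0,1,2,0),(4519,6,58,0,1,0,1,2,0),(4517,6,58,0,1,0,1,2,0),(4513,6,58,0,1,0,1,2,0),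
   (4507,6,58,0,1,0,1,2,0),(4493,6,58,0,1,0,1,2,0),(4483,6,58,0,1,0,1,2,0),(4481,6,58,0,1,0,1,2,0),
   (4463,6,58,0,1,0,1,2,0),(4457,6,58,0,1,0,1,2,0),(4451,6,58,0,1,0,1,2,0),(4447,6,58,0,1,0,1,2,0),
   (4441,6,59,0,1,0,1,2,0),(4423,6,59,0,1,0,1,2,0),(4421,6,59,0,1,0,1,2,0),(4409,6,59,0,1,0,1,2,0),
   (4397,6,59,0,1,0,1,2,0),(4391,6,59,0,1,0,1,2,0),(4373,6,59,0,1,0,1,2,0),(4363,6,60,0,1,0,1,2,0),
   (4357,6,60,0,1,0,1,2,0),(4349,6,60,0,1,0,1,2,0),(4339,6,60,0,1,0,1,2,0),(4337,6,60,0,1,0,1,2,0),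
   (4327,6,60,0,1,0,1,2,0),(4297,6,61,0,1,0,1,2,0),(4289,6,61,0,1,0,1,2,0),(4283,6,61,0,1,0,1,2,0),
   (4273,6,61,0,1,0,1,2,0),(4271,6,61,0,1,0,1,2,0),(4261,6,61,0,1,0,1,2,0),(4259,6,61,0,1,0,1,2,0)]"
definition rows6 :: "row list" where "rows6 = [
   (4253,6,61,0,1,0,1,2,0),(4243,6,61,0,1,0,1,2,0),(4241,6,61,0,1,0,1,2,0),(4231,6,61,0,1,0,1,2,0),
   (4229,6,62,0,1,0,1,2,0),(4219,6,62,0,1,0,1,2,0),(4217,6,62,0,1,0,1,2,0),(4211,6,62,0,1,0,1,2,0),
   (4201,6,62,0,1,1,0,2,0),(4177,6,62,0,1,0,1,2,0),(4159,6,63,0,1,0,1,2,0),(4157,6,63,0,1,0,1,2,0),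
   (4153,6,63,0,1,0,1,2,0),(4139,6,63,0,1,0,1,2,0),(4133,6,63,0,1,0,1,2,0),(4129,6,63,0,1,0,1,2,0),
   (4127,6,63,0,1,0,1,2,0),(4111,6,63,0,1,0,1,2,0),(4099,6,63,0,1,0,1,2,0),(4093,6,64,0,1,0,1,2,0),
   (4091,6,64,0,1,0,1,2,0),(4079,6,64,0,1,0,1,2,0),(4073,6,64,0,1,0,1,2,0),(4057,6,64,0,1,0,1,2,0),
   (4051,6,64,0,1,0,1,2,0),(4049,6,64,0,1,0,1,2,0),(4027,6,65,0,1,0,1,2,0),(4021,6,65,0,1,0,1,2,0),
   (4019,6,65,0,1,0,1,2,0),(4013,6,65,0,1,0,1,2,0),(4007,6,65,0,1,0,1,2,0),(4003,6,65,0,1,0,1,2,0),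
   (4001,6,65,0,1,0,1,2,0),(3989,6,65,0,1,0,1,2,0),(3967,6,66,0,1,0,1,2,0),(3947,6,66,0,1,0,1,2,0),
   (3943,6,66,0,1,0,1,2,0),(3931,6,66,0,1,0,1,2,0),(3929,6,66,0,1,0,1,2,0),(3923,6,66,0,1,0,1,2,0)]"
definition rows7 :: "row list" where "rows7 = [
   (3919,6,66,0,1,0,1,2,0),(3917,6,66,0,1,0,1,2,0),(3911,6,67,0,1,0,1,2,0),(3907,6,67,0,1,0,1,2,0),
   (3889,6,67,0,1,0,1,2,0),(3881,6,67,0,1,0,1,2,0),(3877,6,67,0,1,0,1,2,0),(3863,6,67,0,1,0,1,2,0),
   (3853,6,68,0,1,0,1,2,0),(3851,6,68,0,1,0,1,2,0),(3847,6,68,0,1,0,1,2,0),(3833,6,68,0,1,0,1,2,0),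
   (3823,6,68,0,1,0,1,2,0),(3821,6,68,0,1,0,1,2,0),(3803,6,68,0,1,0,1,2,0),(3797,6,69,0,1,0,1,2,0),
   (3793,6,69,0,1,0,1,2,0),(3779,6,69,0,1,0,1,2,0),(3769,6,69,0,1,0,1,2,0),(3767,6,69,0,1,0,1,2,0),
   (3761,6,69,0,1,0,1,2,0),(3739,6,70,0,1,0,1,2,0),(3733,6,70,0,1,0,1,2,0),(3727,6,70,0,1,0,1,2,0),
   (3719,6,70,0,1,0,1,2,0),(3709,6,70,0,1,0,1,2,0),(3701,6,70,0,1,0,1,2,0),(3697,6,70,0,1,0,1,2,0),
   (3691,6,71,0,1,0,1,2,0),(3677,6,71,0,1,0,1,2,0),(3673,6,71,0,1,0,1,2,0),(3671,6,71,0,1,0,1,2,0),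
   (3659,6,71,0,1,0,1,2,0),(3643,6,71,0,1,0,1,2,0),(3637,6,72,0,1,0,1,2,0),(3631,6,72,0,1,0,1,2,0),
   (3623,6,72,0,1,0,1,2,0),(3617,6,72,0,1,0,1,2,0),(3613,6,72,0,1,0,1,2,0),(3607,6,72,0,1,0,1,2,0)]"
definition rows8 :: "row list" where "rows8 = [
   (3593,6,73,0,1,0,1,2,0),(3583,6,73,0,1,0,1,2,0),(3581,6,73,0,1,0,1,2,0),(3571,6,73,0,1,0,1,2,0),
   (3559,6,73,0,1,0,1,2,0),(3557,6,73,0,1,0,1,2,0),(3547,6,73,0,1,0,1,2,0),(3541,6,74,0,1,0,1,2,0),
   (3539,6,74,0,1,0,1,2,0),(3533,6,74,0,1,0,1,2,0),(3529,6,74,0,1,0,1,2,0),(3527,6,74,0,1,0,1,2,0),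
   (3517,6,74,0,1,0,1,2,0),(3511,6,74,0,1,0,1,2,0),(3499,6,74,0,1,0,1,2,0),(3491,6,75,0,1,0,1,2,0),
   (3469,6,75,0,1,0,1,2,0),(3467,6,75,0,1,0,1,2,0),(3463,6,75,0,1,0,1,2,0),(3461,6,75,0,1,0,1,2,0),
   (3457,6,75,0,1,0,1,2,0),(3449,6,76,0,1,0,1,2,0),(3433,6,76,0,1,0,1,2,0),(3413,6,76,0,1,0,1,2,0),
   (3407,6,76,0,1,0,1,2,0),(3391,6,77,0,1,0,1,2,0),(3389,6,77,0,1,0,1,2,0),(3373,6,77,0,1,0,1,2,0),
   (3371,6,77,0,1,0,1,2,0),(3361,6,78,0,1,0,1,2,0),(3359,6,78,0,1,0,1,2,0),(3347,6,78,0,1,0,1,2,0),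
   (3343,6,78,0,1,0,1,2,0),(3331,6,78,0,1,0,1,2,0),(3329,6,78,0,1,0,1,2,0),(3323,6,78,0,1,0,1,2,0),
   (3319,6,79,0,1,0,1,2,0),(3313,6,79,0,1,0,1,2,0),(3307,6,79,0,1,0,1,2,0),(3301,6,79,0,1,0,1,2,0)]"
definition rows9 :: "row list" where "rows9 = [
   (3299,6,79,0,1,0,1,2,0),(3271,6,80,0,1,0,1,2,0),(3259,6,80,0,1,0,1,2,0),(3257,6,80,0,1,0,1,2,0),
   (3253,6,80,0,1,0,1,2,0),(3251,6,80,0,1,0,1,2,0),(3229,6,81,0,1,0,1,2,0),(3221,6,81,0,1,0,1,2,0),
   (3217,6,81,0,1,0,1,2,0),(3209,6,81,0,1,0,1,2,0),(3203,6,81,0,1,0,1,2,0),(3191,6,82,0,1,0,1,2,0),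
   (3187,6,82,0,1,0,1,2,0),(3181,6,82,0,1,0,1,2,0),(3169,6,82,0,1,0,1,2,0),(3167,6,82,0,1,0,1,2,0),
   (3163,6,82,0,1,0,1,2,0),(3137,6,83,0,1,0,1,2,0),(3121,6,84,0,1,0,1,2,0),(3119,6,84,0,1,0,1,2,0),
   (3109,6,84,0,1,0,1,2,0),(3089,6,84,0,1,0,1,2,0),(3083,6,85,0,1,0,1,2,0),(3079,6,85,0,1,0,1,2,0),
   (3067,6,85,0,1,0,1,2,0),(3061,6,85,0,1,0,1,2,0),(3049,6,86,0,1,0,1,2,0),(3041,6,86,0,1,0,1,2,0),
   (3037,6,86,0,1,0,1,2,0),(3023,6,86,0,1,0,1,2,0),(3019,6,86,0,1,0,1,2,0),(3011,6,87,0,1,0,1,2,0),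
   (3001,6,87,0,1,0,1,2,0),(2999,6,87,0,1,0,1,2,0),(2971,6,88,0,1,0,1,2,0),(2969,6,88,0,1,0,1,2,0),
   (2963,6,88,0,1,0,1,2,0),(2957,6,88,0,1,0,1,2,0),(2953,6,88,0,1,0,1,2,0),(2939,6,89,0,1,0,1,2,0)]"
definition rows10 :: "row list" where "rows10 = [
   (2927,6,89,0,1,0,1,2,0),(2917,6,89,0,1,0,1,2,0),(2909,6,90,0,1,0,1,2,0),(2903,6,90,0,1,0,1,2,0),
   (2897,6,90,0,1,1,1,3,0),(2887,6,90,0,1,0,2,3,0),(2879,6,91,0,1,0,2,3,0),(2861,6,91,0,1,0,2,3,0),
   (2857,6,91,0,1,0,2,3,0),(2851,6,92,0,1,0,2,3,0),(2843,6,92,0,1,0,2,3,0),(2837,6,92,0,1,0,2,3,0),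
   (2833,6,92,0,1,0,2,3,0),(2819,6,93,0,1,0,2,3,0),(2803,6,93,0,1,0,2,3,0),(2801,6,93,0,1,0,2,3,0),
   (2797,6,93,0,1,0,2,3,0),(2791,6,93,0,1,0,2,3,0),(2789,6,94,0,1,0,2,3,0),(2777,6,94,0,1,0,2,3,0),
   (2767,6,94,0,1,0,2,3,0),(2753,6,95,0,1,0,2,3,0),(2749,6,95,0,1,0,2,3,0),(2741,6,95,0,1,0,2,3,0),
   (2731,6,96,0,1,0,2,3,0),(2729,6,96,0,1,0,2,3,0),(2719,6,96,0,1,0,2,3,0),(2713,6,96,0,1,0,2,3,0),
   (2711,6,96,0,1,0,2,3,0),(2707,6,96,0,1,0,2,3,0),(2699,6,97,0,1,0,2,3,0),(2693,6,97,0,1,0,2,3,0),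
   (2689,6,97,0,1,0,2,3,0),(2687,6,97,0,1,0,2,3,0),(2683,6,97,0,1,0,2,3,0),(2677,6,97,0,1,0,2,3,0),
   (2671,6,98,0,1,0,2,3,0),(2663,6,98,0,1,0,2,3,0),(2659,6,98,0,1,0,2,3,0),(2657,6,98,0,1,0,2,3,0)]"
definition rows11 :: "row list" where "rows11 = [
   (2647,6,99,0,1,0,2,3,0),(2633,6,99,0,1,0,2,3,0),(2621,6,100,0,1,0,2,3,0),
   (2617,6,100,0,1,0,2,3,0),(2609,6,100,0,1,0,2,3,0),(2593,6,101,0,1,0,2,3,0),
   (2591,6,101,0,1,0,2,3,0),(2579,6,101,0,1,0,2,3,0),(2557,6,102,0,1,0,2,3,0),
   (2551,6,102,0,1,0,2,3,0),(2549,6,102,0,1,0,2,3,0),(2543,6,103,0,1,0,2,3,0),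
   (2539,6,103,0,1,0,2,3,0),(2531,6,103,0,1,0,2,3,0),(2521,6,104,0,1,0,2,3,0),
   (2503,6,104,0,1,0,2,3,0),(2477,6,105,0,1,0,2,3,0),(2473,6,106,0,1,1,1,3,0),
   (2467,6,106,0,1,0,2,3,0),(2459,6,106,0,1,0,2,3,0),(2447,6,107,0,1,0,2,3,0),
   (2441,6,107,0,1,0,2,3,0),(2437,6,107,0,1,0,2,3,0),(2423,6,108,0,1,0,2,3,0),
   (2417,6,108,0,1,0,2,3,0),(2411,6,108,0,1,0,2,3,0),(2399,6,109,0,1,0,2,3,0),
   (2393,6,109,0,1,0,2,3,0),(2389,6,109,0,1,0,2,3,0),(2383,6,110,0,1,0,2,3,0),
   (2381,6,110,0,1,0,2,3,0),(2377,6,110,0,1,0,2,3,0),(2371,6,110,0,1,0,2,3,0),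
   (2357,6,111,0,1,0,2,3,0),(2351,6,111,0,1,0,2,3,0),(2347,6,111,0,1,0,2,3,0),
   (2341,6,112,0,1,0,2,3,0),(2339,6,112,0,1,0,2,3,0),(2333,6,112,0,1,0,2,3,0),
   (2311,6,113,0,1,0,2,3,0)]"
definition rows12 :: "row list" where "rows12 = [
   (2309,6,113,0,1,0,2,3,0),(2297,6,114,0,1,0,2,3,0),(2293,6,114,0,1,0,2,3,0),
   (2287,6,114,0,1,0,2,3,0),(2281,6,115,0,1,0,2,3,0),(2273,6,115,0,1,0,2,3,0),
   (2269,6,115,0,1,0,2,3,0),(2267,6,115,0,1,0,2,3,0),(2251,6,116,0,1,0,2,3,0),
   (2243,6,116,0,1,0,2,3,0),(2239,6,117,0,1,0,2,3,0),(2237,6,117,0,1,0,2,3,0),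
   (2221,6,118,0,1,0,2,3,0),(2213,6,118,0,1,0,2,3,0),(2207,6,118,0,1,0,2,3,0),
   (2203,6,119,0,1,0,2,3,0),(2179,6,120,0,1,0,2,3,0),(2161,6,121,0,1,0,2,3,0),
   (2153,6,121,0,1,0,2,3,0),(2143,6,122,0,1,0,2,3,0),(2141,6,122,0,1,0,2,3,0),
   (2137,6,122,0,1,0,2,3,0),(2131,6,123,0,1,0,2,3,0),(2129,6,123,0,1,0,2,3,0),
   (2113,6,124,0,1,0,2,3,0),(2111,6,124,0,1,0,2,3,0),(2099,6,125,0,1,0,2,3,0),
   (2089,6,125,0,1,0,2,3,0),(2087,6,125,0,1,0,2,3,0),(2083,6,125,0,1,0,2,3,0),
   (2081,6,126,0,1,0,2,3,0),(2069,6,126,0,1,0,2,3,0),(2063,6,127,0,1,0,2,3,0),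
   (2053,6,127,0,1,0,2,3,0),(2039,6,128,0,1,0,2,3,0),(2029,6,129,0,1,0,2,3,0),
   (2027,6,129,0,1,0,2,3,0),(2017,6,130,0,1,0,2,3,0),(2011,6,130,0,1,0,2,3,0),
   (2003,6,131,0,1,0,2,3,0)]"
definition rows13 :: "row list" where "rows13 = [
   (1999,6,131,0,1,0,2,3,0),(1997,6,131,0,1,0,2,3,0),(1993,6,131,0,1,0,2,3,0),
   (1987,6,132,0,1,0,2,3,0),(1979,6,132,0,1,0,2,3,0),(1973,6,133,0,1,0,2,3,0),
   (1951,6,134,0,1,0,2,3,0),(1949,6,134,0,1,0,2,3,0),(1933,6,135,0,1,0,2,3,1),
   (1931,6,135,0,1,1,2,4,0),(1913,6,137,0,1,0,3,4,0),(1907,6,137,0,1,0,3,4,0),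
   (1901,6,138,0,1,0,3,4,0),(1889,6,138,0,1,0,3,4,0),(1879,6,139,0,1,0,3,4,0),
   (1877,6,139,0,1,0,3,4,0),(1873,6,140,0,1,0,3,4,0),(1871,6,140,0,1,0,3,4,0),
   (1867,6,140,0,1,0,3,4,0),(1861,6,141,0,1,0,3,4,0),(1847,6,142,0,1,0,3,4,0),
   (1831,6,143,0,1,0,3,4,0),(1823,6,143,0,1,0,3,4,0),(1811,6,144,0,1,0,3,4,0),
   (1801,6,145,0,1,0,3,4,0),(1789,6,146,0,1,0,3,4,0),(1787,6,146,0,1,0,3,4,0),
   (1783,6,147,0,1,0,3,4,0),(1777,6,147,0,1,1,2,4,0),(1759,6,149,0,1,0,3,4,0),
   (1753,6,149,0,1,0,3,4,0),(1747,6,150,0,1,0,3,4,0),(1741,6,150,0,1,0,3,4,0),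
   (1733,6,151,0,1,0,3,4,0),(1723,6,152,0,1,0,3,4,0),(1721,6,152,0,1,0,3,4,0),
   (1709,6,153,0,1,0,3,4,0),(1699,6,154,0,1,0,3,4,0),(1697,6,154,0,1,0,3,4,0),
   (1693,6,155,0,1,0,3,4,0)]"
definition rows14 :: "row list" where "rows14 = [
   (1669,6,157,0,1,0,3,4,0),(1667,6,157,0,1,0,3,4,0),(1663,6,157,0,1,0,3,4,0),
   (1657,6,158,0,1,0,3,4,0),(1637,6,160,0,1,0,3,4,0),(1627,6,161,0,1,0,3,4,0),
   (1621,6,161,0,1,0,3,4,0),(1619,6,162,0,1,0,3,4,0),(1613,6,162,0,1,0,3,4,0),
   (1609,6,163,0,1,0,3,4,0),(1607,6,163,0,1,0,3,4,0),(1601,6,163,0,1,0,3,4,0),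
   (1597,6,164,0,1,0,3,4,0),(1583,6,165,0,1,0,3,4,0),(1579,6,166,0,1,0,3,4,0),
   (1571,6,167,0,1,0,3,4,0),(1567,6,167,0,1,0,3,4,0),(1559,6,168,0,1,0,3,4,0),
   (1553,6,169,0,1,0,3,4,0),(1549,6,169,0,1,0,3,4,0),(1543,6,170,0,1,0,3,4,0),
   (1531,6,171,0,1,0,3,4,0),(1523,6,172,0,1,0,3,4,0),(1511,6,173,0,1,0,3,4,0),
   (1499,6,175,0,1,0,3,4,0),(1493,6,175,0,1,0,3,4,0),(1489,6,176,0,1,0,3,4,0),
   (1487,6,176,0,1,0,3,4,0),(1483,6,177,0,1,0,3,4,0),(1481,6,177,0,1,0,3,4,0),
   (1471,6,178,0,1,0,3,4,0),(1459,6,179,0,1,0,3,4,0),(1453,6,180,0,1,0,3,4,0),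
   (1451,6,180,0,1,0,3,4,0),(1447,6,181,0,1,1,3,5,0),(1439,6,182,0,1,0,4,5,0),
   (1433,6,183,0,1,0,4,5,0),(1429,6,183,0,1,0,4,5,0),(1427,6,183,0,1,0,4,5,0),
   (1423,6,184,0,1,0,4,5,0)]"
definition rows15 :: "row list" where "rows15 = [
   (1409,6,186,0,1,0,4,5,0),(1399,6,187,0,1,1,3,5,0),(1381,6,190,0,1,0,4,5,0),
   (1373,6,191,0,1,0,4,5,0),(1367,6,192,0,1,0,4,5,0),(1361,6,192,0,1,0,4,5,0),
   (1327,6,197,0,1,0,4,5,0),(1321,6,198,0,1,0,4,5,0),(1319,6,199,0,1,0,4,5,0),
   (1307,6,200,0,1,0,4,5,0),(1303,6,201,0,1,0,4,5,0),(1301,6,201,0,1,0,4,5,0),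
   (1297,6,202,0,1,0,4,5,0),(1291,6,203,0,1,0,4,5,0),(1289,6,203,0,1,0,4,5,0),
   (1283,6,204,0,1,0,4,5,0),(1279,6,205,0,1,0,4,5,0),(1277,6,205,0,1,0,4,5,0),
   (1259,6,208,0,1,0,4,5,0),(1249,6,210,0,1,0,4,5,0),(1237,6,212,0,1,0,4,5,0),
   (1231,6,213,0,1,0,4,5,0),(1229,6,213,0,1,0,4,5,0),(1223,6,214,0,1,0,4,5,0),
   (1217,6,215,0,1,0,4,5,0),(1213,6,216,0,1,0,4,5,0),(1201,6,218,0,1,0,4,5,0),
   (1193,6,220,0,1,0,4,5,0),(1187,6,221,0,1,0,4,5,0),(1181,6,222,0,1,0,4,5,0),
   (1171,6,224,0,1,0,4,5,0),(1163,6,225,0,1,0,4,5,0),(1153,6,227,0,1,1,4,6,0),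
   (1151,6,228,0,1,1,4,6,0),(1129,6,232,0,1,0,5,6,0),(1123,6,233,0,1,0,5,6,0),
   (1117,6,235,0,1,0,5,6,0),(1109,6,236,0,1,0,5,6,0),(1103,6,238,0,1,0,5,6,0),
   (1097,6,239,0,1,0,5,6,0)]"
definition rows16 :: "row list" where "rows16 = [
   (1093,6,240,0,1,0,5,6,0),(1091,6,240,0,1,0,5,6,0),(1087,6,241,0,1,0,5,6,0),
   (1069,6,245,0,1,0,5,6,0),(1063,6,247,0,1,0,5,6,0),(1061,6,247,0,1,0,5,6,0),
   (1051,6,249,0,1,0,5,6,0),(1049,6,250,0,1,0,5,6,0),(1039,6,252,0,1,0,5,6,0),
   (1033,6,254,0,1,0,5,6,0),(1031,6,254,0,1,0,5,6,0),(1021,6,257,0,1,0,5,6,0),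
   (1019,6,257,0,1,1,4,6,0),(1013,6,259,0,1,0,5,6,0),(1009,6,260,0,1,0,5,6,0),
   (997,6,263,0,1,0,5,6,0),(991,6,265,0,1,0,5,6,0),(983,6,267,0,1,0,5,6,0),(977,6,268,0,1,0,5,6,0),
   (971,6,270,0,1,0,5,6,0),(967,6,271,0,1,0,5,6,1),(953,6,275,0,1,1,5,7,0),(947,6,277,0,1,0,6,7,0),
   (941,6,279,0,1,0,6,7,0),(937,6,280,0,1,0,6,7,0),(929,6,282,0,1,0,6,7,0),(919,6,285,0,1,0,6,7,0),
   (911,6,288,0,1,1,5,7,0),(907,6,289,0,1,0,6,7,0),(887,6,296,0,1,0,6,7,0),(883,6,297,0,1,0,6,7,0),
   (881,6,298,0,1,0,6,7,0),(877,6,299,0,1,0,6,7,0),(863,6,304,0,1,0,6,7,0),(859,6,305,0,1,0,6,7,0),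
   (857,6,306,0,1,0,6,7,0),(853,6,308,0,1,0,6,7,0),(839,6,313,0,1,0,6,7,0),(829,6,316,0,1,0,6,7,1),
   (827,6,317,0,1,2,5,8,0)]"
definition rows17 :: "row list" where "rows17 = [
   (823,6,319,0,1,0,7,8,0),(821,6,320,0,1,0,7,8,0),(811,6,324,0,1,0,7,8,0),(809,6,324,0,1,0,7,8,0),
   (797,6,329,0,1,0,7,8,0),(787,6,333,0,1,0,7,8,0),(773,6,340,0,1,0,7,8,0),(769,6,341,0,1,0,7,8,0),
   (761,6,345,0,1,1,6,8,0),(757,6,347,0,1,0,7,8,0),(751,6,349,0,1,0,7,8,0),(743,6,353,0,1,0,7,8,0),
   (739,6,355,0,1,0,7,8,0),(733,6,358,0,1,0,7,8,0),(727,6,361,0,1,0,7,8,0),(719,6,365,0,1,1,7,9,0),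
   (709,6,370,0,1,0,8,9,0),(701,6,375,0,1,1,7,9,0),(691,6,380,0,1,0,8,9,0),(683,6,384,0,1,0,8,9,0),
   (677,6,388,0,1,0,8,9,0),(673,6,390,0,1,0,8,9,0),(661,6,397,0,1,0,8,9,0),(659,6,399,0,1,0,8,9,0),
   (653,6,402,0,1,1,7,9,0),(647,6,406,0,1,0,8,9,0),(643,6,408,0,1,1,8,10,0),
   (641,6,410,0,1,0,9,10,0),(631,6,416,0,1,0,9,10,0),(619,6,424,0,1,0,9,10,0),
   (617,6,426,0,1,1,8,10,0),(613,6,429,0,1,0,9,10,0),(607,6,433,0,1,0,9,10,0),
   (601,6,437,0,1,0,9,10,0),(599,6,439,0,1,0,9,10,0),(593,6,443,0,1,1,8,10,0),
   (587,6,448,0,1,0,9,10,0),(577,6,455,0,1,1,9,11,0),(571,6,460,0,1,0,10,11,0),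
   (569,6,462,0,1,0,10,11,0)]"
definition rows18 :: "row list" where "rows18 = [
   (563,6,467,0,1,0,10,11,0),(557,6,472,0,1,1,9,11,0),(547,6,481,0,1,0,10,11,0),
   (541,6,486,0,1,0,10,11,0),(523,6,503,0,1,1,10,12,0),(521,6,505,0,1,1,10,12,0),
   (509,6,516,1,2,0,11,12,0),(503,6,522,1,2,0,11,12,0),(499,6,526,1,2,1,10,12,0),
   (491,6,535,1,2,0,11,12,0),(487,6,539,1,2,0,11,12,0),(479,6,548,1,2,1,11,13,0),
   (467,6,562,1,2,1,11,13,0),(463,6,567,1,2,0,12,13,0),(461,6,570,1,2,0,12,13,0),
   (457,6,575,1,2,1,11,13,0),(449,6,585,1,2,0,12,13,0),(443,6,593,1,2,1,12,14,0),
   (439,6,598,1,2,1,12,14,0),(433,6,607,1,2,0,13,14,0),(431,6,610,1,2,0,13,14,0),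
   (421,6,624,1,2,1,12,14,0),(419,6,627,1,2,0,13,14,0),(409,6,643,1,2,1,13,15,0),
   (401,6,656,1,2,1,13,15,0),(397,6,662,1,2,0,14,15,0),(389,6,676,1,2,1,13,15,0),
   (383,6,687,1,2,1,14,16,0),(379,6,694,1,2,1,14,16,0),(373,6,705,1,2,0,15,16,0),
   (367,6,717,1,2,0,15,16,0),(359,6,732,2,3,2,14,17,0),(353,6,744,2,3,1,15,17,0),
   (349,6,753,2,3,0,16,17,0),(347,6,757,2,3,1,15,17,0),(337,6,780,2,3,1,16,18,0),
   (331,6,794,2,3,1,16,18,0),(317,6,830,2,3,1,17,19,0),(313,6,840,2,3,1,17,19,0),
   (311,6,846,2,3,1,17,19,0)]"
definition rows19 :: "row list" where "rows19 = [
   (307,6,857,2,3,0,18,19,0),(293,6,897,3,4,2,17,20,0),(283,6,929,3,4,2,18,21,0),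
   (281,6,936,3,4,1,19,21,0),(277,6,950,3,4,1,19,21,0),(271,6,971,3,4,1,20,22,0),
   (269,6,978,3,4,1,20,22,0),(263,6,1001,3,4,2,20,23,0),(257,6,1024,4,5,1,21,23,0),
   (251,6,1048,4,5,2,21,24,0),(241,6,1092,4,5,3,21,25,0),(239,6,1102,4,5,1,23,25,0),
   (233,6,1130,4,5,1,23,25,0),(229,6,1149,5,6,2,23,26,0),(227,6,1160,5,6,1,24,26,0),
   (223,6,1181,5,6,1,24,26,1),(211,6,1249,5,6,4,23,28,0),(199,6,1324,6,7,3,26,30,0),
   (197,6,1338,6,7,2,27,30,0),(193,6,1365,7,8,2,27,30,1),(191,6,1380,7,8,3,27,31,0),
   (181,6,1456,8,9,2,29,32,1),(179,6,1473,8,9,3,29,33,0),(173,6,1525,8,9,3,30,34,0),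
   (167,6,1579,9,10,4,30,35,0),(163,6,1619,9,10,3,32,36,0),(157,6,1681,10,11,3,33,37,1),
   (151,6,1748,11,12,5,33,39,0),(149,6,1772,11,12,2,36,39,1),(139,6,1900,13,14,6,35,42,0),
   (137,6,1927,14,15,5,37,43,0),(131,6,2017,15,16,5,39,45,0),(127,6,2081,16,17,5,40,46,0),
   (113,6,2341,20,21,11,40,52,0),(109,6,2427,22,23,7,45,53,1),(107,6,2473,23,24,7,46,54,1),
   (103,6,2570,25,26,8,48,57,0),(101,6,2621,26,27,7,50,58,0),(97,6,2731,28,29,8,51,60,1),
   (89,6,2980,33,34,12,52,65,1)]"
definition rows20 :: "row list" where "rows20 = [
   (83,6,3198,38,39,14,55,70,1),(79,6,3361,43,44,13,59,73,1),(73,6,3642,50,51,16,62,79,2),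
   (71,6,3746,53,54,15,66,82,1),(67,6,3973,60,61,17,68,86,2),(61,6,4371,72,73,23,71,95,1),
   (59,6,4522,77,78,20,77,98,2),(53,6,5044,96,97,30,78,109,2),(47,6,5702,123,124,37,85,123,2),
   (43,6,6245,148,149,41,92,134,3),(41,6,6558,163,164,38,101,140,4),
   (37,6,7287,202,203,50,104,155,4),(31,6,8748,291,292,74,110,185,6),
   (29,6,9375,334,335,74,122,197,7),(23,6,11941,542,543,118,128,247,11),
   (19,6,14609,811,812,158,139,298,16),(17,6,16448,1028,1029,176,155,332,20),
   (13,6,21998,1833,1834,276,153,431,34),(11,6,26480,2647,2648,335,169,506,48)]"

definition prime_rows :: "row list" where
  "prime_rows = rows1 @ rows2 @ rows3 @ rows4 @ rows5 @ rows6 @ rows7 @ rows8 @ rows9 @ rows10 @ rows11 @ rows12 @ rows13 @ rows14 @ rows15 @ rows16 @ rows17 @ rows18 @ rows19 @ rows20"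

lemmas prime_rows_defs = prime_rows_def rows1_def rows2_def rows3_def rows4_def rows5_def rows6_def rows7_def rows8_def rows9_def rows10_def rows11_def rows12_def rows13_def rows14_def rows15_def rows16_def rows17_def rows18_def rows19_def rows20_def

section \<open>A sieve showing that the rows list exactly the primes from 11 to 6000\<close>

text \<open>The entry at index \<open>j\<close> of the sieve stands for the odd number \<open>9 + 2 * j\<close>.\<close>

fun strike :: "nat \<Rightarrow> nat \<Rightarrow> bool list \<Rightarrow> bool list" where
  "strike r t [] = []"
| "strike r 0 (x # xs) = False # strike r r xs"
| "strike r (Suc t) (x # xs) = x # strike r t xs"

text \<open>Expands a numeral into nested \<open>Suc\<close>, the form in which the equations of
  \<open>strike\<close> can match their counter.\<close>

definition sucs :: "nat \<Rightarrow> nat \<Rightarrow> nat" where "sucs n x = n + x"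

lemma sucs_rules:
  "sucs 0 x = x" "sucs 1 x = Suc x" "sucs (numeral num.One) x = Suc x"
  "sucs (numeral (num.Bit0 n)) x = sucs (numeral n) (sucs (numeral n) x)"
  "sucs (numeral (num.Bit1 n)) x = Suc (sucs (numeral n) (sucs (numeral n) x))"
  by (simp_all add: sucs_def numeral_Bit0[of n] numeral_Bit1[of n] del: add_numeral_left)

fun strike_all :: "(nat \<times> nat) list \<Rightarrow> bool list \<Rightarrow> bool list" where
  "strike_all [] xs = xs"
| "strike_all ((r, t) # qs) xs = strike_all qs (strike (sucs r 0) (sucs t 0) xs)"

fun survivors :: "nat \<Rightarrow> bool list \<Rightarrow> nat list" where
  "survivors n [] = []"
| "survivors n (True # xs) = n # survivors (n + 2) xs"
| "survivors n (False # xs) = survivors (n + 2) xs"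

text \<open>The accumulator reverses the list into decreasing order, that of
  \<open>prime_rows\<close>.\<close>

fun survivors_acc :: "nat \<Rightarrow> bool list \<Rightarrow> nat list \<Rightarrow> nat list" where
  "survivors_acc n [] acc = acc"
| "survivors_acc n (True # xs) acc = survivors_acc (n + 2) xs (n # acc)"
| "survivors_acc n (False # xs) acc = survivors_acc (n + 2) xs acc"

lemma survivors_acc_eq: "survivors_acc n xs acc = rev (survivors n xs) @ acc"
  by (induction n xs acc rule: survivors_acc.induct) auto

text \<open>The pair for \<open>i\<close> strikes out the odd multiples of \<open>q = 2 * i + 3\<close> from \<open>3 * q\<close> on.\<close>

definition sieve_primes :: "(nat \<times> nat) list" where
  "sieve_primes = map (\<lambda>i. (2 * i + 2, 3 * i)) [0..<38]"

lemma sieve_primes_eq: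
  "sieve_primes = [(2, 0), (4, 3), (6, 6), (8, 9), (10, 12), (12, 15), (14, 18), (16, 21), (18,
    24), (20, 27), (22, 30), (24, 33), (26, 36), (28, 39), (30, 42), (32, 45), (34, 48), (36, 51),
    (38, 54), (40, 57), (42, 60), (44, 63), (46, 66), (48, 69), (50, 72), (52, 75), (54, 78), (56,
    81), (58, 84), (60, 87), (62, 90), (64, 93), (66, 96), (68, 99), (70, 102), (72, 105), (74,
    108), (76, 111)]"
  by (simp add: sieve_primes_def upt_rec)

lemma length_strike [simp]: "length (strike r t xs) = length xs"
  by (induction r t xs rule: strike.induct) auto

lemma nth_strike:
  "j < length xs \<Longrightarrow> strike r t xs ! j \<longleftrightarrow> xs ! j \<and> \<not> (t \<le> j \<and> (j - t) mod Suc r = 0)"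
proof (induction r t xs arbitrary: j rule: strike.induct)
  case (2 r x xs)
  show ?case
  proof (cases j)
    case (Suc i)
    have "strike r r xs ! i \<longleftrightarrow> xs ! i \<and> \<not> (r \<le> i \<and> (i - r) mod Suc r = 0)" using 2 Suc by simp
    moreover have "(r \<le> i \<and> (i - r) mod Suc r = 0) \<longleftrightarrow> Suc i mod Suc r = 0"
    proof (cases "r \<le> i")
      case True
      then have "Suc i = (i - r) + Suc r" by simp
      then show ?thesis using True by (metis mod_add_self2)
    next
      case False
      then show ?thesis by simp
    qed
    ultimately show ?thesis using Suc by simp
  qed simp
next
  case (3 r t x xs)
  then show ?case by (cases j) auto
qed simp

lemma length_sieve [simp]: "length (strike_all qs xs) = length xs"
  by (induction qs xs rule: strike_all.induct) auto

lemma nth_sieve: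
  "j < length xs \<Longrightarrow> strike_all qs xs ! j \<longleftrightarrow> xs ! j \<and> (\<forall>(r, t)\<in>set qs. \<not> (t \<le> j \<and> (j - t) mod Suc r = 0))"
  by (induction qs xs rule: strike_all.induct) (auto simp: nth_strike sucs_def)

lemma set_survivors: "set (survivors n xs) = {n + 2 * j |j. j < length xs \<and> xs ! j}"
proof -
  have ex: "(\<exists>j. P j) \<longleftrightarrow> P 0 \<or> (\<exists>j. P (Suc j))" for P :: "nat \<Rightarrow> bool"
    by (metis not0_implies_Suc)
  have "m \<in> set (survivors n xs) \<longleftrightarrow> (\<exists>j. m = n + 2 * j \<and> j < length xs \<and> xs ! j)" for m
  proof (induction n xs rule: survivors.induct)
    case (2 n xs)
    show ?case unfolding ex[of "\<lambda>j. m = n + 2 * j \<and> _ j"] using 2 by simp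
  next
    case (3 n xs)
    show ?case unfolding ex[of "\<lambda>j. m = n + 2 * j \<and> _ j"] using 3 by simp
  qed simp
  then show ?thesis by blast
qed

lemma distinct_survivors: "distinct (survivors n xs)"
proof (induction n xs rule: survivors.induct)
  case (2 n xs)
  then show ?case by (auto simp: set_survivors)
qed auto

lemma small_primes:
  assumes "prime q" "odd q" "q \<le> 77"
  shows "(q - 1, (3 * q - 9) div 2) \<in> set sieve_primes"
proof -
  have "q \<ge> 3" using prime_ge_2_nat[OF assms(1)] assms(2) by (cases "q = 2") auto
  then have "q = 2 * ((q - 3) div 2) + 3" using assms(2) by presburger
  then obtain i where i: "q = 2 * i + 3" ..
  then have "i < 38" using assms(3) by simp
  then show ?thesis unfolding i by (force simp: sieve_primes_def)
qed

lemma prime_factor_square_le: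
  assumes "\<not> prime n" "n > (1::nat)"
  obtains q where "prime q" "q dvd n" "q * q \<le> n"
proof -
  obtain a b where ab: "n = a * b" "a > 1" "a \<le> b"
  proof -
    obtain a where a: "a dvd n" "a \<noteq> 1" "a \<noteq> n" using assms by (auto simp: prime_nat_iff)
    obtain b where b: "n = a * b" using a(1) by auto
    have "a > 1" "b > 1" using a b assms(2) by (cases a; cases b; auto)+
    then show ?thesis using that[of a b] that[of b a] b by (metis linear mult.commute)
  qed
  obtain q where q: "prime q" "q dvd a" using prime_factor_nat[of a] ab(2) by auto
  have "q \<le> a" using q(2) ab(2) by (intro dvd_imp_le) auto
  then have "q * q \<le> a * b" using ab(3) by (intro mult_le_mono) auto
  then show ?thesis using that[of q] q ab(1) by simp
qed

text \<open>A struck number is q times an odd cofactor of at least 3, hence composite, whether or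
  not q is prime. Conversely an odd composite number up to 6000 has a prime factor q with q^2 <=
  6000 < 78^2, and its cofactor is odd and at least q.\<close>

lemma odd_prime_iff_not_struck:
  assumes n: "n = 9 + 2 * j" "n \<le> 6000"
  shows "prime n \<longleftrightarrow> (\<forall>(r, t)\<in>set sieve_primes. \<not> (t \<le> j \<and> (j - t) mod Suc r = 0))"
proof
  assume "prime n"
  have "\<not> (t \<le> j \<and> (j - t) mod Suc r = 0)" if "(r, t) \<in> set sieve_primes" for r t
  proof
    have rt: "2 * t + 9 = 3 * (r + 1)" "r > 0" using that by (auto simp: sieve_primes_def)
    assume "t \<le> j \<and> (j - t) mod Suc r = 0"
    then obtain i where "j = t + (r + 1) * i" by (metis Suc_eq_plus1 dvd_def le_add_diff_inverse mod_eq_0_iff_dvd)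
    then have "n = (r + 1) * (3 + 2 * i)" using n rt by (simp add: algebra_simps)
    then show False using \<open>prime n\<close> rt(2) prime_product by (metis Suc_eq_plus1 add_eq_0_iff_both_eq_0 numeral_eq_one_iff add_is_1 not_less_zero one_eq_numeral_iff semiring_norm(86) Suc_inject One_nat_def zero_neq_numeral)
  qed
  then show "\<forall>(r, t)\<in>set sieve_primes. \<not> (t \<le> j \<and> (j - t) mod Suc r = 0)" by auto
next
  assume ns: "\<forall>(r, t)\<in>set sieve_primes. \<not> (t \<le> j \<and> (j - t) mod Suc r = 0)"
  show "prime n"
  proof (rule ccontr)
    assume "\<not> prime n"
    then obtain q where q: "prime q" "q dvd n" "q * q \<le> n"
      using prime_factor_square_le[of n] n(1) by auto
    have "q \<le> 77"
    proof (rule ccontr)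
      assume "\<not> q \<le> 77"
      then have "78 * 78 \<le> q * q" by (intro mult_le_mono) auto
      then show False using q(3) n(2) by simp
    qed
    have "odd q" using q(2) n(1) by (metis dvd_trans even_add even_mult_iff odd_numeral even_numeral)
    have "q \<ge> 3" using prime_ge_2_nat[OF q(1)] \<open>odd q\<close> by (cases "q = 2") auto
    have mem: "(q - 1, (3 * q - 9) div 2) \<in> set sieve_primes"
      using q(1) \<open>odd q\<close> \<open>q \<le> 77\<close> by (rule small_primes)
    obtain k where k: "n = q * k" using q(2) by auto
    have "odd n" using n(1) by simp
    then have "odd k" using k by simp
    have "k \<ge> q" using q(3) k \<open>q \<ge> 3\<close> by simp
    define t where "t = (3 * q - 9) div 2"
    have t: "2 * t + 9 = 3 * q" using \<open>odd q\<close> \<open>q \<ge> 3\<close> unfolding t_def by presburger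
    obtain i where i: "k = 3 + 2 * i" using \<open>odd k\<close> \<open>k \<ge> q\<close> \<open>q \<ge> 3\<close>
      by (metis le_Suc_ex oddE odd_add odd_numeral dvdE order_trans even_add)
    have "j = t + q * i" using n(1) k i t by (simp add: algebra_simps)
    then have "t \<le> j" "(j - t) mod Suc (q - 1) = 0" using \<open>q \<ge> 3\<close> by auto
    then show False using ns mem by (auto simp: t_def)
  qed
qed

lemma survivors_eq: "survivors_acc 9 (strike_all sieve_primes (rep 2996 True [])) [] = map fst prime_rows"
  unfolding prime_rows_defs sieve_primes_eq rep_rules strike_all.simps sucs_rules strike.simps survivors_acc.simps
    numeral_plus_numeral add_num_simps append_Cons append_Nil list.map fst_conv
  by (rule refl)

lemma set_prime_rows: "prime_set prime_rows = {p. prime p \<and> 7 < p \<and> p \<le> 6000}" (is "_ = ?S")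
  and distinct_prime_rows: "distinct (map fst prime_rows)"
proof -
  let ?l = "survivors 9 (strike_all sieve_primes (rep 2996 True []))"
  show "distinct (map fst prime_rows)"
    using distinct_survivors[of 9 "strike_all sieve_primes (rep 2996 True [])"] unfolding survivors_eq[symmetric] survivors_acc_eq by simp
  have "prime_set prime_rows = set (map fst prime_rows)" by (simp add: prime_set_def)
  also have "\<dots> = set ?l" unfolding survivors_eq[symmetric] survivors_acc_eq by simp
  also have "\<dots> = ?S"
  proof (intro equalityI subsetI)
    fix p assume "p \<in> set ?l"
    then obtain j where j: "p = 9 + 2 * j" "j < 2996" "strike_all sieve_primes (rep 2996 True []) ! j"
      by (auto simp: set_survivors rep_def)
    then show "p \<in> ?S"
      using odd_prime_iff_not_struck[of p j] nth_sieve[of j "rep 2996 True []" sieve_primes] by (simp add: rep_def)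
  next
    fix p assume p: "p \<in> ?S"
    then have "odd p" using prime_odd_nat[of p] by simp
    then obtain i where i: "p = 2 * i + 1" by (elim oddE)
    have "p \<noteq> 8" using i by presburger
    then obtain j where j: "p = 9 + 2 * j" using p i by (intro that[of "i - 4"]) auto
    moreover have "j < 2996" using p j by auto
    ultimately show "p \<in> set ?l"
      using p odd_prime_iff_not_struck[of p j] nth_sieve[of j "rep 2996 True []" sieve_primes]
      by (auto simp: set_survivors rep_def)
  qed
  finally show "prime_set prime_rows = ?S" .
qed

text \<open>Truncated subtraction is moved across the inequality, so that arithmetic on numerals
  decides every row.\<close>

lemma row_ok_iff:
  "row_ok E (p, k, w, d, v, m, n, u, e) \<longleftrightarrow>
     8 ^ k + (2 * w + (d + v)) \<le> (w + v) * p \<and> 8 ^ k + (2 * w + (d + v)) \<le> v * (p * p)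
     \<and> (w + d) * p \<le> 8 ^ k + (2 * w + (d + v))
     \<and> E * (2 * p + 1) \<le> 2 * p * (p + 1) * u \<and> E * (2 * p) + 2 * p * (u + e) \<le> 2 * p * p * (u + e) + E
     \<and> (m + n) * (2 * p + 1) \<le> 2 * E"
  by (cases p) (auto simp: row_ok_def algebra_simps)

lemma power_8_simps:
  "8 ^ 1 = (8::nat)" "8 ^ 2 = (64::nat)" "8 ^ 3 = (512::nat)" "8 ^ 4 = (4096::nat)" "8 ^ 5 = (32768::nat)" "8 ^ 6 = (262144::nat)"
  by simp_all

lemma nat_zero_one_simps:
  "0 + a = a" "a + 0 = a" "0 * a = 0" "a * 0 = 0" "1 * a = a" "a * 1 = a" "0 \<le> a" for a :: nat
  by simp_all

lemmas row_simps = list.pred_inject append_Cons append_Nil arith_simps rel_simps power_8_simps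
  numeral_plus_one one_plus_numeral one_add_one nat_zero_one_simps simp_thms

lemma prime_rows_ok: "list_all (row_ok 5800) prime_rows"
  by (simp only: prime_rows_defs row_ok_iff row_simps)

lemma total_shift_Cons:
  "total_shift [] = 0" "total_shift ((p, k, w, d, v, m, n, u, e) # rs) = m + total_shift rs"
  by (simp_all add: total_shift_def)

lemma total_shift_prime_rows: "total_shift prime_rows = 1714"
  by (simp only: prime_rows_defs total_shift_Cons row_simps)

section \<open>The initial table and the table for all primes above 7\<close>

definition start_scale :: nat where
  "start_scale = X0 (X0 (X0 (X0 (X0 (X0 (X0 (X0 (X0 (X1 0)))))))))"

definition start_cutoff :: nat where
  "start_cutoff = X0 (X3 (X0 (X1 0)))"

text \<open>Entry j is 8^9 * A * \<rho>^(j + 1) rounded up, with the A and \<rho> of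
  \<open>tabulates_start\<close>; the list ends with the first entry below
  \<open>start_cutoff\<close>.\<close>

definition start_table :: "nat list" where
  "start_table = [
   X1 (X1 (X7 (X4 (X0 (X1 (X2 (X1 (X4 0)))))))),
   X5 (X7 (X6 (X5 (X1 (X5 (X6 (X3 (X1 0)))))))),
   X2 (X5 (X5 (X3 (X2 (X5 (X1 (X4 0))))))),
   X6 (X5 (X7 (X1 (X6 (X7 (X3 (X1 0))))))),
   X7 (X1 (X1 (X4 (X0 (X2 (X4 0)))))),
   X4 (X0 (X3 (X7 (X0 (X4 (X1 0)))))),
   X2 (X1 (X6 (X3 (X2 (X4 0))))),
   X1 (X5 (X0 (X2 (X4 (X1 0))))),
   X4 (X0 (X7 (X2 (X4 0)))),
   X0 (X2 (X3 (X4 (X1 0)))),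
   X4 (X2 (X3 (X4 0))),
   X4 (X4 (X4 (X1 0))),
   X6 (X3 (X4 0))]"

definition final_table :: "nat \<times> nat list" where
  "final_table = run prime_rows start_scale start_cutoff start_table"

text \<open>Chernoff's bound with exponent 6000 for the primes above 6000, as a geometric series.\<close>

lemma tabulates_start:
  assumes "c \<le> 1"
  shows "tabulates start_table (scaled_tail 5800 c M {p. prime p \<and> 6000 < p \<and> p \<le> M} start_scale) 1"
proof -
  \<comment> \<open>A bounds the exponential of the moment term, \<rho> the decay exp (- 6000 /
    5800) over one lattice step.\<close>
  define A \<rho> :: real where "A = 182689/125000" and "\<rho> = 71131/200000"
  \<comment> \<open>Taking a sixteenth of each exponent makes the quadratic Taylor estimates sharp
    enough; the result is raised to the 16th power.\<close>
  define y z :: real where "y = (2 * 6000 + 3 / 2 * 6000\<^sup>2) / (16 * 2999 * 3000) / 16" and "z = 6000 / 5800 / 16"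
  have "exp (16 * y) = exp y ^ 16" by (metis exp_of_nat_mult of_nat_numeral)
  also have "\<dots> \<le> (1 + y + y\<^sup>2) ^ 16" by (intro power_mono exp_bound) (auto simp: y_def)
  also have "\<dots> \<le> A" by (simp add: y_def A_def power2_eq_square power_divide)
  finally have A: "exp ((2 * 6000 + 3 / 2 * 6000\<^sup>2) / (16 * 2999 * 3000)) \<le> A" by (simp add: y_def)
  have "exp (- (6000 / 5800)) = inverse (exp z ^ 16)"
    unfolding exp_minus z_def by (simp add: exp_of_nat_mult[symmetric])
  also have "\<dots> \<le> inverse ((1 + z + z\<^sup>2 / 2) ^ 16)"
    by (intro le_imp_inverse_le power_mono exp_lower_Taylor_quadratic zero_less_power)
      (auto simp: z_def power2_eq_square)
  also have "\<dots> \<le> \<rho>" by (simp add: z_def \<rho>_def power2_eq_square power_divide)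
  finally have \<rho>: "exp (- (6000 / 5800)) \<le> \<rho>" .
  have G: "scaled_tail 5800 c M {p. prime p \<and> 6000 < p \<and> p \<le> M} start_scale (1 + int j) \<le> real start_scale * (A * \<rho> ^ Suc j)" for j
  proof -
    let ?x = "of_int (1 + int j) / real 5800"
    have "tail_prob c M {p. prime p \<and> 2 * 3000 < p \<and> p \<le> M} ?x
      \<le> exp ((2 * 6000 + 3 / 2 * 6000\<^sup>2) / (16 * real (3000 - 1) * real 3000) - 6000 * ?x)"
      using assms by (intro tail_prob_large_primes) auto
    also have "\<dots> = exp ((2 * 6000 + 3 / 2 * 6000\<^sup>2) / (16 * 2999 * 3000)) * exp (- (6000 / 5800)) ^ Suc j"
      by (simp add: exp_of_nat_mult[symmetric] exp_add[symmetric] algebra_simps add_divide_distrib)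
    also have "\<dots> \<le> A * \<rho> ^ Suc j"
      using A \<rho> by (intro mult_mono power_mono) (auto simp: A_def \<rho>_def)
    finally show ?thesis unfolding scaled_tail_def by (intro mult_left_mono) auto
  qed
  have "\<forall>j<length start_table. real start_scale * (A * \<rho> ^ Suc j) \<le> real (start_table ! j)"
    by (simp add: start_table_def start_scale_def X_defs A_def \<rho>_def All_less_Suc)
  moreover have "start_table \<noteq> []" by (simp add: start_table_def)
  ultimately show ?thesis unfolding tabulates_def using G order_trans by blast
qed

lemma tabulates_final:
  assumes "c \<le> 1" "6000 \<le> M"
  shows "tabulates (snd final_table)
    (scaled_tail 5800 c M {p. prime p \<and> 7 < p \<and> p \<le> M} (fst final_table)) (- 1713)"
proof -
  let ?P = "{p. prime p \<and> 6000 < p \<and> p \<le> M}"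
  have "case run prime_rows start_scale start_cutoff start_table of (s', N') \<Rightarrow>
      tabulates N' (scaled_tail 5800 c M (?P \<union> prime_set prime_rows) s') (1 - int (total_shift prime_rows))"
  proof (rule tabulates_run)
    fix r assume r: "r \<in> set prime_rows"
    then have "fst r \<in> prime_set prime_rows" by (simp add: prime_set_def)
    then have "prime (fst r)" "7 < fst r" "fst r \<le> 6000" by (auto simp: set_prime_rows)
    moreover have "row_ok 5800 r" using prime_rows_ok r by (auto simp: list_all_iff)
    ultimately show "row_ok 5800 r \<and> prime (fst r) \<and> odd (fst r) \<and> fst r \<le> M"
      using assms(2) prime_odd_nat[of "fst r"] by auto
  qed (use assms distinct_prime_rows tabulates_start in \<open>auto simp: set_prime_rows\<close>)
  moreover have "?P \<union> prime_set prime_rows = {p. prime p \<and> 7 < p \<and> p \<le> M}"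
    using assms(2) by (auto simp: set_prime_rows)
  ultimately show ?thesis
    unfolding final_table_def[symmetric] total_shift_prime_rows by (simp add: case_prod_beta)
qed

section \<open>Evaluation\<close>

text \<open>The recursion over all rows is evaluated here; \<open>scale_eq\<close> and
  \<open>entry_rules\<close> reuse the result.\<close>

lemmas final_table_eq = final_table_def[unfolded prime_rows_defs append_Cons append_Nil
  start_scale_def start_cutoff_def start_table_def run_rules]

text \<open>The final table is padded so that it ends at index \<open>5 * 8 ^ 4 - 1\<close>; then the fifth octal
  digit of an index tells whether it lies to the left of the table, inside it or to its right.\<close>

definition padded_table :: "nat list" where
  "padded_table = rep 109 (fst final_table) (snd final_table)"

text \<open>The fallback to the last entry makes this a valid bound for every index from 16384 on,
  so the bounds are proved without evaluating the length of the table.\<close>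

definition entry :: "nat \<Rightarrow> nat" where
  "entry j = (if j - 16384 < length padded_table then padded_table ! (j - 16384) else last padded_table)"

definition look :: "nat \<Rightarrow> nat" where
  "look j = (if j div 4096 < 4 then fst final_table else if j div 4096 = 4 then entry j else entry 20479)"

definition pick :: "nat \<Rightarrow> nat \<Rightarrow> nat" where
  "pick q j = (if q < 4 then fst final_table else if q = 4 then entry j else entry 20479)"

lemma look_rules:
  "look j = pick (shift 4 j) j"
  "pick (X1 0) j = fst final_table" "pick (X2 0) j = fst final_table" "pick (X3 0) j = fst final_table"
  "pick (X4 0) j = entry j"
  "pick (X5 0) j = entry (X7 (X7 (X7 (X7 (X4 0)))))" "pick (X6 0) j = entry (X7 (X7 (X7 (X7 (X4 0)))))"
  by (simp_all add: look_def pick_def shift_def X_defs)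

text \<open>Unfolded at the concrete table, this yields one rewrite rule per octal index, so that a
  lookup does not traverse the list.\<close>

fun entries :: "(nat \<Rightarrow> nat) \<Rightarrow> nat \<Rightarrow> nat list \<Rightarrow> bool" where
  "entries f j [] \<longleftrightarrow> True"
| "entries f j (x # xs) \<longleftrightarrow> f j = x \<and> entries f (adc j 0) xs"

lemma entries_nth: "(\<And>i. i < length xs \<Longrightarrow> f (j + i) = xs ! i) \<Longrightarrow> entries f j xs"
proof (induction xs arbitrary: j)
  case (Cons x xs)
  have "f (adc j 0 + i) = xs ! i" if "i < length xs" for i
    using Cons.prems[of "Suc i"] that by (simp add: adc_def)
  then show ?case using Cons.IH Cons.prems[of 0] by simp
qed simp

lemma entries_padded: "entries entry (X0 (X0 (X0 (X0 (X4 0))))) padded_table"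
  by (rule entries_nth) (simp add: entry_def X_defs)

lemmas entry_rules = entries_padded[unfolded padded_table_def final_table_eq fst_conv snd_conv
  rep_rules entries.simps ad_rules simp_thms]

text \<open>The offset 18206 places the start of the padded table, lattice point - 1713 - 109 = -
  1822, at index 16384 = 4 * 8^4.\<close>

lemma scaled_tail_le_look:
  assumes "c \<le> 1" "6000 \<le> M"
  shows "scaled_tail 5800 c M {p. prime p \<and> 7 < p \<and> p \<le> M} (fst final_table) (int j - int 18206) \<le> real (look j)"
proof -
  let ?G = "scaled_tail 5800 c M {p. prime p \<and> 7 < p \<and> p \<le> M} (fst final_table)"
  have anti: "antimono ?G" by (rule antimono_scaled_tail) simp
  have "tabulates padded_table ?G (- 1713 - int 109)"
    unfolding padded_table_def by (rule tabulates_rep[OF tabulates_final[OF assms] scaled_tail_le])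
  then have tab: "tabulates padded_table ?G (- 1822)" by simp
  have entry: "?G (int j - int 18206) \<le> real (entry j)" if "j \<ge> 16384" for j
  proof (cases "j - 16384 < length padded_table")
    case True
    then have "?G (- 1822 + int (j - 16384)) \<le> real (padded_table ! (j - 16384))"
      using tab unfolding tabulates_def by blast
    then show ?thesis using that True by (simp add: entry_def of_nat_diff)
  next
    case False
    then have "?G (- 1822 + int (j - 16384)) \<le> real (last padded_table)"
      by (intro tabulates_last[OF tab anti]) simp
    then show ?thesis using that False by (simp add: entry_def of_nat_diff)
  qed
  consider "j div 4096 < 4" | "j div 4096 = 4" | "j div 4096 > 4" by linarith
  then show ?thesis
  proof cases
    case 1
    then show ?thesis using scaled_tail_le by (simp add: look_def)
  next
    case 2
    then have "j \<ge> 16384" by linarith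
    then show ?thesis using entry 2 by (simp add: look_def)
  next
    case 3
    then have "j \<ge> 20480" by linarith
    then have "?G (int j - int 18206) \<le> ?G (int 20479 - int 18206)" by (intro antimonoD[OF anti]) simp
    also have "\<dots> \<le> real (entry 20479)" by (rule entry) simp
    finally show ?thesis using 3 by (simp add: look_def)
  qed
qed

section \<open>Rational bounds for the logarithms at the primes 2, 3, 5, 7\<close>

text \<open>Six terms of the atanh series, in Horner form for evaluation at rational points; the
  upper bound adds a geometric remainder.\<close>

lemma ln_bounds_atanh:
  fixes x :: real
  assumes "x > 1"
  defines "y \<equiv> (x - 1) / (x + 1)"
  shows "2 * y * (1 + y\<^sup>2 * (1 / 3 + y\<^sup>2 * (1 / 5 + y\<^sup>2 * (1 / 7 + y\<^sup>2 * (1 / 9 + y\<^sup>2 / 11))))) \<le> ln x"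
    and "ln x \<le> 2 * y * (1 + y\<^sup>2 * (1 / 3 + y\<^sup>2 * (1 / 5 + y\<^sup>2 * (1 / 7 + y\<^sup>2 * (1 / 9 + y\<^sup>2 * (1 / 11 + y\<^sup>2 / (1 - y\<^sup>2) / 13))))))"
proof -
  have "(\<Sum>k<6. 2 * y ^ (2 * k + 1) / real (2 * k + 1))
      = 2 * y * (1 + y\<^sup>2 * (1 / 3 + y\<^sup>2 * (1 / 5 + y\<^sup>2 * (1 / 7 + y\<^sup>2 * (1 / 9 + y\<^sup>2 / 11)))))"
    by (simp add: lessThan_nat_numeral distrib_left power2_eq_square power_numeral_reduce mult.assoc)
  moreover have "2 * (y ^ (2 * 6 + 1) / (1 - y\<^sup>2) / real (2 * 6 + 1))
      = 2 * y * (y\<^sup>2 * (y\<^sup>2 * (y\<^sup>2 * (y\<^sup>2 * (y\<^sup>2 * (y\<^sup>2 / (1 - y\<^sup>2) / 13))))))"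
    by (simp add: power2_eq_square power_numeral_reduce mult.assoc)
  moreover have "2 * y * (1 + z * (1 / 3 + z * (1 / 5 + z * (1 / 7 + z * (1 / 9 + z * (1 / 11 + t))))))
      = 2 * y * (1 + z * (1 / 3 + z * (1 / 5 + z * (1 / 7 + z * (1 / 9 + z / 11))))) + 2 * y * (z * (z * (z * (z * (z * t)))))" for z t :: real
    by (simp add: algebra_simps)
  moreover have "ln x \<in> {\<Sum>k<6. 2 * y ^ (2 * k + 1) / real (2 * k + 1)..
      (\<Sum>k<6. 2 * y ^ (2 * k + 1) / real (2 * k + 1)) + 2 * (y ^ (2 * 6 + 1) / (1 - y\<^sup>2) / real (2 * 6 + 1))}"
    unfolding y_def by (rule ln_approx_bounds[OF assms(1), of 6])
  ultimately show "2 * y * (1 + y\<^sup>2 * (1 / 3 + y\<^sup>2 * (1 / 5 + y\<^sup>2 * (1 / 7 + y\<^sup>2 * (1 / 9 + y\<^sup>2 / 11))))) \<le> ln x"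
    and "ln x \<le> 2 * y * (1 + y\<^sup>2 * (1 / 3 + y\<^sup>2 * (1 / 5 + y\<^sup>2 * (1 / 7 + y\<^sup>2 * (1 / 9 + y\<^sup>2 * (1 / 11 + y\<^sup>2 / (1 - y\<^sup>2) / 13))))))"
    by (simp_all only: atLeastAtMost_iff)
qed

text \<open>All bounds are multiples of 1 / 371200, the resolution of the state offsets.\<close>

lemma ln_rational_bounds:
  "ln (8 / 7 :: real) \<le> 49567 / 371200"
  "ln (57 / 49 :: real) \<le> 56137 / 371200"
  "ln (7 / 6 :: real) \<le> 57221 / 371200"
  "ln (6 / 5 :: real) \<le> 33839 / 185600"
  "ln (31 / 25 :: real) \<le> 1597 / 7424"
  "ln (156 / 125 :: real) \<le> 82237 / 371200"
  "ln (5 / 4 :: real) \<le> 82831 / 371200"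
  "ln (4 / 3 :: real) \<le> 26697 / 92800"
  "ln (13 / 9 :: real) \<le> 1365 / 3712"
  "ln (40 / 27 :: real) \<le> 72949 / 185600"
  "ln (121 / 81 :: real) \<le> 74489 / 185600"
  "ln (364 / 243 :: real) \<le> 375 / 928"
  "ln (1093 / 729 :: real) \<le> 150339 / 371200"
  "ln (3 / 2 :: real) \<le> 150509 / 371200"
  "ln (7 / 4 :: real) \<le> 20773 / 37120"
  "ln (15 / 8 :: real) \<le> 11667 / 18560"
  "ln (31 / 16 :: real) \<le> 30689 / 46400"
  "ln (63 / 32 :: real) \<le> 251451 / 371200"
  "ln (127 / 64 :: real) \<le> 50877 / 74240"
  "ln (2 :: real) \<le> 257297 / 371200"
  "24783 / 185600 \<le> ln (8 / 7 :: real)"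
  "7017 / 46400 \<le> ln (57 / 49 :: real)"
  "67677 / 371200 \<le> ln (6 / 5 :: real)"
  "79849 / 371200 \<le> ln (31 / 25 :: real)"
  "20559 / 92800 \<le> ln (156 / 125 :: real)"
  "106787 / 371200 \<le> ln (4 / 3 :: real)"
  "136499 / 371200 \<le> ln (13 / 9 :: real)"
  "145897 / 371200 \<le> ln (40 / 27 :: real)"
  "148977 / 371200 \<le> ln (121 / 81 :: real)"
  "37627 / 92800 \<le> ln (3 / 2 :: real)"
  "207729 / 371200 \<le> ln (7 / 4 :: real)"
  "233339 / 371200 \<le> ln (15 / 8 :: real)"
  "245511 / 371200 \<le> ln (31 / 16 :: real)"
  "5029 / 7424 \<le> ln (63 / 32 :: real)"
  "15899 / 23200 \<le> ln (127 / 64 :: real)"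
  "255843 / 371200 \<le> ln (255 / 128 :: real)"
  "25657 / 37120 \<le> ln (511 / 256 :: real)"
  "256933 / 371200 \<le> ln (1023 / 512 :: real)"
  by (rule order_trans[OF ln_bounds_atanh(2)]; simp add: power2_eq_square | rule order_trans[OF _ ln_bounds_atanh(1)]; simp add: power2_eq_square)+

text \<open>The offsets are octal; \<open>states_eq\<close> gives them in decimal. Weights are
  relative to 7^3 here, to 5^4 and 3^7 for the next two primes, and to 2^8 and 2^6 for the two
  tables of the prime 2.\<close>

definition states7 :: "(nat \<times> nat) list" where
  "states7 = [(245, X5 (X0 (X6 (X7 (X5 (X1 0)))))),
   (42, X6 (X4 (X7 (X6 (X1 0))))),
   (6, X4 (X7 (X0 (X2 0)))),
   (1, 0),
   (42, X3 (X4 (X4 (X0 (X2 (X3 0)))))),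
   (7, X5 (X1 (X3 (X5 (X3 (X3 0))))))]"

definition states5 :: "(nat \<times> nat) list" where
  "states5 = [(375, X7 (X1 (X6 (X1 (X4 (X2 0)))))),
   (100, X1 (X6 (X4 (X5 (X3 0))))),
   (20, X5 (X4 (X6 (X5 0)))),
   (4, X2 (X2 (X1 (X1 0)))),
   (1, 0),
   (100, X4 (X5 (X7 (X5 (X4 (X4 0)))))),
   (20, X0 (X7 (X5 (X5 (X7 (X4 0)))))),
   (5, X3 (X1 (X3 (X2 (X0 (X5 0))))))]"

definition states3 :: "(nat \<times> nat) list" where
  "states3 = [(729, X5 (X5 (X7 (X5 (X4 (X4 0)))))),
   (486, X1 (X1 (X3 (X5 (X2 (X1 0)))))),
   (162, X1 (X7 (X2 (X3 (X3 0))))),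
   (54, X3 (X0 (X0 (X1 (X1 0))))),
   (18, X3 (X7 (X7 (X2 0)))),
   (6, X5 (X7 (X7 0))),
   (2, X2 (X5 (X2 0))),
   (1, 0),
   (486, X0 (X2 (X4 (X6 (X6 (X7 0)))))),
   (162, X0 (X4 (X4 (X0 (X6 (X0 (X1 0))))))),
   (54, X6 (X2 (X7 (X2 (X0 (X1 (X1 0))))))),
   (27, X6 (X3 (X7 (X0 (X1 (X1 (X1 0)))))))]"

definition states2_B :: "(nat \<times> nat) list" where
  "states2_B = [(0, 0),
   (128, X4 (X5 (X7 (X5 (X4 (X4 0)))))),
   (64, X1 (X6 (X5 (X5 (X2 (X6 0)))))),
   (32, X3 (X7 (X5 (X7 (X0 (X7 0)))))),
   (16, X7 (X0 (X4 (X7 (X3 (X7 0)))))),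
   (8, X2 (X7 (X0 (X3 (X5 (X7 0)))))),
   (4, X0 (X6 (X6 (X0 (X6 (X7 0)))))),
   (2, X3 (X4 (X5 (X3 (X6 (X7 0)))))),
   (1, X2 (X7 (X0 (X5 (X6 (X7 0)))))),
   (1, X5 (X4 (X6 (X5 (X6 (X7 0))))))]"

definition states2_C :: "(nat \<times> nat) list" where
  "states2_C = [(0, X1 (X2 (X4 (X6 (X6 (X7 0)))))),
   (32, X4 (X4 (X4 (X0 (X2 (X3 0)))))),
   (16, X7 (X3 (X6 (X0 (X4 (X1 0)))))),
   (8, X5 (X2 (X6 (X6 (X5 0))))),
   (4, X1 (X1 (X0 (X7 (X2 0))))),
   (2, X6 (X2 (X3 (X3 (X1 0))))),
   (1, X0 (X4 (X5 (X5 0)))),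
   (1, 0)]"

lemma states_eq:
  "states7 = states 245 57221 [42, 6, 1] [49567, 56137, 57221] [42, 7] [49566, 56136]"
  "states5 = states 375 82831 [100, 20, 4, 1] [67678, 79850, 82237, 82831] [100, 20, 5] [67677, 79849, 82236]"
  "states3 = states 729 150509 [486, 162, 54, 18, 6, 2, 1] [106788, 136500, 145898, 148978, 150000, 150339, 150509] [486, 162, 54, 27] [106787, 136499, 145897, 148977]"
  "states2_B = states 0 0 [] [] [128, 64, 32, 16, 8, 4, 2, 1, 1] [150508, 207729, 233339, 245511, 251450, 254384, 255843, 256570, 256933]"
  "states2_C = states 0 257297 [32, 16, 8, 4, 2, 1, 1] [150509, 207730, 233340, 245512, 251451, 254385, 257297] [] []"
  by (simp_all add: states7_def states5_def states3_def states2_B_def states2_C_def states_def X_defs)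

lemma log_sigma_pow_eqs:
  "log_sigma_pow 2 (Suc 0) = ln (3 / 2)"
  "log_sigma_pow 2 (Suc (Suc 0)) = ln (7 / 4)"
  "log_sigma_pow 2 (Suc (Suc (Suc 0))) = ln (15 / 8)"
  "log_sigma_pow 2 (Suc (Suc (Suc (Suc 0)))) = ln (31 / 16)"
  "log_sigma_pow 2 (Suc (Suc (Suc (Suc (Suc 0))))) = ln (63 / 32)"
  "log_sigma_pow 2 (Suc (Suc (Suc (Suc (Suc (Suc 0)))))) = ln (127 / 64)"
  "log_sigma_pow 2 (Suc (Suc (Suc (Suc (Suc (Suc (Suc 0))))))) = ln (255 / 128)"
  "log_sigma_pow 2 (Suc (Suc (Suc (Suc (Suc (Suc (Suc (Suc 0)))))))) = ln (511 / 256)"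
  "log_sigma_pow 2 (Suc (Suc (Suc (Suc (Suc (Suc (Suc (Suc (Suc 0))))))))) = ln (1023 / 512)"
  "log_sigma_pow 3 (Suc 0) = ln (4 / 3)"
  "log_sigma_pow 3 (Suc (Suc 0)) = ln (13 / 9)"
  "log_sigma_pow 3 (Suc (Suc (Suc 0))) = ln (40 / 27)"
  "log_sigma_pow 3 (Suc (Suc (Suc (Suc 0)))) = ln (121 / 81)"
  "log_sigma_pow 3 (Suc (Suc (Suc (Suc (Suc 0))))) = ln (364 / 243)"
  "log_sigma_pow 3 (Suc (Suc (Suc (Suc (Suc (Suc 0)))))) = ln (1093 / 729)"
  "log_sigma_pow 5 (Suc 0) = ln (6 / 5)"
  "log_sigma_pow 5 (Suc (Suc 0)) = ln (31 / 25)"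
  "log_sigma_pow 5 (Suc (Suc (Suc 0))) = ln (156 / 125)"
  "log_sigma_pow 7 (Suc 0) = ln (8 / 7)"
  "log_sigma_pow 7 (Suc (Suc 0)) = ln (57 / 49)"
  by (simp_all add: log_sigma_pow_def)

lemma log_sigma_pow_bounds:
  "log_sigma_pow 7 (Suc 0) \<le> 49567 / 371200"
  "log_sigma_pow 7 (Suc (Suc 0)) \<le> 56137 / 371200"
  "24783 / 185600 \<le> log_sigma_pow 7 (Suc 0)"
  "7017 / 46400 \<le> log_sigma_pow 7 (Suc (Suc 0))"
  "log_sigma_pow 5 (Suc 0) \<le> 33839 / 185600"
  "log_sigma_pow 5 (Suc (Suc 0)) \<le> 1597 / 7424"
  "log_sigma_pow 5 (Suc (Suc (Suc 0))) \<le> 82237 / 371200"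
  "67677 / 371200 \<le> log_sigma_pow 5 (Suc 0)"
  "79849 / 371200 \<le> log_sigma_pow 5 (Suc (Suc 0))"
  "20559 / 92800 \<le> log_sigma_pow 5 (Suc (Suc (Suc 0)))"
  "log_sigma_pow 3 (Suc 0) \<le> 26697 / 92800"
  "log_sigma_pow 3 (Suc (Suc 0)) \<le> 1365 / 3712"
  "log_sigma_pow 3 (Suc (Suc (Suc 0))) \<le> 72949 / 185600"
  "log_sigma_pow 3 (Suc (Suc (Suc (Suc 0)))) \<le> 74489 / 185600"
  "log_sigma_pow 3 (Suc (Suc (Suc (Suc (Suc 0))))) \<le> 375 / 928"
  "log_sigma_pow 3 (Suc (Suc (Suc (Suc (Suc (Suc 0)))))) \<le> 150339 / 371200"
  "106787 / 371200 \<le> log_sigma_pow 3 (Suc 0)"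
  "136499 / 371200 \<le> log_sigma_pow 3 (Suc (Suc 0))"
  "145897 / 371200 \<le> log_sigma_pow 3 (Suc (Suc (Suc 0)))"
  "148977 / 371200 \<le> log_sigma_pow 3 (Suc (Suc (Suc (Suc 0))))"
  "37627 / 92800 \<le> log_sigma_pow 2 (Suc 0)"
  "207729 / 371200 \<le> log_sigma_pow 2 (Suc (Suc 0))"
  "233339 / 371200 \<le> log_sigma_pow 2 (Suc (Suc (Suc 0)))"
  "245511 / 371200 \<le> log_sigma_pow 2 (Suc (Suc (Suc (Suc 0))))"
  "5029 / 7424 \<le> log_sigma_pow 2 (Suc (Suc (Suc (Suc (Suc 0)))))"
  "15899 / 23200 \<le> log_sigma_pow 2 (Suc (Suc (Suc (Suc (Suc (Suc 0))))))"
  "255843 / 371200 \<le> log_sigma_pow 2 (Suc (Suc (Suc (Suc (Suc (Suc (Suc 0)))))))"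
  "25657 / 37120 \<le> log_sigma_pow 2 (Suc (Suc (Suc (Suc (Suc (Suc (Suc (Suc 0))))))))"
  "256933 / 371200 \<le> log_sigma_pow 2 (Suc (Suc (Suc (Suc (Suc (Suc (Suc (Suc (Suc 0)))))))))"
  "log_sigma_pow 2 (Suc 0) \<le> 150509 / 371200"
  "log_sigma_pow 2 (Suc (Suc 0)) \<le> 20773 / 37120"
  "log_sigma_pow 2 (Suc (Suc (Suc 0))) \<le> 11667 / 18560"
  "log_sigma_pow 2 (Suc (Suc (Suc (Suc 0)))) \<le> 30689 / 46400"
  "log_sigma_pow 2 (Suc (Suc (Suc (Suc (Suc 0))))) \<le> 251451 / 371200"
  "log_sigma_pow 2 (Suc (Suc (Suc (Suc (Suc (Suc 0)))))) \<le> 50877 / 74240"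
  by (simp_all only: log_sigma_pow_eqs ln_rational_bounds)

lemmas log_bounds = log_sigma_pow_bounds[simplified] ln_rational_bounds[simplified]
  log_sigma_pow_bounds[unfolded le_divide_eq_numeral1 divide_le_eq_numeral1 mult.commute[of "log_sigma_pow p k" for p k]]

section \<open>Adding the primes 7, 5, 3 and 2\<close>

lemma dominates_base:
  assumes "c \<le> 1" "6000 \<le> M"
  shows "dominates 5800 c M {p. prime p \<and> 7 < p \<and> p \<le> M} (fst final_table) look [] 1 1165184"
  using dominates_Nil[of 5800 c M _ _ 18206 look] scaled_tail_le_look[OF assms] by simp

lemma capped_val_odd: "capped_val 2 M (Suc (2 * n)) = 0"
proof -
  have "\<not> 2 ^ j dvd Suc (2 * n)" if "j \<ge> 1" for j
    using that dvd_trans[of 2 "2 ^ j" "Suc (2 * n)"] by (cases j) auto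
  then have "{j \<in> {1..M}. 2 ^ j dvd Suc (2 * n)} = {}" by auto
  then show ?thesis by (simp add: capped_val_def)
qed

lemma dominates_7:
  assumes "c \<le> 1" "6000 \<le> M"
  shows "dominates 5800 c M (insert 7 {p. prime p \<and> 7 < p \<and> p \<le> M}) (fst final_table) look [states7] 343 1107963"
proof -
  have "dominates 5800 c M (insert 7 {p. prime p \<and> 7 < p \<and> p \<le> M}) (fst final_table) look
    (states 245 57221 [42, 6, 1] [49567, 56137, 57221] [42, 7] [49566, 56136] # []) (343 * 1) (1165184 - 57221)"
  proof (rule dominates_Cons)
    show "dominates 5800 c M {p. prime p \<and> 7 < p \<and> p \<le> M} (fst final_table) look [] 1 1165184"
      by (rule dominates_base[OF assms])
  qed (use assms in \<open>auto simp: less_Suc_eq div_prob_odd log_bounds\<close>)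
  then show ?thesis by (simp add: states_eq)
qed

lemma dominates_5:
  assumes "c \<le> 1" "6000 \<le> M"
  shows "dominates 5800 c M (insert 5 (insert 7 {p. prime p \<and> 7 < p \<and> p \<le> M})) (fst final_table) look [states5, states7] 214375 1025132"
proof -
  have "dominates 5800 c M (insert 5 (insert 7 {p. prime p \<and> 7 < p \<and> p \<le> M})) (fst final_table) look
    (states 375 82831 [100, 20, 4, 1] [67678, 79850, 82237, 82831] [100, 20, 5] [67677, 79849, 82236] # [states7]) (625 * 343) (1107963 - 82831)"
  proof (rule dominates_Cons)
    show "dominates 5800 c M (insert 7 {p. prime p \<and> 7 < p \<and> p \<le> M}) (fst final_table) look [states7] 343 1107963"
      by (rule dominates_7[OF assms])
  qed (use assms in \<open>auto simp: less_Suc_eq div_prob_odd log_bounds\<close>)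
  then show ?thesis by (simp add: states_eq)
qed

lemma dominates_3:
  assumes "c \<le> 1" "6000 \<le> M"
  shows "dominates 5800 c M (insert 3 (insert 5 (insert 7 {p. prime p \<and> 7 < p \<and> p \<le> M}))) (fst final_table) look [states3, states5, states7] 468838125 874623"
proof -
  have "dominates 5800 c M (insert 3 (insert 5 (insert 7 {p. prime p \<and> 7 < p \<and> p \<le> M}))) (fst final_table) look
    (states 729 150509 [486, 162, 54, 18, 6, 2, 1] [106788, 136500, 145898, 148978, 150000, 150339, 150509] [486, 162, 54, 27] [106787, 136499, 145897, 148977] # [states5, states7]) (2187 * 214375) (1025132 - 150509)"
  proof (rule dominates_Cons)
    show "dominates 5800 c M (insert 5 (insert 7 {p. prime p \<and> 7 < p \<and> p \<le> M})) (fst final_table) look [states5, states7] 214375 1025132"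
      by (rule dominates_5[OF assms])
  qed (use assms in \<open>auto simp: less_Suc_eq div_prob_odd log_bounds\<close>)
  then show ?thesis by (simp add: states_eq)
qed

text \<open>2 * n + 1 is odd, so there are no upward states, and 2 * n is even, so the state without
  a factor 2 has weight 0. Orders of at least 9 share the lower bound for ln (1023 / 512).\<close>

lemma dominates_2B:
  assumes "6000 \<le> M"
  shows "dominates 5800 1 M (insert 2 (insert 3 (insert 5 (insert 7 {p. prime p \<and> 7 < p \<and> p \<le> M})))) (fst final_table) look [states2_B, states3, states5, states7] 120022560000 874623"
proof -
  have "dominates 5800 1 M (insert 2 (insert 3 (insert 5 (insert 7 {p. prime p \<and> 7 < p \<and> p \<le> M})))) (fst final_table) look
    (states 0 0 [] [] [128, 64, 32, 16, 8, 4, 2, 1, 1] [150508, 207729, 233339, 245511, 251450, 254384, 255843, 256570, 256933] # [states3, states5, states7]) (256 * 468838125) (874623 - 0)"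
  proof (rule dominates_Cons)
    show "dominates 5800 1 M (insert 3 (insert 5 (insert 7 {p. prime p \<and> 7 < p \<and> p \<le> M}))) (fst final_table) look [states3, states5, states7] 468838125 874623"
      by (rule dominates_3[OF _ assms]) simp
  qed (use assms in \<open>auto simp: less_Suc_eq div_prob_two_0 capped_val_odd log_bounds\<close>)
  then show ?thesis by (simp add: states_eq)
qed

text \<open>With the roles exchanged only upward states occur; orders of at least 7 share the upper
  bound for ln 2.\<close>

lemma dominates_2C:
  assumes "6000 \<le> M"
  shows "dominates 5800 0 M (insert 2 (insert 3 (insert 5 (insert 7 {p. prime p \<and> 7 < p \<and> p \<le> M})))) (fst final_table) look [states2_C, states3, states5, states7] 30005640000 617326"
proof -
  have "dominates 5800 0 M (insert 2 (insert 3 (insert 5 (insert 7 {p. prime p \<and> 7 < p \<and> p \<le> M})))) (fst final_table) look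
    (states 0 257297 [32, 16, 8, 4, 2, 1, 1] [150509, 207730, 233340, 245512, 251451, 254385, 257297] [] [] # [states3, states5, states7]) (64 * 468838125) (874623 - 257297)"
  proof (rule dominates_Cons)
    show "dominates 5800 0 M (insert 3 (insert 5 (insert 7 {p. prime p \<and> 7 < p \<and> p \<le> M}))) (fst final_table) look [states3, states5, states7] 468838125 874623"
      by (rule dominates_3[OF _ assms]) simp
  qed (use assms in \<open>auto simp: less_Suc_eq div_prob_two_0 capped_val_odd log_bounds\<close>)
  then show ?thesis by (simp add: states_eq)
qed

text \<open>\<open>start_B\<close> is 874622 and \<open>start_C\<close> is 617325, each one step
  below the index of the threshold 0; this is the threshold - 1 / 371200 = - 2 \<delta>.\<close>

definition start_B :: nat where "start_B = X6 (X7 (X1 (X4 (X5 (X2 (X3 0))))))"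
definition start_C :: nat where "start_C = X5 (X5 (X5 (X5 (X6 (X2 (X2 0))))))"

definition value_B :: nat where
  "value_B = lookup_sum look [states2_B, states3, states5, states7] start_B"

definition value_C :: nat where
  "value_C = lookup_sum look [states2_C, states3, states5, states7] start_C"

lemmas scale_eq = arg_cong[OF final_table_eq, of fst, unfolded fst_conv]

lemmas evaluation_rules = states2_B_def states2_C_def states3_def states5_def states7_def lookup_rules
  look_rules shift_rules sh_rules ad_rules mul_rules scale_eq

lemma final_scale_pos: "real (fst final_table) > 0"
  unfolding scale_eq by (simp add: X_defs)

lemma all_primes_eq:
  assumes "6000 \<le> M"
  shows "insert 2 (insert 3 (insert 5 (insert 7 {p. prime p \<and> 7 < p \<and> p \<le> M}))) = {p::nat. prime p \<and> p \<le> M}"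
proof (intro equalityI subsetI)
  fix p assume "p \<in> {p::nat. prime p \<and> p \<le> M}"
  then have p: "prime p" "p \<le> M" by auto
  show "p \<in> insert 2 (insert 3 (insert 5 (insert 7 {p. prime p \<and> 7 < p \<and> p \<le> M})))"
  proof (cases "7 < p")
    case False
    then have "p \<in> {0, 1, 2, 3, 4, 5, 6, 7}" by auto
    then show ?thesis using p(1) by auto
  qed (use p in auto)
qed (use assms in auto)

lemma value_B_le: "real value_B \<le> 0.0549444 * (real 120022560000 * real (fst final_table))"
  by (simp only: value_B_def start_B_def evaluation_rules entry_rules) (simp add: X_defs)

lemma excess_B:
  assumes "6000 \<le> M"
  shows "avg (modulus M) (\<lambda>n. of_bool (excess 1 M n \<ge> - 2 * (1 / 742400))) \<le> 0.0549444"
proof -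
  have primes: "insert 2 (insert 3 (insert 5 (insert 7 {p. prime p \<and> 7 < p \<and> p \<le> M}))) = {p. prime p \<and> p \<le> M}"
    by (rule all_primes_eq[OF assms])
  have "real (120022560000 * fst final_table) * tail_prob 1 M {p. prime p \<and> p \<le> M} ((real start_B - real 874623) / (64 * real 5800)) \<le> real value_B"
    using dominates_2B[OF assms] unfolding dominates_def value_B_def primes by blast
  also have "\<dots> \<le> 0.0549444 * (real 120022560000 * real (fst final_table))" by (rule value_B_le)
  finally have "tail_prob 1 M {p. prime p \<and> p \<le> M} ((real start_B - real 874623) / (64 * real 5800)) \<le> 0.0549444"
    using final_scale_pos by (simp add: mult_ac)
  moreover have "(real start_B - real 874623) / (64 * real 5800) = - 2 * (1 / 742400)"
    by (simp add: start_B_def X_defs)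
  ultimately show ?thesis unfolding tail_prob_def excess_eq_part_excess by (simp only:)
qed

lemma value_C_le: "real value_C \<le> 0.9460828 * (real 30005640000 * real (fst final_table))"
  by (simp only: value_C_def start_C_def evaluation_rules entry_rules) (simp add: X_defs)

lemma excess_C:
  assumes "6000 \<le> M"
  shows "avg (modulus M) (\<lambda>n. of_bool (excess 0 M n \<ge> - 2 * (1 / 742400))) \<le> 0.9460828"
proof -
  have primes: "insert 2 (insert 3 (insert 5 (insert 7 {p. prime p \<and> 7 < p \<and> p \<le> M}))) = {p. prime p \<and> p \<le> M}"
    by (rule all_primes_eq[OF assms])
  have "real (30005640000 * fst final_table) * tail_prob 0 M {p. prime p \<and> p \<le> M} ((real start_C - real 617326) / (64 * real 5800)) \<le> real value_C"
    using dominates_2C[OF assms] unfolding dominates_def value_C_def primes by blast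
  also have "\<dots> \<le> 0.9460828 * (real 30005640000 * real (fst final_table))" by (rule value_C_le)
  finally have "tail_prob 0 M {p. prime p \<and> p \<le> M} ((real start_C - real 617326) / (64 * real 5800)) \<le> 0.9460828"
    using final_scale_pos by (simp add: mult_ac)
  moreover have "(real start_C - real 617326) / (64 * real 5800) = - 2 * (1 / 742400)"
    by (simp add: start_C_def X_defs)
  ultimately show ?thesis unfolding tail_prob_def excess_eq_part_excess by (simp only:)
qed

theorem theorem1:
  shows "\<exists>d::real. has_natural_density B d \<and> 0.0539171 \<le> d \<and> d \<le> 0.0549445"
proof (rule has_natural_density_between)
  \<comment> \<open>M = 2 * 742400 * 10^7 makes the truncation error 2 / (M * \<delta>) equal to
    10^-7, the difference between the computed bounds and the claimed ones.\<close>
  define M :: nat where "M = 14848000000000"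
  have M: "6000 \<le> M" "M > 0" "2 / (real M * (1 / 742400)) \<le> 1 / 10 ^ 7" by (simp_all add: M_def)
  show "upper_density_le B 0.0549445"
    using M(2) by (intro upper_density_le_subset[OF upper_density_B[of M "1 / 742400"] subset_refl]
        order_trans[OF add_mono[OF excess_B[OF M(1)] M(3)]]) simp_all
  show "upper_density_le (- B) (1 - 0.0539171)"
    using M(2) by (intro upper_density_le_subset[OF upper_density_compl_B[of M "1 / 742400"] subset_refl]
        order_trans[OF add_mono[OF excess_C[OF M(1)] M(3)]]) simp_all
qed (rule density_gap_B)

end
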